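(* Let $\varphi(q)=\sum_{n=-\infty}^{\infty}q^{n^2}$ for $|q|<1$. Then \[ \varphi(e^{-\pi\sqrt{37}}) = 2^{-1/4}(37)^{-1/4}\pi^{-1/4}(6 + \sqrt{37})^{3/8}\Bigg\{\prod_{m = 1}^{148} \Gamma\bigg(\frac{m}{148}\bigg)^{\left(\frac{-148}{m}\right)}\Bigg\}^{1/8}, \] where $\left(\frac{-148}{m}\right)$ denotes the Kronecker symbol and $\Gamma$ is the gamma function. *)

theory Defs
  imports "HOL-Analysis.Analysis" "HOL-Number_Theory.Number_Theory"
begin

text \<open>Ramanujan's theta function \<open>\<phi>\<close>. The series over all integers converges absolutely
  for \<open>norm q < 1\<close>, which is the range in which the definition is used.\<close>

definition ramanujan_phi :: "'a :: {real_normed_field, banach} \<Rightarrow> 'a" where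
  "ramanujan_phi q = (\<Sum>\<^sub>\<infinity>n\<in>(UNIV :: int set). q powi (n ^ 2))"

text \<open>The Kronecker symbol at a prime: the Legendre symbol for odd \<open>p\<close>, and the usual
  extension for \<open>p = 2\<close> (where the Legendre symbol of the library would only record
  whether \<open>a\<close> is odd).\<close>

definition kronecker_prime :: "int \<Rightarrow> int \<Rightarrow> int" where
  "kronecker_prime a p =
     (if p = 2 then (if even a then 0 else if a mod 8 \<in> {1, 7} then 1 else -1)
      else Legendre a p)"

text \<open>Extended completely multiplicatively in the lower argument, with the standard values at
  \<open>n = 0\<close> and at the unit \<open>n = -1\<close>. Note that \<open>prime_factors n\<close> contains only positive primes.\<close>

definition kronecker_symbol :: "int \<Rightarrow> int \<Rightarrow> int" where
  "kronecker_symbol a n =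
     (if n = 0 then (if \<bar>a\<bar> = 1 then 1 else 0)
      else (if n < 0 \<and> a < 0 then -1 else 1) *
           (\<Prod>p\<in>prime_factors n. kronecker_prime a p ^ multiplicity p n))"

end

theory Submission
  imports Defs "HOL-Real_Asymp.Real_Asymp"
begin

text \<open>
The idea is to evaluate, for both reduced forms of discriminant \<open>-148\<close>, namely
\<open>x\<^sup>2 + 37 y\<^sup>2\<close> and \<open>2 x\<^sup>2 + 2 x y + 19 y\<^sup>2\<close>, the sum over the nonzero lattice points of
\<open>w z n = 2 / n - 2 n / (n\<^sup>2 + z\<^sup>2)\<close> at the values \<open>n\<close> of the form, as \<open>z \<rightarrow> \<infinity>\<close>. The cut-off \<open>z\<close>
takes the place of the complex variable in Kronecker's limit formula.

Summing over the lattice row by row with the partial fractions of the cotangent gives \<open>ln z\<close>,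
explicit constants and the logarithm of an Euler product at \<open>q\<^sup>2\<close>, respectively \<open>- q\<close>, where
\<open>q = exp (- \<pi> \<surd>37)\<close>.

Since each genus contains a single class, the number of representations is
a divisor sum. For the sum of the two forms it involves the character modulo \<open>148\<close>; its Gauss sum
and partial fractions turn the weighted sum into a sum of a rational function of an
exponential, whose constant term contains \<open>\<Sum> \<chi>(m) ln \<Gamma>(m / 148)\<close>. For the difference it involves the
characters modulo \<open>4\<close> and \<open>37\<close>, and the limit is a multiple of
\<open>L(1, \<chi>\<^sub>3\<^sub>7) = 2 ln (6 + \<surd>37) / \<surd>37\<close>. Both Euler products are thereby determined, and by the
Jacobi triple product \<open>\<phi> q\<close> is a quotient of them.
\<close>

section \<open>Representations by forms of discriminant -148\<close>

text \<open>Over a two-dimensional lattice the reciprocals of the values diverge logarithmically. As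
  \<open>w z n\<close> equals \<open>2 * z\<^sup>2 / (n * (n\<^sup>2 + z\<^sup>2))\<close>, the
  cut-off sums converge absolutely for each real \<open>z\<close>, so that they may be regrouped at
  will by rows, by values or by divisor pairs; the divergence reappears as a multiple of
  \<open>ln z\<close>. Moreover the weight has partial fractions, in \<open>n\<close> for the
  character sums and in the horizontal variable for each row, so that cotangents sum it in both
  cases. Let \<open>X1\<close> and \<open>X2\<close> be the normalised constant terms of the two
  lattice sums. They contain twice the logarithms of the two Euler products, and the logarithm of
  \<phi> is X1/2 - X2 up to elementary constants, which is -(X1 + X2)/4 + 3 (X1 - X2)/4. The sum
  contributes -1/2 times the Gamma sum and the difference is half the logarithm of 6 + \<surd>37:
  hence the exponents 1/8 and 3/8. The square of the Gauss sum modulo 37 leaves a sign open. The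
  value of L(1) is the same for both signs, and for modulus 148 the growth in \<open>z\<close>
  decides.\<close>

definition chi4 :: "nat \<Rightarrow> int" where
  "chi4 n = (if even n then 0 else if n mod 4 = 1 then 1 else -1)"

definition chi37 :: "nat \<Rightarrow> int" where
  "chi37 n = Legendre (int n) 37"

definition chi148 :: "nat \<Rightarrow> int" where
  "chi148 n = chi4 n * chi37 n"

text \<open>Since \<open>2 (2 x\<^sup>2 + 2 x y + 19 y\<^sup>2) = (2 x + y)\<^sup>2 + 37 y\<^sup>2\<close>, the number of representations of \<open>n\<close>
  by the second form is \<open>rep (2 n)\<close>, so that a single form suffices.\<close>

definition norm_set :: "nat \<Rightarrow> (int \<times> int) set" where
  "norm_set n = {(x, y). x\<^sup>2 + 37 * y\<^sup>2 = int n}"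

definition rep :: "nat \<Rightarrow> nat" where
  "rep n = card (norm_set n)"

lemma in_norm_set [simp]: "(x, y) \<in> norm_set n \<longleftrightarrow> x\<^sup>2 + 37 * y\<^sup>2 = int n"
  by (simp add: norm_set_def)

lemma abs_le_square_int: "\<bar>x\<bar> \<le> x\<^sup>2" for x :: int
proof (cases "x = 0")
  case False
  then have "1 * \<bar>x\<bar> \<le> \<bar>x\<bar> * \<bar>x\<bar>" by (intro mult_right_mono) auto
  then show ?thesis by (simp add: power2_eq_square)
qed auto

lemma finite_norm_set: "finite (norm_set n)"
proof (rule finite_subset)
  show "norm_set n \<subseteq> {- int n..int n} \<times> {- int n..int n}"
  proof safe
    fix x y :: int assume "(x, y) \<in> norm_set n"
    then have e: "x\<^sup>2 + 37 * y\<^sup>2 = int n" by simp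
    have "\<bar>x\<bar> \<le> int n" "\<bar>y\<bar> \<le> int n"
      using e abs_le_square_int[of x] abs_le_square_int[of y] zero_le_power2[of x] zero_le_power2[of y]
      by linarith+
    then show "x \<in> {- int n..int n}" "y \<in> {- int n..int n}" by auto
  qed
qed auto

text \<open>Modulo 4 the form is \<open>x\<^sup>2 + y\<^sup>2\<close>, which is divisible by 4 only
  when both entries are even, so that halving is possible. Consequently \<open>rep n\<close> and
  \<open>rep (2 * n)\<close> change places when \<open>n\<close> is doubled.\<close>

lemma rep_4: "rep (4 * n) = rep n"
proof -
  have "bij_betw (\<lambda>(x, y). (2 * x, 2 * y)) (norm_set n) (norm_set (4 * n))"
    unfolding bij_betw_def
  proof
    show "inj_on (\<lambda>(x, y). (2 * x, 2 * y)) (norm_set n)" by (auto simp: inj_on_def)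
    show "(\<lambda>(x, y). (2 * x, 2 * y)) ` norm_set n = norm_set (4 * n)"
    proof safe
      fix x y :: int assume "(x, y) \<in> norm_set n"
      then show "(2 * x, 2 * y) \<in> norm_set (4 * n)" by (simp add: power2_eq_square)
    next
      fix x y :: int assume "(x, y) \<in> norm_set (4 * n)"
      then have e: "x\<^sup>2 + 37 * y\<^sup>2 = 4 * int n" by simp
      obtain a b where ab: "x = 2 * a \<or> x = 2 * a + 1" "y = 2 * b \<or> y = 2 * b + 1"
        by (meson oddE evenE)
      have "x = 2 * a \<and> y = 2 * b"
      proof -
        have False if "x = 2 * a + 1" "y = 2 * b"
        proof -
          have "2 * (2 * int n - 2 * a^2 - 2 * a - 74 * b^2) = 1"
            using e that by (simp add: power2_eq_square algebra_simps)
          then have "even (1 :: int)" by (metis dvd_triv_left)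
          then show False by simp
        qed
        moreover have False if "x = 2 * a" "y = 2 * b + 1"
        proof -
          have "2 * (2 * int n - 2 * a^2 - 74 * b - 74 * b^2) = 37"
            using e that by (simp add: power2_eq_square algebra_simps)
          then have "even (37 :: int)" by (metis dvd_triv_left)
          then show False by simp
        qed
        moreover have False if "x = 2 * a + 1" "y = 2 * b + 1"
        proof -
          have "2 * (int n - a^2 - a - 37 * b - 37 * b^2) = 19"
            using e that by (simp add: power2_eq_square algebra_simps)
          then have "even (19 :: int)" by (metis dvd_triv_left)
          then show False by simp
        qed
        ultimately show ?thesis using ab by blast
      qed
      then show "(x, y) \<in> (\<lambda>(x, y). (2 * x, 2 * y)) ` norm_set n"
        using e by (intro image_eqI[of _ _ "(a, b)"]) (auto simp: power2_eq_square)
    qed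
  qed
  then show ?thesis unfolding rep_def by (simp add: bij_betw_same_card)
qed

text \<open>Up to a sign the map is multiplication of x + y \<surd>(-37) by \<surd>(-37). It is onto
  because 37 divides \<open>x\<close> whenever it divides the norm.\<close>

lemma rep_37: "rep (37 * n) = rep n"
proof -
  have "bij_betw (\<lambda>(x, y). (37 * y, x)) (norm_set n) (norm_set (37 * n))"
    unfolding bij_betw_def
  proof
    show "inj_on (\<lambda>(x, y). (37 * y, x)) (norm_set n)" by (auto simp: inj_on_def)
    show "(\<lambda>(x, y). (37 * y, x)) ` norm_set n = norm_set (37 * n)"
    proof safe
      fix x y :: int assume "(x, y) \<in> norm_set n"
      then show "(37 * y, x) \<in> norm_set (37 * n)" by (auto simp: power2_eq_square algebra_simps)
    next
      fix x y :: int assume "(x, y) \<in> norm_set (37 * n)"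
      then have e: "x\<^sup>2 + 37 * y\<^sup>2 = 37 * int n" by simp
      have "prime (37 :: int)" by simp
      moreover have "37 dvd x\<^sup>2"
        using e by (metis dvd_add_times_triv_right_iff dvd_triv_left mult.commute)
      ultimately have "37 dvd x" using prime_dvd_power by blast
      then obtain k where "x = 37 * k" by blast
      then show "(x, y) \<in> (\<lambda>(x, y). (37 * y, x)) ` norm_set n"
        using e by (intro image_eqI[of _ _ "(y, k)"]) (auto simp: power2_eq_square)
    qed
  qed
  then show ?thesis unfolding rep_def by (simp add: bij_betw_same_card)
qed

section \<open>Multiples of an odd prime: inert and split primes\<close>

definition rep_div :: "nat \<Rightarrow> nat \<Rightarrow> nat" where
  "rep_div p n = (if p dvd n then rep (n div p) else 0)"

text \<open>Dividing both entries by \<open>p\<close> divides the norm by \<open>p\<^sup>2\<close>.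
  These pairs are all representations when \<open>p\<close> is inert, and the overlap of two
  families when \<open>p\<close> splits; the parameter \<open>k\<close> serves both forms at
  once.\<close>

lemma card_norm_set_dvd:
  assumes p: "prime p" and k: "k \<in> {1, 2}" "p \<noteq> 2"
  shows "card {(x, y) \<in> norm_set (k * p * n). int p dvd x \<and> int p dvd y} = rep_div p (k * n)"
proof (cases "p dvd n")
  case True
  then obtain m where m: "n = p * m" by blast
  have p0: "p > 0" using p prime_gt_0_nat by blast
  have "bij_betw (\<lambda>(x, y). (int p * x, int p * y)) (norm_set (k * m))
          {(x, y) \<in> norm_set (k * p * n). int p dvd x \<and> int p dvd y}"
    unfolding bij_betw_def
  proof
    show "inj_on (\<lambda>(x, y). (int p * x, int p * y)) (norm_set (k * m))"
      using p0 by (auto simp: inj_on_def)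
    show "(\<lambda>(x, y). (int p * x, int p * y)) ` norm_set (k * m) =
          {(x, y) \<in> norm_set (k * p * n). int p dvd x \<and> int p dvd y}"
    proof safe
      fix x y :: int assume "(x, y) \<in> norm_set (k * m)"
      then have "x^2 + 37 * y^2 = int k * int m" by simp
      then have "int p * int p * (x^2 + 37 * y^2) = int p * int p * (int k * int m)" by simp
      then show "(int p * x, int p * y) \<in> norm_set (k * p * n)"
        by (simp add: m power2_eq_square algebra_simps)
    next
      fix x y :: int assume a: "(x, y) \<in> norm_set (k * p * n)" "int p dvd x" "int p dvd y"
      then obtain u v where uv: "x = int p * u" "y = int p * v" by blast
      have "int p * int p * (u^2 + 37 * v^2) = int p * int p * (int k * int m)"
        using a uv m by (simp add: power2_eq_square algebra_simps)
      then have "u^2 + 37 * v^2 = int k * int m" using p0 by simp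
      then show "(x, y) \<in> (\<lambda>(x, y). (int p * x, int p * y)) ` norm_set (k * m)"
        using uv by (intro image_eqI[of _ _ "(u, v)"]) auto
    qed auto
  qed
  then have "card {(x, y) \<in> norm_set (k * p * n). int p dvd x \<and> int p dvd y} = rep (k * m)"
    unfolding rep_def by (rule bij_betw_same_card[symmetric])
  moreover have "rep_div p (k * n) = rep (k * m)"
    using p0 by (simp add: rep_div_def m mult.left_commute)
  ultimately show ?thesis by simp
next
  case False
  have np: "\<not> p dvd k * n"
  proof
    assume "p dvd k * n"
    then have "p dvd k \<or> p dvd n" using p prime_dvd_mult_iff by blast
    moreover have "\<not> p dvd k"
      using k p by (auto dest: primes_dvd_imp_eq[OF _ two_is_prime_nat])
    ultimately show False using False by blast
  qed
  have "False" if a: "x\<^sup>2 + 37 * y\<^sup>2 = int (k * p * n)" "int p dvd x" "int p dvd y" for x y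
  proof -
    obtain u v where uv: "x = int p * u" "y = int p * v" using a by blast
    have "int p * int p * (u^2 + 37 * v^2) = int p * int (k * n)"
      using a uv by (simp add: power2_eq_square algebra_simps)
    then have "int p * (u^2 + 37 * v^2) = int (k * n)"
      using prime_gt_0_nat[OF p] by (simp add: mult.assoc)
    then have "int p dvd int (k * n)" by (metis dvd_triv_left)
    then show False using np int_dvd_int_iff by blast
  qed
  then have empty: "{(x, y) \<in> norm_set (k * p * n). int p dvd x \<and> int p dvd y} = {}"
    by (auto simp: norm_set_def)
  show ?thesis using np by (simp only: rep_div_def empty card.empty if_False)
qed

text \<open>If \<open>p\<close> did not divide \<open>y\<close>, then \<open>x / y\<close> would be
  a square root of -37 modulo \<open>p\<close>. Hence \<open>p\<close> divides both entries of every
  representation.\<close>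

lemma rep_inert:
  assumes p: "prime p" "p \<noteq> 2" and nr: "\<not> QuadRes (int p) (-37)" and k: "k \<in> {1, 2}"
  shows "rep (k * p * n) = rep_div p (k * n)"
proof -
  have pp: "prime (int p)" using p by simp
  have "int p dvd x \<and> int p dvd y" if e: "x\<^sup>2 + 37 * y\<^sup>2 = int (k * p * n)" for x y
  proof -
    have d: "int p dvd x\<^sup>2 + 37 * y\<^sup>2" unfolding e by simp
    have py: "int p dvd y"
    proof (rule ccontr)
      assume "\<not> int p dvd y"
      then have "coprime y (int p)" using pp prime_imp_coprime coprime_commute by blast
      then obtain z where z: "[y * z = 1] (mod int p)" using cong_solve_coprime_int by blast
      have "int p dvd (x\<^sup>2 + 37 * y\<^sup>2) * z^2" using d by simp
      then have "[(x * z)^2 + 37 * (y * z)^2 = 0] (mod int p)"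
        by (simp add: cong_0_iff power_mult_distrib algebra_simps)
      moreover have "[(x * z)^2 + 37 * (y * z)^2 = (x * z)^2 + 37 * 1^2] (mod int p)"
        using z by (intro cong_add cong_mult cong_pow cong_refl)
      ultimately have "[(x * z)^2 + 37 = 0] (mod int p)"
        using cong_trans[OF cong_sym] by fastforce
      then have "[(x * z)^2 = -37] (mod int p)"
        by (simp add: cong_iff_dvd_diff)
      then show False using nr by (auto simp: QuadRes_def)
    qed
    then have "int p dvd 37 * y\<^sup>2" by (simp add: power2_eq_square)
    with d have "int p dvd x\<^sup>2" using dvd_add_left_iff by blast
    then have "int p dvd x" using pp prime_dvd_power by blast
    with py show ?thesis by simp
  qed
  then have "norm_set (k * p * n) = {(x, y) \<in> norm_set (k * p * n). int p dvd x \<and> int p dvd y}"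
    by auto
  then show ?thesis using card_norm_set_dvd[OF p(1) k p(2), of n] unfolding rep_def by simp
qed

text \<open>Gauss reduction of the positive forms of determinant 37, by descent on the middle
  coefficient. Only the inclusion of values is recorded, and the second class enters doubled so that
  its values, too, become norms \<open>x\<^sup>2 + 37 * y\<^sup>2\<close>.\<close>

lemma reduction_det_37:
  fixes A B C :: int
  assumes "A > 0" "A * C - B\<^sup>2 = 37"
  shows "(\<forall>u v. \<exists>x y. A * u\<^sup>2 + 2 * B * u * v + C * v\<^sup>2 = x\<^sup>2 + 37 * y\<^sup>2) \<or>
         (\<forall>u v. \<exists>x y. 2 * (A * u\<^sup>2 + 2 * B * u * v + C * v\<^sup>2) = x\<^sup>2 + 37 * y\<^sup>2)"
  using assms
proof (induction "nat \<bar>B\<bar>" arbitrary: A B C rule: less_induct)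
  case less
  let ?P = "\<lambda>A B C. (\<forall>u v. \<exists>x y. A * u\<^sup>2 + 2 * B * u * v + C * v\<^sup>2 = x\<^sup>2 + 37 * y\<^sup>2) \<or>
         (\<forall>u v. \<exists>x y. 2 * (A * u\<^sup>2 + 2 * B * u * v + C * v\<^sup>2) = x\<^sup>2 + 37 * (y::int)\<^sup>2)"
  have AC: "A * C = 37 + B\<^sup>2" using less.prems by simp
  have C0: "C > 0"
  proof -
    have "A * C > 0" using AC by (simp add: add_pos_nonneg)
    then show ?thesis using less.prems(1) by (simp add: zero_less_mult_iff)
  qed
  \<comment> \<open>Substituting \<open>u - s * v\<close> for \<open>u\<close> changes
    \<open>B\<close> by \<open>s * A\<close> and preserves \<open>A\<close> and the determinant.
    \<open>shiftC\<close> is the mirror image, which preserves \<open>C\<close>.\<close>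
  have shiftA: "?P A B C" if "s = 1 \<or> s = -1" "\<bar>B + s * A\<bar> < \<bar>B\<bar>" for s :: int
  proof -
    have "?P A (B + s * A) (C + 2 * s * B + A)"
    proof (rule less.hyps)
      show "nat \<bar>B + s * A\<bar> < nat \<bar>B\<bar>" using that by linarith
      show "A * (C + 2 * s * B + A) - (B + s * A)\<^sup>2 = 37"
        using that(1) AC by (auto simp: power2_eq_square algebra_simps)
    qed fact
    moreover have "A * u\<^sup>2 + 2 * B * u * v + C * v\<^sup>2 =
        A * (u - s * v)\<^sup>2 + 2 * (B + s * A) * (u - s * v) * v + (C + 2 * s * B + A) * v\<^sup>2" for u v
      using that(1) by (auto simp: power2_eq_square algebra_simps)
    ultimately show ?thesis by metis
  qed
  have shiftC: "?P A B C" if "s = 1 \<or> s = -1" "\<bar>B + s * C\<bar> < \<bar>B\<bar>" for s :: int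
  proof -
    have det: "(A + 2 * s * B + C) * C - (B + s * C)\<^sup>2 = 37"
      using that(1) AC by (auto simp: power2_eq_square algebra_simps)
    have "?P (A + 2 * s * B + C) (B + s * C) C"
    proof (rule less.hyps)
      show "nat \<bar>B + s * C\<bar> < nat \<bar>B\<bar>" using that by linarith
      have "(A + 2 * s * B + C) * C = 37 + (B + s * C)\<^sup>2" using det by simp
      then have "(A + 2 * s * B + C) * C > 0" by (simp add: add_pos_nonneg)
      then show "A + 2 * s * B + C > 0" using C0 by (simp add: zero_less_mult_iff)
    qed fact
    moreover have "A * u\<^sup>2 + 2 * B * u * v + C * v\<^sup>2 =
        (A + 2 * s * B + C) * u\<^sup>2 + 2 * (B + s * C) * u * (v - s * u) + C * (v - s * u)\<^sup>2" for u v
      using that(1) by (auto simp: power2_eq_square algebra_simps)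
    ultimately show ?thesis by metis
  qed
  show ?case
  proof (cases "2 * \<bar>B\<bar> > A \<or> 2 * \<bar>B\<bar> > C")
    case True
    then consider "2 * B > A" | "2 * (-B) > A" | "2 * B > C" | "2 * (-B) > C" by linarith
    then show ?thesis
    proof cases
      case 1
      then show ?thesis using shiftA[of "-1"] less.prems(1) by auto
    next
      case 2
      then show ?thesis using shiftA[of 1] less.prems(1) by auto
    next
      case 3
      then show ?thesis using shiftC[of "-1"] C0 by auto
    next
      case 4
      then show ?thesis using shiftC[of 1] C0 by auto
    qed
  next
    case False
    then have le: "2 * \<bar>B\<bar> \<le> A" "2 * \<bar>B\<bar> \<le> C" by auto
    \<comment> \<open>A reduced form has \<open>4 * B\<^sup>2 \<le> A * C = 37 + B\<^sup>2\<close>,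
      which leaves the products 37, 38, 41, 46 for |B| = 0, 1, 2, 3. The last two have no
      factorisation with both factors at least 2|B|.\<close>
    have "(2 * \<bar>B\<bar>) * (2 * \<bar>B\<bar>) \<le> A * C"
      using le by (intro mult_mono) auto
    then have "4 * B\<^sup>2 \<le> 37 + B\<^sup>2" using AC by (simp add: power2_eq_square)
    then have B12: "B\<^sup>2 \<le> 12" by simp
    have "\<bar>B\<bar> \<le> 3"
    proof (rule ccontr)
      assume "\<not> \<bar>B\<bar> \<le> 3"
      then have "4 * 4 \<le> \<bar>B\<bar> * \<bar>B\<bar>" by (intro mult_mono) auto
      then show False using B12 by (simp add: power2_eq_square)
    qed
    have "B \<in> {-3..3}" using \<open>\<bar>B\<bar> \<le> 3\<close> by auto
    then have "B = -3 \<or> B = -2 \<or> B = -1 \<or> B = 0 \<or> B = 1 \<or> B = 2 \<or> B = 3" by auto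
    have cs: "(A, B, C) \<in> {(1,0,37), (37,0,1), (2,1,19), (19,1,2), (2,-1,19), (19,-1,2)}"
    proof -
      have e37: "A = 1 \<or> A = 37" if "A * C = 37"
      proof -
        have "prime (37::int)" by simp
        moreover have "A dvd 37" using that by (metis dvd_triv_left)
        ultimately show ?thesis using less.prems(1) by (auto simp: prime_int_iff)
      qed
      \<comment> \<open>A product below 7 * 7 has a factor of at most 6; fixing that factor leaves a
        linear condition on the other.\<close>
      have fac: "A \<le> 6 \<or> C \<le> 6" if "A * C < 49"
      proof (rule ccontr)
        assume "\<not> ?thesis"
        then have "7 * 7 \<le> A * C" by (intro mult_mono) auto
        then show False using that by simp
      qed
      from \<open>B = -3 \<or> _\<close> consider "B = 0" | "\<bar>B\<bar> = 1" | "\<bar>B\<bar> = 2" | "\<bar>B\<bar> = 3" by auto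
      then show ?thesis
      proof cases
        case 1
        then show ?thesis using e37 AC by auto
      next
        case 2
        then have "A * C = 38" using AC by (auto simp: abs_if split: if_splits)
        moreover have "2 \<le> A" "2 \<le> C" using 2 le by auto
        ultimately have "A = 2 \<or> A = 3 \<or> A = 4 \<or> A = 5 \<or> A = 6 \<or> C = 2 \<or> C = 3 \<or> C = 4 \<or> C = 5 \<or> C = 6"
          using fac by presburger
        then have "A = 2 \<and> C = 19 \<or> A = 19 \<and> C = 2" using \<open>A * C = 38\<close>
          by (elim disjE) (simp; presburger)+
        then show ?thesis using 2 by auto
      next
        case 3
        then have "B\<^sup>2 = 2^2" by (metis power2_abs)
        then have "A * C = 41" using AC by simp
        moreover have "4 \<le> A" "4 \<le> C" using 3 le by auto
        ultimately have "A = 4 \<or> A = 5 \<or> A = 6 \<or> C = 4 \<or> C = 5 \<or> C = 6"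
          using fac by presburger
        then have False using \<open>A * C = 41\<close> by (elim disjE) (simp; presburger)+
        then show ?thesis ..
      next
        case 4
        then have "B\<^sup>2 = 3^2" by (metis power2_abs)
        then have "A * C = 46" using AC by simp
        moreover have "6 \<le> A" "6 \<le> C" using 4 le by auto
        ultimately have "A = 6 \<or> C = 6" using fac by presburger
        then have False using \<open>A * C = 46\<close> by (elim disjE) (simp; presburger)+
        then show ?thesis ..
      qed
    qed
    have two: "\<exists>x y. 2 * (2 * u\<^sup>2 + 2 * s * u * v + 19 * v\<^sup>2) = x\<^sup>2 + 37 * y\<^sup>2"
      if "s = 1 \<or> s = -1" for s u v :: int
    proof (intro exI)
      show "2 * (2 * u\<^sup>2 + 2 * s * u * v + 19 * v\<^sup>2) = (2 * u + s * v)\<^sup>2 + 37 * v\<^sup>2"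
        using that by (auto simp: power2_eq_square algebra_simps)
    qed
    have two': "\<exists>x y. 2 * (19 * u\<^sup>2 + 2 * s * u * v + 2 * v\<^sup>2) = x\<^sup>2 + 37 * y\<^sup>2"
      if "s = 1 \<or> s = -1" for s u v :: int
    proof (intro exI)
      show "2 * (19 * u\<^sup>2 + 2 * s * u * v + 2 * v\<^sup>2) = (2 * v + s * u)\<^sup>2 + 37 * u\<^sup>2"
        using that by (auto simp: power2_eq_square algebra_simps)
    qed
    have one: "\<exists>x y. u\<^sup>2 + 37 * v\<^sup>2 = x\<^sup>2 + 37 * y\<^sup>2"
      "\<exists>x y. 37 * u\<^sup>2 + v\<^sup>2 = x\<^sup>2 + 37 * y\<^sup>2" for u v :: int
      by (metis add.commute)+
    from cs consider "A = 1" "B = 0" "C = 37" | "A = 37" "B = 0" "C = 1"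
      | s where "s = 1 \<or> s = -1" "A = 2" "B = s" "C = 19"
      | s where "s = 1 \<or> s = -1" "A = 19" "B = s" "C = 2"
      by blast
    then show ?thesis
    proof cases
      case 1
      then show ?thesis using one(1) by simp
    next
      case 2
      then show ?thesis using one(2) by simp
    next
      case 3
      then show ?thesis using two[OF 3(1)] by blast
    next
      case 4
      then show ?thesis using two'[OF 4(1)] by blast
    qed
  qed
qed

text \<open>With \<open>c\<close> a square root of -37 modulo \<open>p\<close>, the form with
  coefficients \<open>p\<close>, \<open>c\<close> and \<open>(c\<^sup>2 + 37) / p\<close> has
  determinant 37 and takes the value \<open>p\<close> at (1, 0). Its class decides whether
  \<open>p\<close> or \<open>2 * p\<close> is obtained as a norm.\<close>

lemma split_prime_norm:
  assumes "prime p" "QuadRes (int p) (-37)"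
  obtains a b k where "k \<in> {1, 2}" "a\<^sup>2 + 37 * b\<^sup>2 = int (k * p)"
proof -
  obtain c where "[c\<^sup>2 = -37] (mod int p)" using assms by (auto simp: QuadRes_def)
  then have "int p dvd c\<^sup>2 + 37" by (simp add: cong_iff_dvd_diff)
  then obtain C where C: "c\<^sup>2 + 37 = int p * C" by blast
  have "int p > 0" using assms(1) prime_gt_0_nat by simp
  moreover have "int p * C - c\<^sup>2 = 37" using C by simp
  ultimately show thesis
  proof (rule reduction_det_37[THEN disjE])
    assume "\<forall>u v. \<exists>x y. int p * u\<^sup>2 + 2 * c * u * v + C * v\<^sup>2 = x\<^sup>2 + 37 * y\<^sup>2"
    then obtain x y where "int p * 1\<^sup>2 + 2 * c * 1 * 0 + C * 0\<^sup>2 = x\<^sup>2 + 37 * y\<^sup>2" by blast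
    then show thesis using that[of 1 x y] by simp
  next
    assume "\<forall>u v. \<exists>x y. 2 * (int p * u\<^sup>2 + 2 * c * u * v + C * v\<^sup>2) = x\<^sup>2 + 37 * y\<^sup>2"
    then obtain x y where "2 * (int p * 1\<^sup>2 + 2 * c * 1 * 0 + C * 0\<^sup>2) = x\<^sup>2 + 37 * y\<^sup>2" by blast
    then show thesis using that[of 2 x y] by simp
  qed
qed

text \<open>Multiplication by the two conjugate elements a \<plusminus> b \<surd>(-37) of norm
  \<open>k * p\<close> maps the representations of \<open>m\<close> injectively into those of
  \<open>k * p * m\<close>. The two images cover everything and meet in the pairs divisible by
  \<open>p\<close>, so that the formula is inclusion-exclusion.\<close>

lemma rep_split:
  assumes p: "prime p" "p \<noteq> 2" "p \<noteq> 37" and k: "k \<in> {1, 2}"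
    and ab: "a\<^sup>2 + 37 * b\<^sup>2 = int (k * p)"
  shows "rep (k * p * m) + rep_div p (k * m) = 2 * rep m"
proof -
  have pp: "prime (int p)" and p0: "int p > 0" using p prime_gt_0_nat by auto
  have oddp: "odd p" using p prime_odd_nat primes_dvd_imp_eq two_is_prime_nat by blast
  have k0: "int k > 0" using k by auto
  \<comment> \<open>\<open>f s\<close> is multiplication by a + s b \<surd>(-37), and
    \<open>P s\<close> below is its image. The inverse multiplies by the conjugate and divides by
    \<open>k * p\<close>; the second coordinate of that product is
    \<open>a * Y - s * b * X\<close>.\<close>
  define f where "f = (\<lambda>(s :: int) (x, y). (a * x - 37 * (s * b) * y, a * y + s * b * x))"
  define T where "T = norm_set (k * p * m)"
  define P where "P = (\<lambda>s. {(X, Y) \<in> T. int p dvd a * Y - s * b * X})"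
  have not_dvd: "\<not> int p dvd a" "\<not> int p dvd b"
  proof -
    have dk: "\<not> int p dvd int k"
    proof
      assume "int p dvd int k"
      then have "p dvd k" by (simp only: int_dvd_int_iff)
      then have "p dvd 2" using k by auto
      then show False using p(1,2) primes_dvd_imp_eq two_is_prime_nat by blast
    qed
    have d37: "\<not> int p dvd 37"
    proof
      assume "int p dvd 37"
      then have "int p dvd int 37" by simp
      then have "p dvd 37" by (simp only: int_dvd_int_iff)
      moreover have "prime (37::nat)" by simp
      ultimately show False using p primes_dvd_imp_eq by blast
    qed
    have key: False if pab: "int p dvd a" "int p dvd b"
    proof -
      obtain u v where uv: "a = int p * u" "b = int p * v" using pab by blast
      have "int p * (int p * (u\<^sup>2 + 37 * v\<^sup>2)) = int p * int k"
        using ab uv by (simp add: power2_eq_square algebra_simps)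
      then have "int p * (u\<^sup>2 + 37 * v\<^sup>2) = int k" using p0 by simp
      then show False using dk by (metis dvd_triv_left)
    qed
    have kp: "int p dvd a\<^sup>2 + 37 * b\<^sup>2" unfolding ab by simp
    show "\<not> int p dvd a"
    proof
      assume pa: "int p dvd a"
      then have "int p dvd a\<^sup>2" by (simp add: power2_eq_square)
      then have "int p dvd 37 * b\<^sup>2" using kp dvd_add_right_iff by blast
      then have "int p dvd b" using pp d37 prime_dvd_mult_iff prime_dvd_power by blast
      then show False using key pa by blast
    qed
    show "\<not> int p dvd b"
    proof
      assume pb: "int p dvd b"
      then have "int p dvd 37 * b\<^sup>2" by (simp add: power2_eq_square)
      then have "int p dvd a\<^sup>2" using kp dvd_add_left_iff by blast
      then have "int p dvd a" using pp prime_dvd_power by blast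
      then show False using key pb by blast
    qed
  qed
  have cardP: "card (P s) = rep m" if s: "s = 1 \<or> s = -1" for s :: int
  proof -
    have ss: "s * s = 1" using s by auto
    have "bij_betw (f s) (norm_set m) (P s)"
      unfolding bij_betw_def
    proof
      show "inj_on (f s) (norm_set m)"
      proof (rule inj_onI, clarsimp simp: f_def simp del: in_norm_set)
        fix x y u v :: int
        assume e: "a * x - 37 * (s * b) * y = a * u - 37 * (s * b) * v"
                  "a * y + s * b * x = a * v + s * b * u"
        have "(a\<^sup>2 + 37 * (s * s) * b\<^sup>2) * (x - u) = a * ((a * x - 37 * (s * b) * y) - (a * u - 37 * (s * b) * v))
                + 37 * s * b * ((a * y + s * b * x) - (a * v + s * b * u))"
          by (simp add: power2_eq_square algebra_simps)
        then have "int (k * p) * (x - u) = 0" using e ss ab by simp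
        moreover have "(a\<^sup>2 + 37 * (s * s) * b\<^sup>2) * (y - v) = a * ((a * y + s * b * x) - (a * v + s * b * u))
                - s * b * ((a * x - 37 * (s * b) * y) - (a * u - 37 * (s * b) * v))"
          by (simp add: power2_eq_square algebra_simps)
        then have "int (k * p) * (y - v) = 0" using e ss ab by simp
        ultimately show "x = u \<and> y = v" using k0 p0 by simp
      qed
      show "f s ` norm_set m = P s"
      proof (intro equalityI subrelI)
        fix X Y :: int assume "(X, Y) \<in> f s ` norm_set m"
        then obtain x y where xy: "(x, y) \<in> norm_set m" "(X, Y) = f s (x, y)" by auto
        then have e: "x\<^sup>2 + 37 * y\<^sup>2 = int m" by simp
        let ?X = "a * x - 37 * (s * b) * y" and ?Y = "a * y + s * b * x"
        have "?X\<^sup>2 + 37 * ?Y\<^sup>2 = (a\<^sup>2 + 37 * (s * s) * b\<^sup>2) * x\<^sup>2 + 37 * (a\<^sup>2 + 37 * (s * s) * b\<^sup>2) * y\<^sup>2"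
          by (simp add: power2_eq_square algebra_simps)
        also have "\<dots> = int (k * p) * (x\<^sup>2 + 37 * y\<^sup>2)" using ss ab by (simp add: algebra_simps)
        finally have "?X\<^sup>2 + 37 * ?Y\<^sup>2 = int (k * p * m)" using e by simp
        moreover have "a * ?Y - s * b * ?X = (a\<^sup>2 + 37 * (s * s) * b\<^sup>2) * y"
          by (simp add: power2_eq_square algebra_simps)
        then have "int p dvd a * ?Y - s * b * ?X" using ss ab by simp
        ultimately show "(X, Y) \<in> P s" by (simp add: xy(2) f_def P_def T_def)
      next
        fix X Y :: int assume "(X, Y) \<in> P s"
        then have N: "X\<^sup>2 + 37 * Y\<^sup>2 = int (k * p * m)" and d: "int p dvd a * Y - s * b * X"
          by (auto simp: P_def T_def)
        let ?U = "a * X + 37 * (s * b) * Y" and ?V = "a * Y - s * b * X"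
        have NN: "?U\<^sup>2 + 37 * ?V\<^sup>2 = int (k * p) * int (k * p * m)"
        proof -
          have "?U\<^sup>2 + 37 * ?V\<^sup>2 = (a\<^sup>2 + 37 * (s * s) * b\<^sup>2) * (X\<^sup>2 + 37 * Y\<^sup>2)"
            by (simp add: power2_eq_square algebra_simps)
          then show ?thesis using ss ab N by simp
        qed
        have pU: "int p dvd ?U"
        proof -
          have "int p dvd 37 * ?V\<^sup>2" using d by (simp add: power2_eq_square)
          moreover have "int p dvd ?U\<^sup>2 + 37 * ?V\<^sup>2" unfolding NN by simp
          ultimately have "int p dvd ?U\<^sup>2" using dvd_add_left_iff by blast
          then show ?thesis using pp prime_dvd_power by blast
        qed
        have kp: "int (k * p) dvd w" if "int p dvd w" "int k dvd w" for w
        proof -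
          have "coprime (int k) (int p)" using k oddp by auto
          then show ?thesis using that by (simp add: divides_mult)
        qed
        \<comment> \<open>For \<open>k = 2\<close> both norms are even, so \<open>a\<close> and
          \<open>b\<close> have equal parity, and so do \<open>X\<close> and \<open>Y\<close>. This
          makes both coordinates of the product even.\<close>
        have kUV: "int k dvd ?U" "int k dvd ?V"
        proof -
          have "int k dvd ?U \<and> int k dvd ?V"
          proof (cases "k = 1")
            case False
            then have k2: "k = 2" using k by simp
            have "even (a\<^sup>2 + 37 * b\<^sup>2)" "even (X\<^sup>2 + 37 * Y\<^sup>2)" unfolding ab N k2 by simp_all
            then have "even a = even b" "even X = even Y" by auto
            then show ?thesis using k2 s by auto
          qed auto
          then show "int k dvd ?U" "int k dvd ?V" by auto
        qed
        obtain x where x: "?U = int (k * p) * x" using kp[OF pU kUV(1)] by blast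
        obtain y where y: "?V = int (k * p) * y" using kp[OF d kUV(2)] by blast
        have kp0: "int (k * p) > 0" using k0 p0 by simp
        have "int (k * p) * int (k * p) * (x\<^sup>2 + 37 * y\<^sup>2) = int (k * p) * int (k * p) * int m"
          using NN unfolding x y by (simp add: power2_eq_square algebra_simps)
        then have nm: "x\<^sup>2 + 37 * y\<^sup>2 = int m" using k0 p0 by simp
        have "int (k * p) * (a * x - 37 * (s * b) * y) = a * ?U - 37 * (s * b) * ?V"
          unfolding x y by (simp add: algebra_simps)
        also have "\<dots> = (a\<^sup>2 + 37 * (s * s) * b\<^sup>2) * X" by (simp add: power2_eq_square algebra_simps)
        also have "\<dots> = int (k * p) * X" using ss ab by simp
        finally have 1: "a * x - 37 * (s * b) * y = X" using k0 p0 by simp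
        have "int (k * p) * (a * y + s * b * x) = a * ?V + s * b * ?U"
          unfolding x y by (simp add: algebra_simps)
        also have "\<dots> = (a\<^sup>2 + 37 * (s * s) * b\<^sup>2) * Y" by (simp add: power2_eq_square algebra_simps)
        also have "\<dots> = int (k * p) * Y" using ss ab by simp
        finally have 2: "a * y + s * b * x = Y" using k0 p0 by simp
        show "(X, Y) \<in> f s ` norm_set m"
          using 1 2 nm by (intro image_eqI[of _ _ "(x, y)"]) (simp_all add: f_def)
      qed
    qed
    then show ?thesis unfolding rep_def by (rule bij_betw_same_card[symmetric])
  qed
  have finP: "finite (P s)" for s
    by (rule finite_subset[OF _ finite_norm_set[of "k * p * m"]]) (auto simp: P_def T_def)
  have un: "P 1 \<union> P (-1) = T"
  proof (intro equalityI subrelI)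
    fix X Y assume XY: "(X, Y) \<in> T"
    then have N: "X\<^sup>2 + 37 * Y\<^sup>2 = int (k * p * m)" by (simp add: T_def)
    \<comment> \<open>Each term on the right contains one of the two norms, both divisible by
      \<open>p\<close>. Hence \<open>p\<close> divides one of the factors on the left, and the pair
      lies in one of the images.\<close>
    have "(a * Y - b * X) * (a * Y + b * X) = (a\<^sup>2 + 37 * b\<^sup>2) * Y\<^sup>2 - b\<^sup>2 * (X\<^sup>2 + 37 * Y\<^sup>2)"
      by (simp add: power2_eq_square algebra_simps)
    also have "\<dots> = int p * (int k * Y\<^sup>2 - b\<^sup>2 * int (k * m))"
      unfolding ab N by (simp add: algebra_simps)
    finally have "int p dvd (a * Y - b * X) * (a * Y + b * X)" by simp
    then have "int p dvd a * Y - b * X \<or> int p dvd a * Y + b * X"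
      using pp prime_dvd_mult_iff by blast
    then show "(X, Y) \<in> P 1 \<union> P (-1)" using XY by (auto simp: P_def)
  qed (auto simp: P_def)
  have int: "P 1 \<inter> P (-1) = {(X, Y) \<in> T. int p dvd X \<and> int p dvd Y}"
  proof (intro equalityI subrelI)
    fix X Y assume "(X, Y) \<in> P 1 \<inter> P (-1)"
    then have XY: "(X, Y) \<in> P 1" "(X, Y) \<in> P (-1)" by auto
    then have d: "int p dvd a * Y - b * X" "int p dvd a * Y + b * X" by (auto simp: P_def)
    have p2: "\<not> int p dvd 2"
    proof
      assume "int p dvd 2"
      then have "int p dvd int 2" by simp
      then have "p dvd 2" by (simp only: int_dvd_int_iff)
      then show False using p(1,2) primes_dvd_imp_eq two_is_prime_nat by blast
    qed
    have "int p dvd 2 * a * Y" using dvd_add[OF d] by (simp add: algebra_simps)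
    then have 1: "int p dvd Y" using pp p2 not_dvd prime_dvd_mult_iff by blast
    have "int p dvd 2 * b * X" using dvd_diff[OF d(2) d(1)] by (simp add: algebra_simps)
    then have "int p dvd X" using pp p2 not_dvd prime_dvd_mult_iff by blast
    then show "(X, Y) \<in> {(X, Y) \<in> T. int p dvd X \<and> int p dvd Y}" using XY 1 by (auto simp: P_def)
  qed (auto simp: P_def)
  have "card (P 1) + card (P (-1)) = card (P 1 \<union> P (-1)) + card (P 1 \<inter> P (-1))"
    by (rule card_Un_Int) (fact finP)+
  also have "card (P 1 \<inter> P (-1)) = rep_div p (k * m)"
    unfolding int T_def by (rule card_norm_set_dvd[OF p(1) k p(2)])
  also have "card (P 1 \<union> P (-1)) = rep (k * p * m)"
    unfolding un T_def rep_def ..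
  finally show ?thesis using cardP[of 1] cardP[of "-1"] by simp
qed

section \<open>The characters, quadratic reciprocity and the Kronecker symbol\<close>

lemma Legendre_values: "Legendre a p \<in> {-1, 0, 1}"
  by (simp add: Legendre_def)

text \<open>By Euler's criterion both sides are congruent modulo \<open>p\<close>, and they differ
  by at most 2, which is less than \<open>p\<close>.\<close>

lemma Legendre_mult:
  fixes p :: nat
  assumes "prime p" "2 < p"
  shows "Legendre (a * b) (int p) = Legendre a (int p) * Legendre b (int p)"
proof -
  let ?e = "(p - 1) div 2"
  have "[Legendre (a * b) p = (a * b) ^ ?e] (mod p)" by (rule euler_criterion[OF assms])
  moreover have "[Legendre a p * Legendre b p = a ^ ?e * b ^ ?e] (mod p)"
    by (intro cong_mult euler_criterion[OF assms])
  ultimately have "[Legendre (a * b) p = Legendre a p * Legendre b p] (mod p)"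
    by (metis cong_sym cong_trans power_mult_distrib)
  then have "int p dvd Legendre (a * b) p - Legendre a p * Legendre b p"
    by (simp add: cong_iff_dvd_diff)
  moreover have "\<bar>Legendre (a * b) p - Legendre a p * Legendre b p\<bar> \<le> 2"
    using Legendre_values[of "a * b" p] Legendre_values[of a p] Legendre_values[of b p] by auto
  ultimately show ?thesis using assms(2) zdvd_imp_le[of "int p" "\<bar>Legendre (a * b) p - Legendre a p * Legendre b p\<bar>"]
    by (cases "Legendre (a * b) p - Legendre a p * Legendre b p = 0") auto
qed

lemma chi4_altdef: "chi4 n = (if n mod 4 = 1 then 1 else if n mod 4 = 3 then -1 else 0)"
proof -
  have "odd n \<longleftrightarrow> n mod 4 = 1 \<or> n mod 4 = 3" by presburger
  then show ?thesis by (auto simp: chi4_def)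
qed

lemma chi4_mult: "chi4 (m * n) = chi4 m * chi4 n"
proof -
  have "(m * n) mod 4 = ((m mod 4) * (n mod 4)) mod 4" by (simp add: mod_mult_eq)
  moreover have "n mod 4 = 0 \<or> n mod 4 = 1 \<or> n mod 4 = 2 \<or> n mod 4 = 3"
    "m mod 4 = 0 \<or> m mod 4 = 1 \<or> m mod 4 = 2 \<or> m mod 4 = 3" by linarith+
  ultimately show ?thesis unfolding chi4_altdef by auto
qed

lemma chi37_mult: "chi37 (m * n) = chi37 m * chi37 n"
  using Legendre_mult[of 37 "int m" "int n"] by (simp add: chi37_def)

lemma chi148_mult: "chi148 (m * n) = chi148 m * chi148 n"
  by (simp add: chi148_def chi4_mult chi37_mult)

lemma chi37_1 [simp]: "chi37 (Suc 0) = 1"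
  by (auto simp: chi37_def Legendre_def cong_def QuadRes_def intro: exI[of _ 1])

lemma chi4_1 [simp]: "chi4 (Suc 0) = 1"
  by (simp add: chi4_def)

lemma chi148_1 [simp]: "chi148 (Suc 0) = 1"
  by (simp add: chi148_def)

text \<open>The factor -1 gives \<open>chi4\<close> by Euler's criterion. The factor 37 gives
  \<open>chi37\<close> by reciprocity, without a sign because (37 - 1) / 2 = 18 is even. At 37
  itself both sides vanish.\<close>

lemma Legendre_minus_37:
  assumes p: "prime p" "p \<noteq> 2"
  shows "Legendre (-37) (int p) = chi148 p"
proof (cases "p = 37")
  case True
  then show ?thesis by (simp add: chi148_def chi37_def Legendre_def cong_def)
next
  case False
  have p2: "2 < p" using p prime_gt_1_nat[of p] by linarith
  have odd: "odd p" using p2 p(1) prime_odd_nat by auto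
  have "Legendre (-37) (int p) = Legendre (-1) (int p) * Legendre 37 (int p)"
    using Legendre_mult[OF p(1) p2, of "-1" 37] by simp
  moreover have "Legendre (-1) (int p) = chi4 p"
  proof -
    have "[Legendre (-1) p = (-1) ^ ((p - 1) div 2)] (mod p)" by (rule euler_criterion[OF p(1) p2])
    moreover have "(-1) ^ ((p - 1) div 2) = chi4 p"
    proof (cases "p mod 4 = 1")
      case True
      then have "even ((p - 1) div 2)" by presburger
      then show ?thesis using True odd by (simp add: chi4_def)
    next
      case f: False
      then have "odd ((p - 1) div 2)" using odd by presburger
      then show ?thesis using f odd by (simp add: chi4_def)
    qed
    ultimately have "int p dvd Legendre (-1) p - chi4 p" by (simp add: cong_iff_dvd_diff)
    moreover have "\<bar>Legendre (-1) p - chi4 p\<bar> \<le> 2"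
      using Legendre_values[of "-1" p] by (auto simp: chi4_def)
    ultimately show ?thesis using p2 zdvd_imp_le[of "int p" "\<bar>Legendre (-1) p - chi4 p\<bar>"]
      by (cases "Legendre (-1) p - chi4 p = 0") auto
  qed
  moreover have "Legendre 37 (int p) = chi37 p"
  proof -
    have "Legendre (int p) (int 37) * Legendre (int 37) (int p) = (-1) ^ ((p - 1) div 2 * ((37 - 1) div 2))"
      using p2 p(1) False by (intro Quadratic_Reciprocity) auto
    then have "Legendre (int p) 37 * Legendre 37 (int p) = 1" by simp
    then show ?thesis
      using Legendre_values[of "int p" 37] Legendre_values[of 37 "int p"] by (auto simp: chi37_def)
  qed
  ultimately show ?thesis by (simp add: chi148_def)
qed

lemma Legendre_minus_148:
  assumes p: "prime p" "p \<noteq> 2"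
  shows "Legendre (-148) (int p) = chi148 p"
proof -
  have p2: "2 < p" using p prime_gt_1_nat[of p] by linarith
  have "\<not> int p dvd 4"
  proof
    assume "int p dvd 4"
    then have "int p dvd int (2 ^ 2)" by simp
    then have "p dvd 2 ^ 2" by (simp only: int_dvd_int_iff)
    then have "p dvd 2" using p(1) prime_dvd_power_nat by blast
    then show False using p2 by (auto dest: dvd_imp_le)
  qed
  then have "Legendre 4 (int p) = 1"
    by (auto simp: Legendre_def cong_0_iff QuadRes_def intro: exI[of _ 2])
  then show ?thesis
    using Legendre_mult[OF p(1) p2, of 4 "-37"] Legendre_minus_37[OF p] by simp
qed

text \<open>Both symbols are completely multiplicative in the lower argument, so they are compared
  at primes. At 2 both vanish, and at odd primes the factor 4 of -148 is a nonzero square.\<close>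

lemma kronecker_eq_chi148:
  assumes "m > 0"
  shows "kronecker_symbol (-148) (int m) = chi148 m"
proof -
  have mset: "prod_mset M > 0 \<and> chi148 (nat (prod_mset M)) = (\<Prod>p\<in>#M. chi148 (nat p))"
    if "\<forall>p\<in>#M. p > 0" for M :: "int multiset"
    using that by (induction M) (auto simp: nat_mult_distrib chi148_mult)
  have pos: "\<forall>p\<in>#prime_factorization (int m). p > 0"
    by (auto simp: in_prime_factors_iff prime_gt_0_int)
  have "chi148 m = chi148 (nat (prod_mset (prime_factorization (int m))))"
    using assms by (subst prod_mset_prime_factorization) auto
  also have "\<dots> = (\<Prod>p\<in>#prime_factorization (int m). chi148 (nat p))" by (rule mset[OF pos, THEN conjunct2])
  also have "\<dots> = (\<Prod>p\<in>prime_factors (int m). chi148 (nat p) ^ count (prime_factorization (int m)) p)"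
    by (rule image_prod_mset_multiplicity)
  also have "\<dots> = (\<Prod>p\<in>prime_factors (int m). kronecker_prime (-148) p ^ multiplicity p (int m))"
  proof (rule prod.cong[OF refl])
    fix p assume p: "p \<in> prime_factors (int m)"
    then have pr: "prime p" by auto
    have "kronecker_prime (-148) p = chi148 (nat p)"
    proof (cases "p = 2")
      case True
      then show ?thesis by (simp add: kronecker_prime_def chi148_def chi4_def)
    next
      case False
      have np: "int (nat p) = p" using pr prime_ge_0_int by simp
      moreover have "prime (int (nat p))" unfolding np by (fact pr)
      then have "prime (nat p)" by (simp only: prime_nat_int_transfer)
      moreover have "nat p \<noteq> 2" using False by auto
      ultimately show ?thesis
        using Legendre_minus_148[of "nat p"] False by (simp add: kronecker_prime_def)
    qed
    then show "chi148 (nat p) ^ count (prime_factorization (int m)) p =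
        kronecker_prime (-148) p ^ multiplicity p (int m)"
      using pr by (simp add: count_prime_factorization_prime)
  qed
  finally show ?thesis using assms by (simp add: kronecker_symbol_def)
qed

text \<open>The divisors of \<open>p * n\<close> are those of \<open>n\<close> and their multiples
  by \<open>p\<close>; the two sets overlap in the multiples by \<open>p\<close> of the divisors of
  \<open>n div p\<close>.\<close>

lemma Hecke_divisor_sum:
  fixes f :: "nat \<Rightarrow> int"
  assumes p: "prime p" and f: "\<And>m n. f (m * n) = f m * f n" and n: "n > 0"
  shows "(\<Sum>d | d dvd p * n. f d) + f p * (if p dvd n then \<Sum>d | d dvd n div p. f d else 0) =
         (1 + f p) * (\<Sum>d | d dvd n. f d)"
proof -
  have p0: "p > 0" using p prime_gt_0_nat by blast
  let ?A = "{d. d dvd n}" and ?B = "(*) p ` {d. d dvd n}"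
  have un: "{d. d dvd p * n} = ?A \<union> ?B"
  proof (intro equalityI subsetI)
    fix d assume "d \<in> {d. d dvd p * n}"
    then have d: "d dvd p * n" by simp
    show "d \<in> ?A \<union> ?B"
    proof (cases "p dvd d")
      case True
      then obtain e where "d = p * e" by blast
      then show ?thesis using d p0 by auto
    next
      case False
      then have "coprime d p" using p prime_imp_coprime coprime_commute by blast
      then show ?thesis using d by (simp add: coprime_dvd_mult_right_iff)
    qed
  qed auto
  have fin: "finite ?A" "finite ?B" using n by auto
  have int: "sum f (?A \<inter> ?B) = f p * (if p dvd n then \<Sum>d | d dvd n div p. f d else 0)"
  proof (cases "p dvd n")
    case True
    then obtain k where k: "n = p * k" by blast
    have "?A \<inter> ?B = (*) p ` {d. d dvd n div p}" using p0 k by auto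
    then show ?thesis using True p0
      by (simp add: sum.reindex inj_on_def f sum_distrib_left)
  next
    case False
    then have "?A \<inter> ?B = {}" by auto
    then show ?thesis using False by simp
  qed
  have "sum f (?A \<union> ?B) + sum f (?A \<inter> ?B) = sum f ?A + sum f ?B"
    by (rule sum.union_inter[OF fin])
  moreover have "sum f ?B = f p * sum f ?A"
    using p0 by (simp add: sum.reindex inj_on_def f sum_distrib_left)
  ultimately show ?thesis unfolding un int by (simp add: algebra_simps)
qed

text \<open>This is the recursion of \<open>Hecke_divisor_sum\<close> for \<open>chi148\<close>. A
  split prime exchanges the two forms when it is \<open>2 * p\<close> rather than \<open>p\<close>
  that is written as a norm; the sum of the two counts is invariant under this exchange.\<close>

lemma Hecke_rep:
  assumes p: "prime p"
  shows "int (rep (p * n) + rep (2 * (p * n))) +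
           chi148 p * (if p dvd n then int (rep (n div p) + rep (2 * (n div p))) else 0) =
         (1 + chi148 p) * int (rep n + rep (2 * n))"
proof -
  consider "p = 2" | "p = 37" | "p \<noteq> 2" "p \<noteq> 37" by blast
  then show ?thesis
  proof cases
    case 1
    then show ?thesis using rep_4[of n] by (simp add: chi148_def chi4_def mult.assoc[symmetric])
  next
    case 2
    then have "chi148 p = 0" by (simp add: chi148_def chi37_def Legendre_def cong_def)
    moreover have "2 * (37 * n) = 37 * (2 * n)" by simp
    ultimately show ?thesis using 2 rep_37[of n] rep_37[of "2 * n"] by simp
  next
    case 3
    have chi: "chi148 p = (if QuadRes (int p) (-37) then 1 else -1)"
    proof -
      have "\<not> int p dvd -37"
      proof
        assume "int p dvd -37"
        then have "int p dvd int 37" by simp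
        then have "p dvd 37" by (simp only: int_dvd_int_iff)
        moreover have "prime (37::nat)" by simp
        ultimately show False using p 3 primes_dvd_imp_eq by blast
      qed
      then show ?thesis
        using Legendre_minus_37[OF p 3(1)] by (simp add: Legendre_def cong_0_iff)
    qed
    have c2: "coprime p 2" using p 3(1) primes_coprime two_is_prime_nat by blast
    have rd1: "rep_div p n = (if p dvd n then rep (n div p) else 0)"
      by (simp add: rep_div_def)
    have rd2: "rep_div p (2 * n) = (if p dvd n then rep (2 * (n div p)) else 0)"
      using c2 by (auto simp: rep_div_def coprime_dvd_mult_right_iff div_mult_swap)
    have m2: "2 * (p * n) = p * (2 * n)" "2 * p * n = p * (2 * n)" "2 * (2 * n) = 4 * n" by auto
    show ?thesis
    proof (cases "QuadRes (int p) (-37)")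
      case False
      have "rep (p * n) = rep_div p n" "rep (p * (2 * n)) = rep_div p (2 * n)"
        using rep_inert[OF p 3(1) False, of 1 n] rep_inert[OF p 3(1) False, of 2 n]
        by (simp_all add: m2)
      then show ?thesis unfolding m2(1) using False chi rd1 rd2 by simp
    next
      case True
      obtain a b k where k: "k \<in> {1, 2}" and ab: "a\<^sup>2 + 37 * b\<^sup>2 = int (k * p)"
        by (rule split_prime_norm[OF p True])
      have s1: "rep (k * p * n) + rep_div p (k * n) = 2 * rep n"
        by (rule rep_split[OF p 3 k ab])
      have s2: "rep (k * p * (2 * n)) + rep_div p (k * (2 * n)) = 2 * rep (2 * n)"
        by (rule rep_split[OF p 3 k ab])
      have "rep (p * n) + rep (p * (2 * n)) + (rep_div p n + rep_div p (2 * n)) = 2 * (rep n + rep (2 * n))"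
      proof (cases "k = 1")
        case True
        then show ?thesis using s1 s2 by simp
      next
        case False
        then have k2: "k = 2" using k by simp
        have "rep_div p (4 * n) = rep_div p n"
        proof -
          have "coprime p (2 ^ 2)" using c2 by (simp only: coprime_power_right_iff) simp
          then have "coprime p 4" by simp
          then have "p dvd 4 * n \<longleftrightarrow> p dvd n" by (simp add: coprime_dvd_mult_right_iff)
          moreover have "rep (4 * n div p) = rep (n div p)" if "p dvd n"
            using that rep_4 by (metis div_mult_swap)
          ultimately show ?thesis by (simp add: rep_div_def)
        qed
        moreover have "rep (2 * p * (2 * n)) = rep (p * n)"
          using rep_4[of "p * n"] by (simp add: mult.assoc mult.left_commute)
        ultimately show ?thesis using s1 s2 unfolding k2 m2 by simp
      qed
      then show ?thesis unfolding m2(1) using True chi rd1 rd2 by (auto split: if_splits)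
    qed
  qed
qed

section \<open>Numbers of representations as divisor sums\<close>

lemma rep_1: "rep (Suc 0) = 2" and rep_2: "rep 2 = 0"
proof -
  have y0: "y = 0" if "x\<^sup>2 + 37 * y\<^sup>2 \<le> 2" for x y :: int
  proof (rule ccontr)
    assume "y \<noteq> 0"
    then have "y\<^sup>2 > 0" by simp
    then show False using that zero_le_power2[of x] by linarith
  qed
  have "norm_set (Suc 0) = {(1, 0), (-1, 0)}"
  proof (intro equalityI subrelI)
    fix x y :: int assume "(x, y) \<in> norm_set (Suc 0)"
    then have "x\<^sup>2 + 37 * y\<^sup>2 = 1" by simp
    then show "(x, y) \<in> {(1, 0), (-1, 0)}" using y0[of x y] by (auto simp: power2_eq_1_iff)
  qed auto
  then show "rep (Suc 0) = 2" by (simp add: rep_def)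
  have "x\<^sup>2 \<noteq> 2" for x :: int
  proof
    assume x: "x\<^sup>2 = 2"
    then have "\<bar>x\<bar> \<le> 2" using abs_le_square_int[of x] by simp
    then have "x = -2 \<or> x = -1 \<or> x = 0 \<or> x = 1 \<or> x = 2" by auto
    then show False using x by auto
  qed
  moreover have "y = 0" if "x\<^sup>2 + 37 * y\<^sup>2 = 2" for x y :: int
    using y0[of x y] that by simp
  ultimately have "norm_set 2 = {}" by (force simp: norm_set_def)
  then show "rep 2 = 0" by (simp add: rep_def)
qed

text \<open>Both sides satisfy the same recursion at every prime.\<close>

theorem rep_add: "n > 0 \<Longrightarrow> int (rep n + rep (2 * n)) = 2 * (\<Sum>d | d dvd n. chi148 d)"
proof (induction n rule: less_induct)
  case (less n)
  show ?case
  proof (cases "n = 1")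
    case True
    then show ?thesis by (simp add: rep_1 rep_2)
  next
    case False
    then obtain p where p: "prime p" "p dvd n" using prime_factor_nat by blast
    then obtain m where m: "n = p * m" by blast
    have p1: "p > 1" using p prime_gt_1_nat by blast
    have m0: "m > 0" "m < n" using less.prems m p1 by (auto intro: Nat.gr0I)
    have IH1: "int (rep m + rep (2 * m)) = 2 * (\<Sum>d | d dvd m. chi148 d)"
      by (rule less.IH) (use m0 in auto)
    have IH2: "int (rep (m div p) + rep (2 * (m div p))) = 2 * (\<Sum>d | d dvd m div p. chi148 d)"
      if "p dvd m"
      by (rule less.IH) (use m0 that p1 in \<open>auto simp: dvd_imp_le div_less_dividend dest: dvd_imp_le elim!: dvdE intro!: Nat.gr0I intro: le_less_trans[OF div_le_dividend]\<close>)
    have X: "(if p dvd m then int (rep (m div p) + rep (2 * (m div p))) else 0) =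
        2 * (if p dvd m then \<Sum>d | d dvd m div p. chi148 d else 0)"
      using IH2 by simp
    have "int (rep n + rep (2 * n)) =
        2 * ((1 + chi148 p) * (\<Sum>d | d dvd m. chi148 d) -
          chi148 p * (if p dvd m then \<Sum>d | d dvd m div p. chi148 d else 0))"
      using Hecke_rep[OF p(1), of m] unfolding m X IH1
      by (simp only: right_diff_distrib mult.left_commute[of 2])
    moreover have "(\<Sum>d | d dvd n. chi148 d) = (1 + chi148 p) * (\<Sum>d | d dvd m. chi148 d) -
          chi148 p * (if p dvd m then \<Sum>d | d dvd m div p. chi148 d else 0)"
      using Hecke_divisor_sum[OF p(1) chi148_mult m0(1)] unfolding m eq_diff_eq by simp
    ultimately show ?thesis by simp
  qed
qed

text \<open>For odd \<open>n\<close> only one of the two forms represents \<open>n\<close>, according to \<open>n mod 4\<close>; for even \<open>n\<close>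
  both sides change sign when \<open>n\<close> is halved.\<close>

theorem rep_diff:
  "n > 0 \<Longrightarrow> int (rep n) - int (rep (2 * n)) = 2 * (\<Sum>d | d dvd n. chi37 d * chi4 (n div d))"
proof (induction n rule: less_induct)
  case (less n)
  show ?case
  proof (cases "even n")
    case True
    then obtain m where m: "n = 2 * m" by blast
    have m0: "m > 0" "m < n" using less.prems m by auto
    \<comment> \<open>An odd divisor of an even \<open>n\<close> has an even cofactor, at which
      \<open>chi4\<close> vanishes, so only the divisors \<open>2 * e\<close> remain. The change of
      sign comes from \<open>chi37 2 = -1\<close>; on the side of the representations it comes from
      \<open>rep_4\<close>.\<close>
    have "(\<Sum>d | d dvd n. chi37 d * chi4 (n div d)) = (\<Sum>d\<in>(*) 2 ` {d. d dvd m}. chi37 d * chi4 (n div d))"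
    proof (rule sum.mono_neutral_right)
      show "finite {d. d dvd n}" using less.prems by simp
      show "\<forall>d\<in>{d. d dvd n} - (*) 2 ` {d. d dvd m}. chi37 d * chi4 (n div d) = 0"
      proof
        fix d assume d: "d \<in> {d. d dvd n} - (*) 2 ` {d. d dvd m}"
        then have "d dvd n" "\<not> (\<exists>e. d = 2 * e \<and> e dvd m)" by auto
        moreover from this have "odd d" using m by (auto elim!: evenE)
        ultimately have "even (n div d)" using True by (metis dvd_div_mult_self even_mult_iff)
        then show "chi37 d * chi4 (n div d) = 0" by (simp add: chi4_def)
      qed
    qed (use m in auto)
    also have "\<dots> = (\<Sum>d | d dvd m. chi37 (2 * d) * chi4 (m div d))"
      by (subst sum.reindex) (auto simp: inj_on_def m)
    also have "chi37 2 = -1"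
    proof -
      have "\<not> QuadRes 37 2"
      proof
        assume "QuadRes 37 2"
        then obtain y :: int where "[y\<^sup>2 = 2] (mod 37)" by (auto simp: QuadRes_def)
        then have "(y mod 37)\<^sup>2 mod 37 = 2" by (simp add: cong_def power_mod)
        moreover have "y mod 37 \<in> {0..36}" by auto
        moreover have "\<forall>z\<in>set [0..36]. z\<^sup>2 mod 37 \<noteq> (2::int)" by code_simp
        ultimately show False by auto
      qed
      then show ?thesis by (simp add: chi37_def Legendre_def cong_def)
    qed
    then have "(\<Sum>d | d dvd m. chi37 (2 * d) * chi4 (m div d)) = - (\<Sum>d | d dvd m. chi37 d * chi4 (m div d))"
      by (simp add: chi37_mult sum_negf)
    finally show ?thesis
      using less.IH[OF m0(2) m0(1)] rep_4[of m] m by simp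
  next
    case False
    \<comment> \<open>For odd \<open>n\<close> exactly one of \<open>x\<close>, \<open>y\<close> is
      odd, and both 1 and 37 are 1 modulo 4. In \<open>par2\<close> both entries are odd; there
      \<open>a * (a + 1)\<close> and \<open>b * (b + 1)\<close> are even, which leaves 19, that is 3
      modulo 4.\<close>
    have par: "n mod 4 = 1" if "x\<^sup>2 + 37 * y\<^sup>2 = int n" for x y
    proof -
      obtain a b where ab: "x = 2 * a \<or> x = 2 * a + 1" "y = 2 * b \<or> y = 2 * b + 1"
        by (meson oddE evenE)
      have "odd (x\<^sup>2 + 37 * y\<^sup>2)" unfolding that using False by simp
      then have "(x = 2 * a \<and> y = 2 * b + 1) \<or> (x = 2 * a + 1 \<and> y = 2 * b)" using ab by auto
      then have "\<exists>t. int n = 4 * t + 1"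
      proof
        assume xy: "x = 2 * a \<and> y = 2 * b + 1"
        have "int n = 4 * (a\<^sup>2 + 37 * b\<^sup>2 + 37 * b + 9) + 1"
          unfolding that[symmetric] using xy by (simp add: power2_eq_square algebra_simps)
        then show ?thesis by blast
      next
        assume xy: "x = 2 * a + 1 \<and> y = 2 * b"
        have "int n = 4 * (a\<^sup>2 + a + 37 * b\<^sup>2) + 1"
          unfolding that[symmetric] using xy by (simp add: power2_eq_square algebra_simps)
        then show ?thesis by blast
      qed
      then show ?thesis by presburger
    qed
    have par2: "n mod 4 = 3" if "x\<^sup>2 + 37 * y\<^sup>2 = 2 * int n" for x y
    proof -
      obtain a b where ab: "x = 2 * a \<or> x = 2 * a + 1" "y = 2 * b \<or> y = 2 * b + 1"
        by (meson oddE evenE)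
      have "even (x\<^sup>2 + 37 * y\<^sup>2)" unfolding that by simp
      then have "(x = 2 * a \<and> y = 2 * b) \<or> (x = 2 * a + 1 \<and> y = 2 * b + 1)" using ab by auto
      then have "int n = 2 * (a\<^sup>2 + 37 * b\<^sup>2) \<or> int n = 2 * (a * (a + 1) + 37 * (b * (b + 1))) + 19"
      proof
        assume xy: "x = 2 * a \<and> y = 2 * b"
        have "2 * int n = 2 * (2 * (a\<^sup>2 + 37 * b\<^sup>2))"
          unfolding that[symmetric] using xy by (simp add: power2_eq_square algebra_simps)
        then show ?thesis by simp
      next
        assume xy: "x = 2 * a + 1 \<and> y = 2 * b + 1"
        have "2 * int n = 2 * (2 * (a * (a + 1) + 37 * (b * (b + 1))) + 19)"
          unfolding that[symmetric] using xy by (simp add: power2_eq_square algebra_simps)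
        then show ?thesis by simp
      qed
      then consider "int n = 2 * (a\<^sup>2 + 37 * b\<^sup>2)" | "int n = 2 * (a * (a + 1) + 37 * (b * (b + 1))) + 19"
        by blast
      then show ?thesis
      proof cases
        case 1
        then have "even (int n)" by simp
        then show ?thesis using False by simp
      next
        case 2
        have "even (a * (a + 1) + 37 * (b * (b + 1)))" by simp
        then obtain c where "a * (a + 1) + 37 * (b * (b + 1)) = 2 * c" by blast
        then have "int n = 4 * c + 19" using 2 by simp
        then show ?thesis by presburger
      qed
    qed
    have chi4n: "chi4 n = (if n mod 4 = 1 then 1 else -1)" using False by (simp add: chi4_def)
    have "int (rep n) - int (rep (2 * n)) = chi4 n * int (rep n + rep (2 * n))"
    proof (cases "n mod 4 = 1")
      case True
      then have "norm_set (2 * n) = {}" using par2 by (fastforce simp: norm_set_def)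
      then show ?thesis using chi4n True by (simp add: rep_def)
    next
      case False
      then have "norm_set n = {}" using par by (fastforce simp: norm_set_def)
      then show ?thesis using chi4n False by (simp add: rep_def)
    qed
    also have "\<dots> = 2 * (\<Sum>d | d dvd n. chi4 n * chi148 d)"
      by (subst rep_add[OF less.prems]) (simp add: sum_distrib_left mult.left_commute)
    also have "(\<Sum>d | d dvd n. chi4 n * chi148 d) = (\<Sum>d | d dvd n. chi37 d * chi4 (n div d))"
    proof (rule sum.cong[OF refl])
      fix d assume "d \<in> {d. d dvd n}"
      then have d: "n = d * (n div d)" by simp
      then have "odd d" using False by (metis even_mult_iff)
      then have "chi4 d * chi4 d = 1" by (simp add: chi4_def)
      moreover have "chi4 n = chi4 d * chi4 (n div d)" by (subst d) (rule chi4_mult)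
      ultimately show "chi4 n * chi148 d = chi37 d * chi4 (n div d)"
        by (simp add: chi148_def algebra_simps)
    qed
    finally show ?thesis .
  qed
qed

section \<open>Partial fractions and logarithmic asymptotics\<close>

lemma sin_pi_nonzero:
  fixes z :: complex
  assumes "z \<notin> \<int>"
  shows "sin (of_real pi * z) \<noteq> 0"
proof
  assume "sin (of_real pi * z) = 0"
  then obtain n :: int where "of_real pi * z = of_real (of_int n * pi)"
    using sin_eq_0 by auto
  then have "z = of_int n" by (simp add: mult.commute)
  then show False using assms by simp
qed

text \<open>The logarithmic derivative of Euler's reflection formula for \<Gamma>(z) \<Gamma>(1 -
  z).\<close>

lemma Digamma_reflection:
  fixes z :: complex
  assumes z: "z \<notin> \<int>"
  shows "Digamma (1 - z) - Digamma z = of_real pi * cot (of_real pi * z)"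
proof -
  have nz: "z \<notin> \<int>\<^sub>\<le>\<^sub>0" "1 - z \<notin> \<int>\<^sub>\<le>\<^sub>0"
    using z nonpos_Ints_Int Ints_diff[of 1 "1 - z"] by auto
  have s: "sin (of_real pi * z) \<noteq> 0"
    by (rule sin_pi_nonzero[OF z])
  have "((\<lambda>w. Gamma w * Gamma (1 - w)) has_field_derivative
      Gamma z * Gamma (1 - z) * (Digamma z - Digamma (1 - z))) (at z)"
    using nz by (auto intro!: derivative_eq_intros simp: algebra_simps)
  moreover have "((\<lambda>w. of_real pi / sin (of_real pi * w)) has_field_derivative
      - (of_real pi)\<^sup>2 * cos (of_real pi * z) / (sin (of_real pi * z))\<^sup>2) (at z)"
    using s by (auto intro!: derivative_eq_intros simp: power2_eq_square)
  then have "((\<lambda>w. Gamma w * Gamma (1 - w)) has_field_derivative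
      - (of_real pi)\<^sup>2 * cos (of_real pi * z) / (sin (of_real pi * z))\<^sup>2) (at z)"
    by (simp add: Gamma_reflection_complex)
  ultimately have eq: "Gamma z * Gamma (1 - z) * (Digamma z - Digamma (1 - z)) =
      - (of_real pi)\<^sup>2 * cos (of_real pi * z) / (sin (of_real pi * z))\<^sup>2"
    by (rule DERIV_unique)
  have "Digamma z - Digamma (1 - z) = sin (of_real pi * z) / of_real pi *
      (Gamma z * Gamma (1 - z) * (Digamma z - Digamma (1 - z)))"
    using s by (simp add: Gamma_reflection_complex)
  also have "\<dots> = - (of_real pi * cot (of_real pi * z))"
    unfolding eq cot_def using s by (simp add: field_simps power2_eq_square)
  finally show ?thesis by (metis minus_diff_eq minus_minus)
qed

text \<open>The Digamma series at \<open>1 - z\<close> and \<open>z\<close> are subtracted, whereby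
  their harmonic terms and Euler's constant cancel. The index \<open>k\<close> is paired with
  \<open>- 1 - k\<close>, as in \<open>has_sum_int_pairs\<close>, so that the pairs exhaust the
  integers.\<close>

lemma cot_partial_fractions:
  fixes z :: complex
  assumes z: "z \<notin> \<int>"
  shows "(\<lambda>k. 1 / (z + of_nat k) + 1 / (z - 1 - of_nat k)) sums (of_real pi * cot (of_real pi * z))"
proof -
  have z0: "z \<noteq> 0" "1 - z \<noteq> 0" using z by auto
  have *: "(\<lambda>k. inverse (of_nat (Suc k)) - inverse (w + of_nat k)) sums (Digamma w + euler_mascheroni)"
    if "w \<noteq> 0" for w :: complex
    using summable_Digamma[OF that] by (simp add: Digamma_def summable_sums)
  have "(\<lambda>k. (inverse (of_nat (Suc k)) - inverse (1 - z + of_nat k)) -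
             (inverse (of_nat (Suc k)) - inverse (z + of_nat k))) sums
        ((Digamma (1 - z) + euler_mascheroni) - (Digamma z + euler_mascheroni))"
    by (intro sums_diff * z0)
  moreover have "(inverse (of_nat (Suc k)) - inverse (1 - z + of_nat k)) -
        (inverse (of_nat (Suc k)) - inverse (z + of_nat k)) = 1 / (z + of_nat k) + 1 / (z - 1 - of_nat k)" for k
  proof -
    have "1 / (z - 1 - of_nat k) = - inverse (1 - z + of_nat k)"
    proof -
      have "z - 1 - of_nat k = - (1 - z + of_nat k)" by simp
      then show ?thesis by (simp only: inverse_eq_divide minus_divide_right[symmetric])
    qed
    then show ?thesis by (simp add: inverse_eq_divide)
  qed
  ultimately show ?thesis using Digamma_reflection[OF z] by (simp add: algebra_simps)
qed

lemma has_sum_int_pairs: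
  fixes f :: "int \<Rightarrow> 'a :: banach"
  assumes "summable (\<lambda>k. norm (f (int k)))" "summable (\<lambda>k. norm (f (- 1 - int k)))"
    and s: "(\<lambda>k. f (int k) + f (- 1 - int k)) sums S"
  shows "(f has_sum S) UNIV"
proof -
  have 1: "((\<lambda>k. f (int k)) has_sum (\<Sum>k. f (int k))) UNIV"
    by (intro norm_summable_imp_has_sum assms summable_sums summable_norm_cancel)
  have 2: "((\<lambda>k. f (- 1 - int k)) has_sum (\<Sum>k. f (- 1 - int k))) UNIV"
    by (intro norm_summable_imp_has_sum assms summable_sums summable_norm_cancel)
  have "(f has_sum (\<Sum>k. f (int k))) (range int)"
    using 1 by (subst has_sum_reindex) (auto simp: o_def inj_on_def)
  moreover have "(f has_sum (\<Sum>k. f (- 1 - int k))) (range (\<lambda>k. - 1 - int k))"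
    using 2 by (subst has_sum_reindex) (auto simp: o_def inj_on_def)
  moreover have "range int \<inter> range (\<lambda>k. - 1 - int k) = {}" by auto
  ultimately have "(f has_sum ((\<Sum>k. f (int k)) + (\<Sum>k. f (- 1 - int k)))) (range int \<union> range (\<lambda>k. - 1 - int k))"
    by (rule has_sum_Un_disjoint)
  moreover have "range int \<union> range (\<lambda>k. - 1 - int k) = UNIV"
  proof (intro equalityI subsetI UnCI)
    fix n :: int assume "n \<notin> range (\<lambda>k. - 1 - int k)"
    then have "n \<noteq> - 1 - int (nat (- 1 - n))" by blast
    then have "n \<ge> 0" by linarith
    then show "n \<in> range int" by (metis int_nat_eq rangeI)
  qed auto
  moreover have "(\<Sum>k. f (int k)) + (\<Sum>k. f (- 1 - int k)) = S"
    using s assms by (metis suminf_add summable_norm_cancel sums_unique)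
  ultimately show ?thesis by simp
qed

lemma summable_norm_inverse_quadratic:
  fixes u v :: complex
  shows "summable (\<lambda>k. norm (1 / ((of_nat k + u) * (of_nat k + v))))"
proof -
  obtain N where N: "real N \<ge> 2 * norm u" "real N \<ge> 2 * norm v" "N > 0"
  proof -
    obtain N where "max 1 (2 * max (norm u) (norm v)) \<le> real N" using real_arch_simple by blast
    then show ?thesis by (intro that[of N]) auto
  qed
  have *: "norm (1 / ((of_nat k + u) * (of_nat k + v))) \<le> 4 * inverse (real k ^ 2)" if k: "k \<ge> N" for k
  proof -
    have k0: "real k > 0" using k N by simp
    have half: "norm (of_nat k + w) \<ge> real k / 2" if "real N \<ge> 2 * norm w" for w :: complex
    proof -
      have "norm (of_nat k :: complex) \<le> norm (of_nat k + w) + norm w"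
        using norm_triangle_ineq4[of "of_nat k + w" w] by simp
      moreover have "2 * norm w \<le> real k" using that k by linarith
      ultimately show ?thesis by simp
    qed
    have "real k / 2 * (real k / 2) \<le> norm (of_nat k + u) * norm (of_nat k + v)"
      using half[OF N(1)] half[OF N(2)] by (intro mult_mono) auto
    then have "inverse (norm (of_nat k + u) * norm (of_nat k + v)) \<le> inverse (real k / 2 * (real k / 2))"
      using k0 by (intro le_imp_inverse_le) auto
    moreover have "inverse (real k / 2 * (real k / 2)) = 4 * inverse (real k ^ 2)"
      by (simp add: field_simps power2_eq_square)
    ultimately show ?thesis by (simp add: norm_divide norm_mult inverse_eq_divide)
  qed
  show ?thesis
    by (rule summable_comparison_test'[where g = "\<lambda>k. 4 * inverse (real k ^ 2)" and N = N])
       (use * in \<open>auto intro!: summable_mult inverse_power_summable\<close>)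
qed

lemma cot_exp: "cot w = \<i> * (exp (2 * \<i> * w) + 1) / (exp (2 * \<i> * w) - 1)" if "sin w \<noteq> 0"
proof -
  define y where "y = exp (\<i> * w)"
  have y: "y \<noteq> 0" "exp (2 * \<i> * w) = y * y" "exp (- (\<i> * w)) = inverse y"
    by (simp_all add: y_def exp_add[symmetric] exp_minus mult.assoc)
  have s: "sin w = (y * y - 1) / (2 * \<i> * y)" and c: "cos w = (y * y + 1) / (2 * y)"
    using y(1) by (simp_all add: sin_exp_eq cos_exp_eq y(3) y_def[symmetric] field_simps)
  then have "y * y - 1 \<noteq> 0" using that by auto
  then show ?thesis unfolding cot_def s c y(2) using y(1) by (simp add: field_simps)
qed

text \<open>Partial fractions with respect to the points x \<plusminus> i b, followed by the
  cotangent series. Because the phase \<open>e\<close> is its own inverse, both points lead to the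
  same \<open>u\<close>. The number \<open>b\<close> is complex since the cut-off moves the squared
  height of a row off the real axis.\<close>

lemma line_sum:
  fixes x :: real and b :: complex
  assumes b: "Re b > 0" and e: "exp (2 * of_real pi * \<i> * of_real x) = of_real e" and e1: "e = 1 \<or> e = -1"
  defines "u \<equiv> of_real e * exp (- 2 * of_real pi * b)"
  shows "((\<lambda>n :: int. 1 / ((of_int n + of_real x)\<^sup>2 + b\<^sup>2)) has_sum (of_real pi / b * ((1 + u) / (1 - u)))) UNIV"
proof -
  let ?z1 = "of_real x - \<i> * b" and ?z2 = "of_real x + \<i> * b"
  have b0: "b \<noteq> 0" using b by auto
  have nI: "?z1 \<notin> \<int>" "?z2 \<notin> \<int>"
    using b by (auto elim!: Ints_cases simp: complex_eq_iff)
  have fac: "(of_int n + of_real x)\<^sup>2 + b\<^sup>2 = (of_int n + ?z1) * (of_int n + ?z2)" for n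
    by (simp add: power2_eq_square algebra_simps)
  have nz: "of_int n + ?z1 \<noteq> 0" "of_int n + ?z2 \<noteq> 0" for n :: int
    using b by (auto simp: complex_eq_iff)
  define E where "E = exp (- 2 * of_real pi * b)"
  have uE: "u = of_real e * E" by (simp add: u_def E_def)
  have nE: "norm E < 1" using b by (simp add: E_def)
  have "norm u = norm E" using e1 by (auto simp: u_def E_def norm_mult)
  then have u1: "1 - u \<noteq> 0" "E \<noteq> 0"
    using nE by (auto simp: E_def)
  have ee: "of_real e * of_real e = (1 :: complex)" using e1 by auto
  have cot1: "cot (of_real pi * ?z1) = \<i> * (1 + u) / (1 - u)"
  proof -
    have "exp (2 * \<i> * (of_real pi * ?z1)) = of_real e / E"
      unfolding e[symmetric] E_def by (simp add: exp_diff[symmetric] exp_minus[symmetric] algebra_simps flip: exp_add)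
    moreover have "sin (of_real pi * ?z1) \<noteq> 0"
      by (rule sin_pi_nonzero[OF nI(1)])
    ultimately have "cot (of_real pi * ?z1) = \<i> * (of_real e / E + 1) / (of_real e / E - 1)"
      using cot_exp by simp
    also have "\<dots> = \<i> * (1 + u) / (1 - u)"
    proof -
      have "of_real e / E + 1 = of_real e / E * (1 + u)" "of_real e / E - 1 = of_real e / E * (1 - u)"
        using u1(2) ee unfolding uE by (simp_all add: field_simps)
      moreover have "of_real e / E \<noteq> 0" using u1 e1 by auto
      ultimately show ?thesis by (simp only:) (simp add: mult.left_commute[of \<i>])
    qed
    finally show ?thesis .
  qed
  have cot2: "cot (of_real pi * ?z2) = - \<i> * (1 + u) / (1 - u)"
  proof -
    have "exp (2 * \<i> * (of_real pi * ?z2)) = u"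
      unfolding u_def e[symmetric] by (simp add: algebra_simps flip: exp_add)
    moreover have "sin (of_real pi * ?z2) \<noteq> 0"
      by (rule sin_pi_nonzero[OF nI(2)])
    ultimately have "cot (of_real pi * ?z2) = \<i> * (u + 1) / (u - 1)"
      using cot_exp by simp
    also have "\<dots> = - \<i> * (1 + u) / (1 - u)"
    proof -
      have "u - 1 = - (1 - u)" "u + 1 = 1 + u" by simp_all
      then show ?thesis by (simp only: minus_divide_right[symmetric]) simp
    qed
    finally show ?thesis .
  qed
  show ?thesis
  proof (rule has_sum_int_pairs)
    show "summable (\<lambda>k. norm (1 / ((of_int (int k) + of_real x)\<^sup>2 + b\<^sup>2)))"
      unfolding fac using summable_norm_inverse_quadratic[of ?z1 ?z2] by simp
    have "(of_int (- 1 - int k) + of_real x)\<^sup>2 + b\<^sup>2 = (of_nat k + (1 - ?z1)) * (of_nat k + (1 - ?z2))" for k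
      by (simp add: power2_eq_square algebra_simps)
    then show "summable (\<lambda>k. norm (1 / ((of_int (- 1 - int k) + of_real x)\<^sup>2 + b\<^sup>2)))"
      using summable_norm_inverse_quadratic[of "1 - ?z1" "1 - ?z2"] by simp
    have pf: "1 / ((of_int n + of_real x)\<^sup>2 + b\<^sup>2) =
        1 / (2 * \<i> * b) * (1 / (?z1 + of_int n) - 1 / (?z2 + of_int n))" for n
      unfolding fac using nz[of n] b0 by (simp add: field_simps)
    have "(\<lambda>k. 1 / (2 * \<i> * b) * ((1 / (?z1 + of_nat k) + 1 / (?z1 - 1 - of_nat k)) -
             (1 / (?z2 + of_nat k) + 1 / (?z2 - 1 - of_nat k)))) sums
          (1 / (2 * \<i> * b) * (of_real pi * cot (of_real pi * ?z1) - of_real pi * cot (of_real pi * ?z2)))"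
      by (intro sums_mult sums_diff cot_partial_fractions nI)
    also have "(\<lambda>k. 1 / (2 * \<i> * b) * ((1 / (?z1 + of_nat k) + 1 / (?z1 - 1 - of_nat k)) -
             (1 / (?z2 + of_nat k) + 1 / (?z2 - 1 - of_nat k)))) =
        (\<lambda>k. 1 / ((of_int (int k) + of_real x)\<^sup>2 + b\<^sup>2) + 1 / ((of_int (- 1 - int k) + of_real x)\<^sup>2 + b\<^sup>2))"
      unfolding pf by (simp add: algebra_simps)
    also have "1 / (2 * \<i> * b) * (of_real pi * cot (of_real pi * ?z1) - of_real pi * cot (of_real pi * ?z2)) =
        of_real pi / b * ((1 + u) / (1 - u))"
    proof -
      have "1 / (2 * \<i> * b) * (of_real pi * (\<i> * W) - of_real pi * (- \<i> * W)) = of_real pi / b * W" for W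
        using b0 by (simp add: field_simps)
      then show ?thesis unfolding cot1 cot2 by (metis times_divide_eq_right)
    qed
    finally show "(\<lambda>k. 1 / ((of_int (int k) + of_real x)\<^sup>2 + b\<^sup>2) +
        1 / ((of_int (- 1 - int k) + of_real x)\<^sup>2 + b\<^sup>2)) sums (of_real pi / b * ((1 + u) / (1 - u)))" .
  qed
qed

text \<open>Each term differs from the increment of the antiderivative over the preceding unit
  interval by at most the variation of \<open>f\<close> there, which the increase of
  \<open>g\<close> majorises. These increases telescope.\<close>

lemma sum_antiderivative_bound:
  fixes f Phi f' :: "real \<Rightarrow> 'a :: real_normed_vector" and g g' :: "real \<Rightarrow> real"
  assumes MN: "M \<le> N"
    and Phi: "\<And>x. x \<ge> real M \<Longrightarrow> (Phi has_vector_derivative f x) (at x)"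
    and f: "\<And>x. x \<ge> real M \<Longrightarrow> (f has_vector_derivative f' x) (at x)"
    and g: "\<And>x. x \<ge> real M \<Longrightarrow> (g has_real_derivative g' x) (at x)"
    and le: "\<And>x. x \<ge> real M \<Longrightarrow> norm (f' x) \<le> g' x"
  shows "norm ((\<Sum>m\<in>{M<..N}. f (real m)) - (Phi (real N) - Phi (real M))) \<le> g (real N) - g (real M)"
  using MN
proof (induction N rule: dec_induct)
  case (step n)
  let ?a = "real n" and ?b = "real (Suc n)"
  have aM: "?a \<ge> real M" using step by simp
  have fb: "norm (f y - f x) \<le> g y - g x" if "?a \<le> x" "x \<le> y" for x y
  proof (cases "x = y")
    case False
    show ?thesis
    proof (rule differentiable_bound_general)
      show "x < y" using False that by simp
      show "continuous_on {x..y} f" "continuous_on {x..y} g"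
        using that aM by (auto intro!: continuous_on_vector_derivative[OF has_vector_derivative_at_within[OF f]]
            DERIV_continuous_on[OF has_field_derivative_at_within[OF g]])
      show "(f has_vector_derivative f' t) (at t)" if "x < t" "t < y" for t
        using that \<open>?a \<le> x\<close> aM by (intro f) simp
      show "(g has_vector_derivative g' t) (at t)" if "x < t" "t < y" for t
        using that \<open>?a \<le> x\<close> aM g[of t] by (simp add: has_real_derivative_iff_has_vector_derivative)
      show "norm (f' t) \<le> g' t" if "x < t" "t < y" for t
        using that \<open>?a \<le> x\<close> aM by (intro le) simp
    qed
  qed auto
  \<comment> \<open>The derivative of \<open>?h\<close> is \<open>f ?b - f x\<close>, so the mean
    value inequality for \<open>?h\<close> bounds precisely the error of the endpoint rule on this
    interval.\<close>
  let ?h = "\<lambda>x. x *\<^sub>R f ?b - Phi x"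
  have "norm (?h ?b - ?h ?a) \<le> (g ?b - g ?a) * ?b - (g ?b - g ?a) * ?a"
  proof (rule differentiable_bound_general)
    have dh: "(?h has_vector_derivative (f ?b - f t)) (at t)" if "t \<ge> ?a" for t
      using that aM by (auto intro!: derivative_eq_intros Phi)
    show "?a < ?b" by simp
    show "continuous_on {?a..?b} ?h"
      by (rule continuous_on_vector_derivative) (rule has_vector_derivative_at_within, rule dh, simp)
    show "continuous_on {?a..?b} ((*) (g ?b - g ?a))" by (intro continuous_intros)
    show "(?h has_vector_derivative (f ?b - f t)) (at t)" if "?a < t" "t < ?b" for t
      using that by (intro dh) simp
    show "((*) (g ?b - g ?a) has_vector_derivative (g ?b - g ?a)) (at t)" for t
      unfolding has_real_derivative_iff_has_vector_derivative[symmetric]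
      by (auto intro!: derivative_eq_intros)
    show "norm (f ?b - f t) \<le> g ?b - g ?a" if "?a < t" "t < ?b" for t
    proof -
      have "norm (f ?b - f t) \<le> g ?b - g t" using that by (intro fb) auto
      moreover have "0 \<le> g t - g ?a" using that by (intro order.trans[OF norm_ge_zero fb]) auto
      ultimately show ?thesis by simp
    qed
  qed
  moreover have "?h ?b - ?h ?a = f ?b - (Phi ?b - Phi ?a)"
    by (simp add: algebra_simps flip: scaleR_left_diff_distrib)
  ultimately have "norm (f ?b - (Phi ?b - Phi ?a)) \<le> g ?b - g ?a"
    by (simp add: algebra_simps)
  moreover have "{M<..Suc n} = insert (Suc n) {M<..n}" using step by auto
  then have "(\<Sum>m\<in>{M<..Suc n}. f (real m)) - (Phi ?b - Phi (real M)) =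
      (f ?b - (Phi ?b - Phi ?a)) + ((\<Sum>m\<in>{M<..n}. f (real m)) - (Phi ?a - Phi (real M)))"
    by simp
  then have "norm ((\<Sum>m\<in>{M<..Suc n}. f (real m)) - (Phi ?b - Phi (real M))) \<le>
      norm (f ?b - (Phi ?b - Phi ?a)) + norm ((\<Sum>m\<in>{M<..n}. f (real m)) - (Phi ?a - Phi (real M)))"
    by (simp only: norm_triangle_ineq)
  ultimately show ?case
    using step.IH by linarith
qed simp

text \<open>\<open>c\<close> takes the place of the height \<open>x\<close> of a row once the
  cut-off has added an imaginary constant to the denominators. It approaches \<open>x\<close> for
  large \<open>x\<close>, and its norm is never below half of \<open>Z\<close>.\<close>

lemma csqrt_line_bounds:
  fixes x Z :: real
  assumes x: "x \<ge> 0" and Z: "Z > 0"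
  defines "c \<equiv> csqrt (of_real (x\<^sup>2) + \<i> * of_real (Z\<^sup>2))"
  shows "norm c \<ge> x" "norm c \<ge> sqrt (x\<^sup>2 + Z\<^sup>2) / 2" "Re c > 0" "Re c \<ge> x" "norm (of_real x + c) \<ge> x"
    "x > 0 \<Longrightarrow> norm (c - of_real x) \<le> Z\<^sup>2 / x"
proof -
  define w where "w = of_real (x\<^sup>2) + \<i> * complex_of_real (Z\<^sup>2)"
  have Rw: "Re w = x\<^sup>2" "Im w = Z\<^sup>2" by (simp_all add: w_def flip: of_real_power)
  have cw: "c\<^sup>2 = w" by (simp add: c_def w_def)
  then have n2: "(norm c)\<^sup>2 = norm w" by (metis norm_power)
  have "x\<^sup>2 \<le> norm w" "Z\<^sup>2 \<le> norm w"
    using abs_Re_le_cmod[of w] abs_Im_le_cmod[of w] Rw by auto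
  then have le: "x\<^sup>2 \<le> (norm c)\<^sup>2" "Z\<^sup>2 \<le> (norm c)\<^sup>2" using n2 by auto
  show "norm c \<ge> x" using le(1) by (rule power2_le_imp_le) simp
  have "(sqrt (x\<^sup>2 + Z\<^sup>2) / 2)\<^sup>2 \<le> (norm c)\<^sup>2"
  proof -
    have "x\<^sup>2 + Z\<^sup>2 \<le> (norm c)\<^sup>2 * 4" using le zero_le_power2[of "norm c"] by linarith
    then show ?thesis by (simp add: power_divide)
  qed
  then show "norm c \<ge> sqrt (x\<^sup>2 + Z\<^sup>2) / 2" by (rule power2_le_imp_le) simp
  show Rc: "Re c > 0"
  proof -
    have "Re c \<ge> 0" unfolding c_def using csqrt_principal by (metis less_imp_le order.refl)
    moreover have "Re c \<noteq> 0"
    proof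
      assume "Re c = 0"
      then have "Im (c\<^sup>2) = 0" by (simp add: power2_eq_square)
      then show False using cw Rw Z by simp
    qed
    ultimately show ?thesis by simp
  qed
  have "(Re c)\<^sup>2 - (Im c)\<^sup>2 = x\<^sup>2" using cw Rw by (metis Re_power2)
  then have "x\<^sup>2 \<le> (Re c)\<^sup>2" using zero_le_power2[of "Im c"] by linarith
  then show "Re c \<ge> x" by (rule power2_le_imp_le) (use Rc in simp)
  have ge: "norm (of_real x + c) \<ge> x"
    using complex_Re_le_cmod[of "of_real x + c"] Rc by simp
  show "norm (of_real x + c) \<ge> x" by (fact ge)
  show "norm (c - of_real x) \<le> Z\<^sup>2 / x" if x0: "x > 0"
  proof -
    have "(c - of_real x) * (of_real x + c) = c\<^sup>2 - of_real (x\<^sup>2)"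
      by (simp add: power2_eq_square algebra_simps)
    also have "\<dots> = \<i> * complex_of_real (Z\<^sup>2)" unfolding cw w_def by simp
    finally have "norm (c - of_real x) * norm (of_real x + c) = Z\<^sup>2"
      by (metis abs_power2 mult_1 norm_ii norm_mult norm_of_real)
    moreover have "norm (c - of_real x) * x \<le> norm (c - of_real x) * norm (of_real x + c)"
      using ge by (intro mult_left_mono) auto
    ultimately show ?thesis using x0 by (simp add: field_simps)
  qed
qed

text \<open>The reciprocal of the square root has the antiderivative Ln (x + c), whose real part is
  close to ln (2 x) for large x and equal to \<open>ln Z\<close> at 0. Against the harmonic sum this
  leaves the stated constant.\<close>

lemma sum_inverse_csqrt:
  fixes Z :: real
  assumes Z: "Z > 0"
  defines "a \<equiv> (\<lambda>m. 1 / real (Suc m) - Re (1 / csqrt (of_real ((real (Suc m))\<^sup>2) + \<i> * of_real (Z\<^sup>2))))"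
  shows "summable a" "\<bar>suminf a - (euler_mascheroni - ln 2 + ln Z)\<bar> \<le> 8 / Z"
proof -
  define w where "w = (\<lambda>x :: real. of_real (x\<^sup>2) + \<i> * complex_of_real (Z\<^sup>2))"
  define f where "f = (\<lambda>x. 1 / csqrt (w x))"
  define Phi where "Phi = (\<lambda>x. Ln (of_real x + csqrt (w x)))"
  define f' where "f' = (\<lambda>x. - of_real x / csqrt (w x) ^ 3)"
  \<comment> \<open>\<open>g\<close> majorises the variation of \<open>f\<close>: the derivative of
    \<open>f\<close> has norm x / |c|^3, and the lower bound
    \<open>sqrt (x\<^sup>2 + Z\<^sup>2) / 2\<close> for |c| accounts for the factor 8.\<close>
  define g where "g = (\<lambda>x. - 8 / sqrt (x\<^sup>2 + Z\<^sup>2))"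
  define g' where "g' = (\<lambda>x. 8 * x / (sqrt (x\<^sup>2 + Z\<^sup>2)) ^ 3)"
  have w_eq: "of_real (x\<^sup>2) + \<i> * complex_of_real (Z\<^sup>2) = w x" for x by (simp add: w_def)
  note B = csqrt_line_bounds[OF _ Z, unfolded w_eq]
  have w_nonpos: "w x \<notin> \<real>\<^sub>\<le>\<^sub>0" for x
  proof -
    have "Im (w x) = Z\<^sup>2" by (simp add: w_def flip: of_real_power)
    then show ?thesis using Z by (auto simp: complex_nonpos_Reals_iff)
  qed
  have c0: "csqrt (w x) \<noteq> 0" if "x \<ge> 0" for x
    using B(3)[OF that] by (metis less_irrefl zero_complex.sel(1))
  have dw: "(w has_vector_derivative of_real (2 * x)) (at x)" for x
    unfolding w_def by (auto intro!: derivative_eq_intros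
        simp: has_vector_derivative_def scaleR_conv_of_real mult_ac)
  have dc: "((\<lambda>x. csqrt (w x)) has_vector_derivative (of_real x / csqrt (w x))) (at x)" if "x \<ge> 0" for x
  proof -
    have "((csqrt \<circ> w) has_vector_derivative (of_real (2 * x) * (1 / (2 * csqrt (w x))))) (at x)"
      by (rule field_vector_diff_chain_at[OF dw]) (use has_field_derivative_csqrt[OF w_nonpos[of x]] in \<open>simp add: inverse_eq_divide\<close>)
    then show ?thesis using c0[OF that] by (simp add: o_def field_simps)
  qed
  have df: "(f has_vector_derivative f' x) (at x)" if "x \<ge> 0" for x
  proof -
    have "((\<lambda>z. 1 / z) has_field_derivative - 1 / (csqrt (w x))\<^sup>2) (at (csqrt (w x)))"
      using c0[OF that] by (auto intro!: derivative_eq_intros simp: power2_eq_square)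
    from field_vector_diff_chain_at[OF dc[OF that] this]
    show ?thesis unfolding f_def f'_def o_def
      by (simp add: field_simps power2_eq_square power3_eq_cube)
  qed
  have dPhi: "(Phi has_vector_derivative f x) (at x)" if "x \<ge> 0" for x
  proof -
    have R: "Re (of_real x + csqrt (w x)) > 0"
      using add_nonneg_pos[OF that B(3)[OF that]] by (simp only: plus_complex.sel Re_complex_of_real)
    then have np: "of_real x + csqrt (w x) \<notin> \<real>\<^sub>\<le>\<^sub>0" by (auto simp: complex_nonpos_Reals_iff)
    have n0: "of_real x + csqrt (w x) \<noteq> 0" using R by (metis less_irrefl zero_complex.sel(1))
    have "((\<lambda>x. of_real x + csqrt (w x)) has_vector_derivative (1 + of_real x / csqrt (w x))) (at x)"
      by (auto intro!: derivative_eq_intros dc that)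
    moreover have "(Ln has_field_derivative inverse (of_real x + csqrt (w x))) (at (of_real x + csqrt (w x)))"
      by (rule has_field_derivative_Ln[OF np])
    ultimately have "((Ln \<circ> (\<lambda>x. of_real x + csqrt (w x))) has_vector_derivative
        ((1 + of_real x / csqrt (w x)) * inverse (of_real x + csqrt (w x)))) (at x)"
      by (rule field_vector_diff_chain_at)
    moreover have "(1 + of_real x / csqrt (w x)) * inverse (of_real x + csqrt (w x)) = f x"
    proof -
      have "1 + of_real x / csqrt (w x) = (of_real x + csqrt (w x)) / csqrt (w x)"
        using c0[OF that] by (simp add: field_simps)
      then show ?thesis using n0 by (simp add: f_def)
    qed
    ultimately show ?thesis by (simp add: Phi_def o_def)
  qed
  have s0: "x\<^sup>2 + Z\<^sup>2 > 0" for x using Z by (simp add: add_nonneg_pos)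
  have dg: "(g has_real_derivative g' x) (at x)" for x
    unfolding g_def g'_def using s0[of x]
    by (auto intro!: derivative_eq_intros simp: field_simps power3_eq_cube)
  have le: "norm (f' x) \<le> g' x" if "x \<ge> 0" for x
  proof -
    have sp: "sqrt (x\<^sup>2 + Z\<^sup>2) > 0" using s0 by simp
    have "(sqrt (x\<^sup>2 + Z\<^sup>2) / 2) ^ 3 \<le> norm (csqrt (w x)) ^ 3"
      using B(2)[OF that] sp by (intro power_mono) auto
    then have "x / norm (csqrt (w x)) ^ 3 \<le> x / (sqrt (x\<^sup>2 + Z\<^sup>2) / 2) ^ 3"
      using that sp by (intro divide_left_mono mult_pos_pos zero_less_power) (auto intro: less_le_trans[OF _ B(2)[OF that]])
    then show ?thesis using that by (simp add: f'_def g'_def norm_divide norm_power power_divide mult.commute)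
  qed
  have bound: "\<bar>Re (\<Sum>m\<in>{0<..N}. f (real m)) - (ln (norm (of_real (real N) + csqrt (w (real N)))) - ln Z)\<bar> \<le> 8 / Z" for N
  proof -
    have "norm ((\<Sum>m\<in>{0<..N}. f (real m)) - (Phi (real N) - Phi (real 0))) \<le> g (real N) - g (real 0)"
      by (rule sum_antiderivative_bound[where f' = f' and g' = g']) (use dPhi df dg le in auto)
    also have "\<dots> \<le> 8 / Z" using Z by (simp add: g_def)
    finally have "\<bar>Re ((\<Sum>m\<in>{0<..N}. f (real m)) - (Phi (real N) - Phi (real 0)))\<bar> \<le> 8 / Z"
      using abs_Re_le_cmod order.trans by blast
    moreover have "Re (Phi x) = ln (norm (of_real x + csqrt (w x)))" if "x \<ge> 0" for x
    proof -
      have "Re (of_real x + csqrt (w x)) > 0"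
      using add_nonneg_pos[OF that B(3)[OF that]] by (simp only: plus_complex.sel Re_complex_of_real)
      then have "of_real x + csqrt (w x) \<noteq> 0" by (metis less_irrefl zero_complex.sel(1))
      then show ?thesis by (simp add: Phi_def)
    qed
    moreover have "norm (csqrt (w 0)) = Z"
    proof -
      have "(norm (csqrt (w 0)))\<^sup>2 = norm (w 0)" by (metis norm_power power2_csqrt)
      also have "\<dots> = Z\<^sup>2" by (simp add: w_def norm_mult norm_power)
      finally show ?thesis using Z by (simp add: power2_eq_iff_nonneg)
    qed
    ultimately show ?thesis by simp
  qed
  have a_eq: "a m = 1 / real (Suc m) - Re (f (real (Suc m)))" for m
    by (simp add: a_def f_def w_def)
  have a_le: "norm (a m) \<le> Z\<^sup>2 * inverse (real (Suc m) ^ 2)" for m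
  proof -
    let ?x = "real (Suc m)"
    have x0: "?x \<ge> 0" "?x > 0" "?x \<ge> 1" by auto
    have cn: "norm (csqrt (w ?x)) \<ge> ?x" "norm (csqrt (w ?x)) > 0"
      using B(1)[OF x0(1)] x0 by auto
    have am: "a m = Re (of_real (1 / ?x) - f ?x)" by (simp add: a_eq)
    have "norm (a m) \<le> norm (of_real (1 / ?x) - f ?x)"
      unfolding am real_norm_def by (rule abs_Re_le_cmod)
    also have "of_real (1 / ?x) - f ?x = (csqrt (w ?x) - of_real ?x) / (of_real ?x * csqrt (w ?x))"
      using c0[OF x0(1)] x0(2) by (simp add: f_def divide_simps del: of_nat_Suc)
    also have "norm \<dots> = norm (csqrt (w ?x) - of_real ?x) / (?x * norm (csqrt (w ?x)))"
      by (simp add: norm_divide norm_mult del: of_nat_Suc)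
    also have "\<dots> \<le> (Z\<^sup>2 / ?x) / (?x * ?x)"
      using B(6)[OF x0(1,2)] cn x0 by (intro frac_le mult_left_mono mult_pos_pos) auto
    also have "\<dots> \<le> (Z\<^sup>2 / 1) / (?x * ?x)"
      using x0 by (intro divide_right_mono divide_left_mono) auto
    finally show ?thesis by (simp add: field_simps power2_eq_square)
  qed
  have "summable (\<lambda>m. inverse (real (Suc m) ^ 2))"
    using summable_Suc_iff[of "\<lambda>m. inverse (real m ^ 2)"] inverse_power_summable[of 2, where ?'a = real] by simp
  then have "summable (\<lambda>m. Z\<^sup>2 * inverse (real (Suc m) ^ 2))" by (rule summable_mult)
  then show sa: "summable a"
    by (rule summable_comparison_test'[where N = 0]) (rule a_le)
  define L where "L = (\<lambda>N. harm N - ln (real N) - (ln (norm (of_real (real N) + csqrt (w (real N)))) - ln (real N)) + ln Z)"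
  have part: "\<bar>(\<Sum>m<N. a m) - L N\<bar> \<le> 8 / Z" for N
  proof -
    have "(\<Sum>m<N. a m) = harm N - Re (\<Sum>m\<in>{0<..N}. f (real m))"
    proof -
      have "{0<..N} = Suc ` {..<N}" by (auto simp: image_iff Suc_le_eq) (metis Suc_pred lessThan_iff Suc_le_lessD)
      then have "(\<Sum>m\<in>{0<..N}. f (real m)) = (\<Sum>m<N. f (real (Suc m)))"
        by (simp add: sum.reindex)
      then show ?thesis
        by (simp add: a_eq sum_subtractf harm_altdef inverse_eq_divide)
    qed
    then have "(\<Sum>m<N. a m) - L N = - (Re (\<Sum>m\<in>{0<..N}. f (real m)) - (ln (norm (of_real (real N) + csqrt (w (real N)))) - ln Z))"
      by (simp add: L_def)
    then show ?thesis using bound[of N] by (simp only: abs_minus_cancel)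
  qed
  have "(\<lambda>N. ln (norm (of_real (real N) + csqrt (w (real N)))) - ln (real N)) \<longlonglongrightarrow> ln 2"
  proof -
    have ev: "\<bar>norm (of_real (real N) + csqrt (w (real N))) / real N - 2\<bar> \<le> Z\<^sup>2 / real N ^ 2" if "N > 0" for N
    proof -
      let ?x = "real N"
      have x0: "?x > 0" using that by simp
      have "\<bar>norm (of_real ?x + csqrt (w ?x)) - norm (complex_of_real (2 * ?x))\<bar> \<le>
          norm ((of_real ?x + csqrt (w ?x)) - complex_of_real (2 * ?x))"
        by (rule norm_triangle_ineq3)
      also have "(of_real ?x + csqrt (w ?x)) - complex_of_real (2 * ?x) = csqrt (w ?x) - of_real ?x" by simp
      also have "norm \<dots> \<le> Z\<^sup>2 / ?x" by (rule B(6)) (use x0 in auto)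
      finally have "\<bar>norm (of_real ?x + csqrt (w ?x)) - 2 * ?x\<bar> \<le> Z\<^sup>2 / ?x" by (simp add: norm_mult)
      moreover have "norm (of_real ?x + csqrt (w ?x)) / ?x - 2 = (norm (of_real ?x + csqrt (w ?x)) - 2 * ?x) / ?x"
        using x0 by (simp add: field_simps)
      ultimately show ?thesis using x0 by (simp add: abs_divide field_simps power2_eq_square)
    qed
    have "(\<lambda>N. norm (of_real (real N) + csqrt (w (real N))) / real N - 2) \<longlonglongrightarrow> 0"
    proof (rule Lim_null_comparison)
      show "\<forall>\<^sub>F N in sequentially. norm (norm (of_real (real N) + csqrt (w (real N))) / real N - 2) \<le> Z\<^sup>2 / real N ^ 2"
        using ev by (intro eventually_sequentiallyI[of 1]) auto
      show "(\<lambda>N. Z\<^sup>2 / real N ^ 2) \<longlonglongrightarrow> 0" by real_asymp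
    qed
    then have "(\<lambda>N. norm (of_real (real N) + csqrt (w (real N))) / real N) \<longlonglongrightarrow> 2"
      by (simp add: LIM_zero_iff)
    then have "(\<lambda>N. ln (norm (of_real (real N) + csqrt (w (real N))) / real N)) \<longlonglongrightarrow> ln 2"
      by (intro tendsto_ln) auto
    moreover have "\<forall>\<^sub>F N in sequentially. ln (norm (of_real (real N) + csqrt (w (real N))) / real N) =
        ln (norm (of_real (real N) + csqrt (w (real N)))) - ln (real N)"
    proof (intro eventually_sequentiallyI[of 1])
      fix N :: nat assume "1 \<le> N"
      then have "norm (of_real (real N) + csqrt (w (real N))) > 0" using B(5)[of "real N"] by linarith
      then show "ln (norm (of_real (real N) + csqrt (w (real N))) / real N) =
        ln (norm (of_real (real N) + csqrt (w (real N)))) - ln (real N)"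
        using \<open>1 \<le> N\<close> by (simp add: ln_div)
    qed
    ultimately show ?thesis by (rule Lim_transform_eventually)
  qed
  then have "L \<longlonglongrightarrow> euler_mascheroni - ln 2 + ln Z"
    unfolding L_def by (intro tendsto_intros euler_mascheroni_LIMSEQ)
  then have "(\<lambda>N. \<bar>(\<Sum>m<N. a m) - L N\<bar>) \<longlonglongrightarrow> \<bar>suminf a - (euler_mascheroni - ln 2 + ln Z)\<bar>"
    using summable_LIMSEQ[OF sa] by (intro tendsto_intros)
  then show "\<bar>suminf a - (euler_mascheroni - ln 2 + ln Z)\<bar> \<le> 8 / Z"
    by (rule LIMSEQ_le_const2) (use part in auto)
qed

section \<open>The theta function as a product\<close>

text \<open>Minus the logarithm of the product of 1 - Q^k over k \<ge> 1, rearranged as a Lambert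
  series. In this shape it comes out of the rows of a lattice, each of which contributes (1 + Q^k) /
  (k (1 - Q^k)).\<close>

definition log_euler :: "real \<Rightarrow> real" where
  "log_euler Q = (\<Sum>m. Q ^ Suc m / (real (Suc m) * (1 - Q ^ Suc m)))"

lemma summable_log_euler:
  assumes "\<bar>Q\<bar> < 1"
  shows "summable (\<lambda>m. norm (Q ^ Suc m / (real (Suc m) * (1 - Q ^ Suc m))))"
proof (rule summable_comparison_test'[where N = 0])
  show "summable (\<lambda>m. \<bar>Q\<bar> ^ m * (\<bar>Q\<bar> / (1 - \<bar>Q\<bar>)))"
    using assms by (intro summable_mult2 summable_geometric) auto
  show "norm (norm (Q ^ Suc m / (real (Suc m) * (1 - Q ^ Suc m)))) \<le> \<bar>Q\<bar> ^ m * (\<bar>Q\<bar> / (1 - \<bar>Q\<bar>))" for m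
  proof -
    have "\<bar>Q ^ Suc m\<bar> \<le> \<bar>Q\<bar>"
      using assms power_decreasing[of 1 "Suc m" "\<bar>Q\<bar>"] by (simp add: power_abs abs_mult)
    then have "1 - \<bar>Q\<bar> \<le> 1 - Q ^ Suc m" by linarith
    then have pos: "1 - Q ^ Suc m > 0" using assms by linarith
    have "1 * (1 - \<bar>Q\<bar>) \<le> real (Suc m) * (1 - Q ^ Suc m)"
      using assms \<open>1 - \<bar>Q\<bar> \<le> _\<close> by (intro mult_mono) auto
    then have "\<bar>Q\<bar> ^ Suc m / (real (Suc m) * (1 - Q ^ Suc m)) \<le> \<bar>Q\<bar> ^ Suc m / (1 - \<bar>Q\<bar>)"
      using assms pos by (intro divide_left_mono mult_pos_pos) auto
    moreover have "norm (norm (Q ^ Suc m / (real (Suc m) * (1 - Q ^ Suc m)))) =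
        \<bar>Q\<bar> ^ Suc m / (real (Suc m) * (1 - Q ^ Suc m))"
      using pos by (simp add: abs_mult power_abs abs_divide del: of_nat_Suc power_Suc)
    moreover have "\<bar>Q\<bar> ^ Suc m / (1 - \<bar>Q\<bar>) = \<bar>Q\<bar> ^ m * (\<bar>Q\<bar> / (1 - \<bar>Q\<bar>))" by simp
    ultimately show ?thesis by linarith
  qed
qed

text \<open>The double series of (Q^k)^m / m is summed over k as a geometric series and over m as a
  logarithm. Its absolute convergence is read off from the same series at |Q|, since
  \<open>Q\<close> may be negative.\<close>

lemma log_euler_prod:
  assumes Q: "\<bar>Q\<bar> < 1"
  shows "(\<lambda>n. \<Prod>k<n. 1 - Q ^ Suc k) \<longlonglongrightarrow> exp (- log_euler Q)"
proof -
  define h where "h = (\<lambda>Q (m, k). (Q ^ Suc k) ^ Suc m / real (Suc m))"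
  have pow: "\<bar>Q ^ Suc m\<bar> < 1" for m
    using Q power_less_one_iff[of "\<bar>Q\<bar>" "Suc m"] by (simp only: power_abs) simp
  have row: "((\<lambda>k. h Q (m, k)) has_sum (Q ^ Suc m / (real (Suc m) * (1 - Q ^ Suc m)))) UNIV"
    if Q: "\<bar>Q\<bar> < 1" for Q m
  proof (rule norm_summable_imp_has_sum)
    have pow: "\<bar>Q ^ Suc m\<bar> < 1"
      using Q power_less_one_iff[of "\<bar>Q\<bar>" "Suc m"] by (simp only: power_abs) simp
    have eq: "(Q ^ Suc k) ^ Suc m = (Q ^ Suc m) ^ k * Q ^ Suc m" for k
      by (metis power_Suc2 power_mult mult.commute)
    have "summable (\<lambda>k. \<bar>Q ^ Suc m\<bar> ^ k * (\<bar>Q ^ Suc m\<bar> / real (Suc m)))"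
      using pow by (intro summable_mult2 summable_geometric) auto
    then show "summable (\<lambda>k. norm (h Q (m, k)))"
      unfolding h_def prod.case eq by (simp add: abs_mult power_abs del: power_Suc of_nat_Suc)
    have "(\<lambda>k. (Q ^ Suc m) ^ k * (Q ^ Suc m / real (Suc m))) sums (1 / (1 - Q ^ Suc m) * (Q ^ Suc m / real (Suc m)))"
      using pow by (intro sums_mult2 geometric_sums) auto
    then show "(\<lambda>k. h Q (m, k)) sums (Q ^ Suc m / (real (Suc m) * (1 - Q ^ Suc m)))"
      unfolding h_def prod.case eq by (simp add: mult.commute del: power_Suc of_nat_Suc)
  qed
  have "h \<bar>Q\<bar> summable_on (UNIV \<times> UNIV)"
  proof (rule summable_on_SigmaI)
    show "((\<lambda>k. h \<bar>Q\<bar> (m, k)) has_sum (\<bar>Q\<bar> ^ Suc m / (real (Suc m) * (1 - \<bar>Q\<bar> ^ Suc m)))) UNIV" for m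
      using Q by (intro row) simp
    show "(\<lambda>m. \<bar>Q\<bar> ^ Suc m / (real (Suc m) * (1 - \<bar>Q\<bar> ^ Suc m))) summable_on UNIV"
      using Q by (intro norm_summable_imp_summable_on summable_log_euler) simp
  qed (auto simp: h_def)
  then have "(\<lambda>x. norm (h Q x)) summable_on (UNIV \<times> UNIV)"
    by (simp add: h_def case_prod_unfold power_abs abs_mult del: power_Suc of_nat_Suc)
  then have "h Q summable_on (UNIV \<times> UNIV)" by (rule abs_summable_summable)
  then obtain S where S: "(h Q has_sum S) (UNIV \<times> UNIV)" by (auto simp: summable_on_def)
  have col: "((\<lambda>m. h Q (m, k)) has_sum (- ln (1 - Q ^ Suc k))) UNIV" for k
  proof (rule norm_summable_imp_has_sum)
    have "(\<lambda>n. - ((- (- (Q ^ Suc k))) ^ n) / real n) sums ln (1 + - (Q ^ Suc k))"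
      using pow[of k] by (intro ln_series') (simp del: power_Suc)
    then have "(\<lambda>n. - (- ((Q ^ Suc k) ^ n) / real n)) sums - ln (1 - Q ^ Suc k)"
      by (intro sums_minus) (simp del: power_Suc)
    then have "(\<lambda>n. (Q ^ Suc k) ^ n / real n) sums - ln (1 - Q ^ Suc k)" by simp
    then show "(\<lambda>m. h Q (m, k)) sums - ln (1 - Q ^ Suc k)"
      using sums_Suc_iff[of "\<lambda>n. (Q ^ Suc k) ^ n / real n" "- ln (1 - Q ^ Suc k)"]
      by (simp add: h_def del: power_Suc of_nat_Suc)
    have "summable (\<lambda>m. \<bar>Q ^ Suc k\<bar> ^ m)" using pow[of k] by (intro summable_geometric) auto
    then show "summable (\<lambda>m. norm (h Q (m, k)))"
    proof (rule summable_comparison_test'[where N = 0])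
      fix m
      have "\<bar>Q ^ Suc k\<bar> ^ Suc m \<le> \<bar>Q ^ Suc k\<bar> ^ m"
        using pow[of k] by (intro power_decreasing) auto
      moreover have "\<bar>Q ^ Suc k\<bar> ^ Suc m / real (Suc m) \<le> \<bar>Q ^ Suc k\<bar> ^ Suc m / 1"
        by (intro divide_left_mono) auto
      ultimately have "\<bar>Q ^ Suc k\<bar> ^ Suc m / real (Suc m) \<le> \<bar>Q ^ Suc k\<bar> ^ m" by linarith
      then show "norm (norm (h Q (m, k))) \<le> \<bar>Q ^ Suc k\<bar> ^ m"
        by (simp add: h_def power_abs abs_mult del: power_Suc of_nat_Suc)
    qed
  qed
  have "((\<lambda>m. Q ^ Suc m / (real (Suc m) * (1 - Q ^ Suc m))) has_sum S) UNIV"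
    by (rule has_sum_SigmaD[OF S]) (use row[OF Q] in auto)
  then have "S = log_euler Q"
    unfolding log_euler_def by (intro sums_unique has_sum_imp_sums)
  have "((\<lambda>(k, m). h Q (m, k)) has_sum S) (UNIV \<times> UNIV)"
    using S by (subst has_sum_swap) auto
  then have "((\<lambda>k. - ln (1 - Q ^ Suc k)) has_sum S) UNIV"
    by (rule has_sum_SigmaD) (use col in auto)
  then have "(\<lambda>n. \<Sum>k<n. - ln (1 - Q ^ Suc k)) \<longlonglongrightarrow> log_euler Q"
    unfolding \<open>S = log_euler Q\<close> by (intro has_sum_imp_sums[unfolded sums_def])
  then have "(\<lambda>n. exp (- (\<Sum>k<n. - ln (1 - Q ^ Suc k)))) \<longlonglongrightarrow> exp (- log_euler Q)"
    by (intro tendsto_intros)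
  moreover have "exp (- (\<Sum>k<n. - ln (1 - Q ^ Suc k))) = (\<Prod>k<n. 1 - Q ^ Suc k)" for n
  proof -
    have "1 - Q ^ Suc k > 0" for k using pow[of k] by linarith
    then show ?thesis by (simp add: sum_negf exp_sum del: power_Suc)
  qed
  ultimately show ?thesis by simp
qed

section \<open>The finite triple product at z = 1 and its limit\<close>

definition q_poch :: "real \<Rightarrow> nat \<Rightarrow> real" where
  "q_poch q n = (\<Prod>k<n. 1 - q ^ (2 * Suc k))"

text \<open>The reciprocal of (q^2; q^2)_m, extended by zero to negative indices like 1 / m!. The
  recursion \<open>inv_poch_rec\<close> then holds at every integer, because
  \<open>1 - q powi (2 * m)\<close> vanishes at \<open>m = 0\<close>.\<close>

definition inv_poch :: "real \<Rightarrow> int \<Rightarrow> real" where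
  "inv_poch q m = (if m < 0 then 0 else 1 / q_poch q (nat m))"

lemma q_poch_pos: "0 < q \<Longrightarrow> q < 1 \<Longrightarrow> q_poch q n > 0"
  unfolding q_poch_def by (intro prod_pos) (auto simp: power_less_one_iff simp del: power_Suc mult_Suc_right)

lemma inv_poch_rec:
  assumes q: "0 < q" "q < 1"
  shows "inv_poch q (m - 1) = (1 - q powi (2 * m)) * inv_poch q m"
proof (cases "m \<ge> 1")
  case True
  then obtain k where k: "m = int (Suc k)" by (metis nonneg_int_cases zero_le_one order.trans not0_implies_Suc of_nat_0 not_one_le_zero)
  have "q powi (2 * m) = q ^ (2 * Suc k)" unfolding k by (metis of_nat_mult of_nat_numeral power_int_of_nat)
  moreover have "1 - q ^ (2 * Suc k) > 0" using q by (simp add: power_less_one_iff del: mult_Suc_right)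
  moreover have "nat (int (Suc k) - 1) = k" "nat (int (Suc k)) = Suc k" by simp_all
  ultimately show ?thesis
    by (simp add: inv_poch_def k q_poch_def del: mult_Suc_right power_Suc of_nat_Suc)
next
  case False
  then consider "m = 0" | "m < 0" by linarith
  then show ?thesis by cases (auto simp: inv_poch_def)
qed

text \<open>The coefficient of \<open>z\<^sup>j\<close> in \<open>\<Prod>k<n. (1 + q\<^bsup>2k+1\<^esup> z) (1 + q\<^bsup>2k+1\<^esup> / z)\<close>, a Gaussian binomial
  coefficient in base \<open>q\<^sup>2\<close> times a power of \<open>q\<close>; it is only evaluated at \<open>z = 1\<close>.\<close>

definition theta_coeff :: "real \<Rightarrow> nat \<Rightarrow> int \<Rightarrow> real" where
  "theta_coeff q n j = q powi (j\<^sup>2) * q_poch q (2 * n) * inv_poch q (int n - j) * inv_poch q (int n + j)"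

text \<open>Passing from \<open>n\<close> to \<open>Suc n\<close> multiplies the product by 1 +
  q^(4n+2) + q^(2n+1) (z + 1/z), and the coefficients of z^j are compared. All four are multiples of
  one quantity \<open>X\<close>, and there remains a polynomial identity in \<open>a\<close>,
  \<open>b\<close>, \<open>t\<close>.\<close>

lemma theta_coeff_rec:
  assumes q: "0 < q" "q < 1"
  shows "theta_coeff q (Suc n) j = (1 + q ^ (4 * n + 2)) * theta_coeff q n j +
           q ^ (2 * n + 1) * (theta_coeff q n (j - 1) + theta_coeff q n (j + 1))"
proof -
  define a b t where "a = q powi (2 * (int n + 1 - j))" and "b = q powi (2 * (int n + 1 + j))"
    and "t = 1 / q\<^sup>2"
  define X where "X = q powi (j\<^sup>2) * q_poch q (2 * n) * (inv_poch q (int n + 1 - j) * inv_poch q (int n + 1 + j))"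
  have q0: "q \<noteq> 0" using q by simp
  have ab: "q ^ (4 * n + 4) = a * b" "q ^ (4 * n + 2) = a * b * t"
  proof -
    have e: "a * b = q powi (int (4 * n + 4))"
      unfolding a_def b_def using q0 by (simp add: power_int_add[symmetric] algebra_simps)
    then show "q ^ (4 * n + 4) = a * b" by (simp only: power_int_of_nat)
    then show "q ^ (4 * n + 2) = a * b * t" using q0 by (simp add: t_def power_add field_simps eval_nat_numeral)
  qed
  have r1: "inv_poch q (int n - j) = (1 - a) * inv_poch q (int n + 1 - j)"
    using inv_poch_rec[OF q, of "int n + 1 - j"] by (simp add: a_def algebra_simps)
  have r2: "inv_poch q (int n + j) = (1 - b) * inv_poch q (int n + 1 + j)"
    using inv_poch_rec[OF q, of "int n + 1 + j"] by (simp add: b_def algebra_simps)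
  have at: "q powi (2 * (int n - j)) = a * t"
  proof -
    have "a = q powi (2 * (int n - j) + 2)" by (simp add: a_def algebra_simps)
    also have "\<dots> = q powi (2 * (int n - j)) * q\<^sup>2" using q0 by (subst power_int_add) auto
    finally show ?thesis using q0 by (simp add: t_def)
  qed
  have bt: "q powi (2 * (int n + j)) = b * t"
  proof -
    have "b = q powi (2 * (int n + j) + 2)" by (simp add: b_def algebra_simps)
    also have "\<dots> = q powi (2 * (int n + j)) * q\<^sup>2" using q0 by (subst power_int_add) auto
    finally show ?thesis using q0 by (simp add: t_def)
  qed
  have r3: "inv_poch q (int n - (j + 1)) = (1 - a * t) * ((1 - a) * inv_poch q (int n + 1 - j))"
    using inv_poch_rec[OF q, of "int n - j"] unfolding at r1 by (simp add: algebra_simps)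
  have r4: "inv_poch q (int n + (j - 1)) = (1 - b * t) * ((1 - b) * inv_poch q (int n + 1 + j))"
    using inv_poch_rec[OF q, of "int n + j"] unfolding bt r2 by (simp add: algebra_simps)
  have p1: "q ^ (2 * n + 1) * q powi ((j - 1)\<^sup>2) = a * q powi (j\<^sup>2)"
  proof -
    have "q ^ (2 * n + 1) * q powi ((j - 1)\<^sup>2) = q powi (int (2 * n + 1) + (j - 1)\<^sup>2)"
      by (simp only: power_int_add[OF disjI1[OF q0]] power_int_of_nat)
    also have "int (2 * n + 1) + (j - 1)\<^sup>2 = 2 * (int n + 1 - j) + j\<^sup>2"
      by (simp add: power2_eq_square algebra_simps)
    finally show ?thesis using q0 by (simp add: a_def power_int_add)
  qed
  have p2: "q ^ (2 * n + 1) * q powi ((j + 1)\<^sup>2) = b * q powi (j\<^sup>2)"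
  proof -
    have "q ^ (2 * n + 1) * q powi ((j + 1)\<^sup>2) = q powi (int (2 * n + 1) + (j + 1)\<^sup>2)"
      by (simp only: power_int_add[OF disjI1[OF q0]] power_int_of_nat)
    also have "int (2 * n + 1) + (j + 1)\<^sup>2 = 2 * (int n + 1 + j) + j\<^sup>2"
      by (simp add: power2_eq_square algebra_simps)
    finally show ?thesis using q0 by (simp add: b_def power_int_add)
  qed
  have P: "q_poch q (2 * Suc n) = q_poch q (2 * n) * (1 - a * b * t) * (1 - a * b)"
  proof -
    have "2 * Suc (2 * n) = 4 * n + 2" "2 * Suc (Suc (2 * n)) = 4 * n + 4" "2 * Suc n = Suc (Suc (2 * n))" by simp_all
    then show ?thesis unfolding q_poch_def by (simp only: prod.lessThan_Suc ab)
  qed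
  have T0: "theta_coeff q (Suc n) j = (1 - a * b * t) * (1 - a * b) * X"
    unfolding theta_coeff_def P X_def by (simp add: algebra_simps)
  have T1: "theta_coeff q n j = (1 - a) * (1 - b) * X"
    unfolding theta_coeff_def r1 r2 X_def by (simp add: mult_ac)
  have "q ^ (2 * n + 1) * theta_coeff q n (j - 1) =
      (q ^ (2 * n + 1) * q powi ((j - 1)\<^sup>2)) * q_poch q (2 * n) * inv_poch q (int n - (j - 1)) * inv_poch q (int n + (j - 1))"
    by (simp add: theta_coeff_def mult_ac)
  also have "\<dots> = a * (1 - b) * (1 - b * t) * X"
    unfolding p1 r4 X_def by (simp add: mult_ac algebra_simps)
  finally have T2: "q ^ (2 * n + 1) * theta_coeff q n (j - 1) = a * (1 - b) * (1 - b * t) * X" .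
  have "q ^ (2 * n + 1) * theta_coeff q n (j + 1) =
      (q ^ (2 * n + 1) * q powi ((j + 1)\<^sup>2)) * q_poch q (2 * n) * inv_poch q (int n - (j + 1)) * inv_poch q (int n + (j + 1))"
    by (simp add: theta_coeff_def mult_ac)
  also have "\<dots> = b * (1 - a) * (1 - a * t) * X"
    unfolding p2 r3 X_def by (simp add: mult_ac algebra_simps)
  finally have T3: "q ^ (2 * n + 1) * theta_coeff q n (j + 1) = b * (1 - a) * (1 - a * t) * X" .
  have "(1 - a * b * t) * (1 - a * b) =
      (1 + a * b * t) * ((1 - a) * (1 - b)) + (a * (1 - b) * (1 - b * t) + b * (1 - a) * (1 - a * t))"
    by (simp add: algebra_simps)
  then show ?thesis
    unfolding T0 distrib_left[of "q ^ (2 * n + 1)"] T2 T3 T1 ab(2) by (simp only:) (simp add: algebra_simps)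
qed

lemma theta_coeff_eq_0: "\<bar>j\<bar> > int n \<Longrightarrow> theta_coeff q n j = 0"
  by (auto simp: theta_coeff_def inv_poch_def)

text \<open>At z = 1 the two factors of the product coincide, so that the new factor 1 + q^(4n+2) +
  2 q^(2n+1) is a square. Shifting the index costs nothing because the coefficients vanish outside
  the range.\<close>

lemma sum_theta_coeff:
  assumes q: "0 < q" "q < 1"
  shows "(\<Sum>j\<in>{- int n..int n}. theta_coeff q n j) = (\<Prod>k<n. 1 + q ^ (2 * k + 1))\<^sup>2"
proof (induction n)
  case 0
  then show ?case by (simp add: theta_coeff_def inv_poch_def q_poch_def)
next
  case (Suc n)
  let ?I = "{- int n..int n}" and ?J = "{- int (Suc n)..int (Suc n)}"
  have shift: "(\<Sum>j\<in>?J. theta_coeff q n (j + s)) = (\<Sum>j\<in>?I. theta_coeff q n j)" if "\<bar>s\<bar> \<le> 1" for s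
  proof -
    have "(\<Sum>j\<in>?J. theta_coeff q n (j + s)) = (\<Sum>j\<in>(\<lambda>j. j + s) ` ?J. theta_coeff q n j)"
      by (subst sum.reindex) (auto simp: inj_on_def)
    also have "\<dots> = (\<Sum>j\<in>?I. theta_coeff q n j)"
    proof (rule sum.mono_neutral_right)
      show "?I \<subseteq> (\<lambda>j. j + s) ` ?J"
      proof
        fix i assume "i \<in> ?I"
        then show "i \<in> (\<lambda>j. j + s) ` ?J" using that by (intro image_eqI[of _ _ "i - s"]) auto
      qed
      show "\<forall>i\<in>(\<lambda>j. j + s) ` ?J - ?I. theta_coeff q n i = 0"
        by (auto intro!: theta_coeff_eq_0)
    qed auto
    finally show ?thesis .
  qed
  have "(\<Sum>j\<in>?J. theta_coeff q (Suc n) j) =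
      (1 + q ^ (4 * n + 2)) * (\<Sum>j\<in>?J. theta_coeff q n (j + 0)) +
      q ^ (2 * n + 1) * ((\<Sum>j\<in>?J. theta_coeff q n (j + (-1))) + (\<Sum>j\<in>?J. theta_coeff q n (j + 1)))"
    unfolding theta_coeff_rec[OF q] by (simp add: sum.distrib sum_distrib_left distrib_left)
  also have "\<dots> = (1 + q ^ (4 * n + 2) + 2 * q ^ (2 * n + 1)) * (\<Sum>j\<in>?I. theta_coeff q n j)"
    unfolding shift[of 0, simplified] using shift[of "-1"] shift[of 1] shift[of 0] by (simp add: algebra_simps)
  also have "1 + q ^ (4 * n + 2) + 2 * q ^ (2 * n + 1) = (1 + q ^ (2 * n + 1))\<^sup>2"
    by (simp add: power2_eq_square algebra_simps flip: power_add mult_2)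
  finally show ?case using Suc.IH by (simp add: power_mult_distrib)
qed

lemma sum_int_pairs:
  fixes f :: "int \<Rightarrow> real"
  shows "(\<Sum>k<Suc n. f (int k) + f (- 1 - int k)) = (\<Sum>j\<in>{- 1 - int n..int n}. f j)"
proof (induction n)
  case 0
  have "{-1..0::int} = {-1, 0}" by auto
  then show ?case by simp
next
  case (Suc n)
  have "{- 1 - int (Suc n)..int (Suc n)} = insert (int (Suc n)) (insert (- 1 - int (Suc n)) {- 1 - int n..int n})"
    by auto
  then show ?case using Suc.IH by simp
qed

text \<open>As n grows in \<open>sum_theta_coeff\<close>, the coefficients tend to q^(j^2) / P and
  the right-hand side to (E / P)^2; Tannery's theorem permits the exchange of limits. Thus \<phi> is
  P (E / P)^2, that is E^2 / P.\<close>

theorem theta_product: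
  assumes q: "0 < q" "q < 1"
  shows "ramanujan_phi q = exp (log_euler (q\<^sup>2) - 2 * log_euler (- q))"
proof -
  define P where "P = exp (- log_euler (q\<^sup>2))"
  define E where "E = exp (- log_euler (- q))"
  have P0: "P > 0" by (simp add: P_def)
  have q2: "\<bar>q\<^sup>2\<bar> < 1" using q by (simp add: power_less_one_iff)
  have Plim: "q_poch q \<longlonglongrightarrow> P"
    using log_euler_prod[OF q2] unfolding P_def q_poch_def power_mult .
  have dec: "decseq (q_poch q)"
  proof (rule decseq_SucI)
    fix n
    have "q_poch q n * (1 - q ^ (2 * Suc n)) \<le> q_poch q n * 1"
      using q_poch_pos[OF q, of n] q by (intro mult_left_mono) (auto simp del: mult_Suc_right)
    then show "q_poch q (Suc n) \<le> q_poch q n" by (simp add: q_poch_def)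
  qed
  have Ple: "q_poch q n \<ge> P" for n by (rule decseq_ge[OF dec Plim])
  have P1: "q_poch q n \<le> 1" for n using decseqD[OF dec, of 0 n] by (simp add: q_poch_def)
  define D where "D = (\<lambda>n. \<Prod>k<n. 1 + q ^ (2 * k + 1))"
  \<comment> \<open>The even powers of - q make up \<open>q_poch\<close>, and the odd ones give the
    factors 1 + q^(2k+1) of \<open>D\<close>. So the odd product enters only through the Euler
    product at - q.\<close>
  have fact: "(\<Prod>k<2 * n. 1 - (- q) ^ Suc k) = q_poch q n * D n" for n
  proof (induction n)
    case (Suc n)
    then show ?case by (simp add: q_poch_def D_def mult_ac)
  qed (simp add: q_poch_def D_def)
  have "(\<lambda>n. \<Prod>k<2 * n. 1 - (- q) ^ Suc k) \<longlonglongrightarrow> E"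
    using LIMSEQ_subseq_LIMSEQ[OF log_euler_prod[of "- q"], of "\<lambda>n. 2 * n"] q
    by (simp add: E_def o_def strict_mono_def del: power_Suc)
  then have "(\<lambda>n. q_poch q n * D n / q_poch q n) \<longlonglongrightarrow> E / P"
    unfolding fact using P0 by (intro tendsto_divide Plim) auto
  moreover have "q_poch q n * D n / q_poch q n = D n" for n using q_poch_pos[OF q, of n] by simp
  ultimately have Dlim: "D \<longlonglongrightarrow> E / P" by simp
  have inv_le: "0 \<le> inv_poch q m" "inv_poch q m \<le> 1 / P" for m
    using q_poch_pos[OF q, of "nat m"] P0 Ple[of "nat m"]
    by (auto simp: inv_poch_def intro!: divide_left_mono)
  have inv_lim: "(\<lambda>n. inv_poch q (int n + j)) \<longlonglongrightarrow> 1 / P" for j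
  proof -
    have "filterlim (\<lambda>n. nat (int n + j)) at_top sequentially"
      unfolding filterlim_at_top
    proof
      fix Z show "\<forall>\<^sub>F n in sequentially. Z \<le> nat (int n + j)"
        by (rule eventually_sequentiallyI[of "Z + nat \<bar>j\<bar>"]) linarith
    qed
    then have "(\<lambda>n. 1 / q_poch q (nat (int n + j))) \<longlonglongrightarrow> 1 / P"
      using P0 by (intro tendsto_divide tendsto_const filterlim_compose[OF Plim]) auto
    moreover have "\<forall>\<^sub>F n in sequentially. 1 / q_poch q (nat (int n + j)) = inv_poch q (int n + j)"
      by (rule eventually_sequentiallyI[of "nat \<bar>j\<bar>"]) (auto simp: inv_poch_def)
    ultimately show ?thesis by (rule Lim_transform_eventually)
  qed
  have tlim: "(\<lambda>n. theta_coeff q n j) \<longlonglongrightarrow> q powi (j\<^sup>2) / P" for j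
  proof -
    have "(\<lambda>n. q_poch q (2 * n)) \<longlonglongrightarrow> P"
      using LIMSEQ_subseq_LIMSEQ[OF Plim, of "\<lambda>n. 2 * n"] by (simp add: o_def strict_mono_def)
    then have "(\<lambda>n. q powi (j\<^sup>2) * q_poch q (2 * n) * inv_poch q (int n + (- j)) * inv_poch q (int n + j))
        \<longlonglongrightarrow> q powi (j\<^sup>2) * P * (1 / P) * (1 / P)"
      by (intro tendsto_mult tendsto_const inv_lim)
    then show ?thesis using P0 by (simp add: theta_coeff_def)
  qed
  have tbound: "norm (theta_coeff q n j) \<le> q powi (j\<^sup>2) / P\<^sup>2" for n j
  proof -
    have "norm (theta_coeff q n j) = q powi (j\<^sup>2) * q_poch q (2 * n) * inv_poch q (int n - j) * inv_poch q (int n + j)"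
      using q q_poch_pos[OF q, of "2 * n"] inv_le(1) by (simp add: theta_coeff_def abs_mult)
    also have "\<dots> \<le> q powi (j\<^sup>2) * 1 * (1 / P) * (1 / P)"
      using q P0 q_poch_pos[OF q, of "2 * n"] inv_le P1 by (intro mult_mono mult_nonneg_nonneg) (auto intro: less_imp_le)
    finally show ?thesis by (simp add: power2_eq_square)
  qed
  have powi: "q powi ((int k)\<^sup>2) = q ^ k\<^sup>2" "q powi ((- 1 - int k)\<^sup>2) = q ^ (Suc k)\<^sup>2" for k
  proof -
    have "(- 1 - int k)\<^sup>2 = int ((Suc k)\<^sup>2)" by (simp add: power2_eq_square algebra_simps)
    then show "q powi ((- 1 - int k)\<^sup>2) = q ^ (Suc k)\<^sup>2" by (simp only: power_int_of_nat)
  qed (simp flip: of_nat_power)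
  have qk: "q ^ k\<^sup>2 \<le> q ^ k" "q ^ (Suc k)\<^sup>2 \<le> q ^ k" for k
  proof -
    show "q ^ k\<^sup>2 \<le> q ^ k" using q by (intro power_decreasing) (auto simp: power2_eq_square)
    have "k \<le> (Suc k)\<^sup>2" by (simp add: power2_eq_square)
    then show "q ^ (Suc k)\<^sup>2 \<le> q ^ k" using q by (intro power_decreasing) auto
  qed
  have sq: "summable (\<lambda>k. q ^ k)" using q by (intro summable_geometric) auto
  define b where "b = (\<lambda>k. q powi ((int k)\<^sup>2) / P + q powi ((- 1 - int k)\<^sup>2) / P)"
  have tan: "(\<lambda>n. \<Sum>k. theta_coeff q n (int k) + theta_coeff q n (- 1 - int k)) \<longlonglongrightarrow> suminf b"
  proof (rule tannerys_theorem[THEN conjunct2, THEN conjunct2])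
    show "(\<lambda>n. theta_coeff q n (int k) + theta_coeff q n (- 1 - int k)) \<longlonglongrightarrow> b k" for k
      unfolding b_def by (intro tendsto_add tlim)
    show "summable (\<lambda>k. q ^ k * (2 / P\<^sup>2))" by (intro summable_mult2 sq)
    have "norm (theta_coeff q n (int k) + theta_coeff q n (- 1 - int k)) \<le> q ^ k * (2 / P\<^sup>2)" for n k
    proof -
      have "norm (theta_coeff q n (int k) + theta_coeff q n (- 1 - int k)) \<le> q ^ k\<^sup>2 / P\<^sup>2 + q ^ (Suc k)\<^sup>2 / P\<^sup>2"
        using norm_triangle_mono[OF tbound[of n "int k"] tbound[of n "- 1 - int k"]] unfolding powi .
      also have "\<dots> \<le> q ^ k / P\<^sup>2 + q ^ k / P\<^sup>2"
        by (intro add_mono divide_right_mono qk) auto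
      finally show ?thesis by (simp add: mult.commute)
    qed
    then show "\<forall>\<^sub>F (k, n) in at_top \<times>\<^sub>F sequentially.
        norm (theta_coeff q n (int k) + theta_coeff q n (- 1 - int k)) \<le> q ^ k * (2 / P\<^sup>2)"
      by (intro always_eventually) auto
  qed auto
  have fin: "(\<Sum>k. theta_coeff q n (int k) + theta_coeff q n (- 1 - int k)) = (D n)\<^sup>2" for n
  proof -
    have "(\<Sum>k. theta_coeff q n (int k) + theta_coeff q n (- 1 - int k)) =
        (\<Sum>k<Suc n. theta_coeff q n (int k) + theta_coeff q n (- 1 - int k))"
      by (rule suminf_finite) (auto simp: theta_coeff_eq_0)
    also have "\<dots> = (\<Sum>j\<in>{- 1 - int n..int n}. theta_coeff q n j)" by (rule sum_int_pairs)
    also have "\<dots> = (\<Sum>j\<in>{- int n..int n}. theta_coeff q n j)"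
      by (rule sum.mono_neutral_right) (auto intro!: theta_coeff_eq_0)
    also have "\<dots> = (D n)\<^sup>2" unfolding D_def by (rule sum_theta_coeff[OF q])
    finally show ?thesis .
  qed
  have "(\<lambda>n. (D n)\<^sup>2) \<longlonglongrightarrow> (E / P)\<^sup>2" by (intro tendsto_power Dlim)
  then have sb: "suminf b = (E / P)\<^sup>2" using tan unfolding fin by (rule LIMSEQ_unique[symmetric])
  have s1: "summable (\<lambda>k. norm (q powi ((int k)\<^sup>2)))" "summable (\<lambda>k. norm (q powi ((- 1 - int k)\<^sup>2)))"
    unfolding powi by (rule summable_comparison_test'[OF sq, where N = 0]; use q qk in auto)+
  have "summable b"
    unfolding b_def by (rule summable_add[OF summable_divide[OF summable_norm_cancel[OF s1(1)]]
          summable_divide[OF summable_norm_cancel[OF s1(2)]]])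
  then have "b sums (E / P)\<^sup>2" using sb by (simp add: sums_iff)
  then have "(\<lambda>k. P * b k) sums (P * (E / P)\<^sup>2)" by (rule sums_mult)
  moreover have "P * b k = q powi ((int k)\<^sup>2) + q powi ((- 1 - int k)\<^sup>2)" for k
    using P0 by (simp add: b_def field_simps)
  ultimately have "((\<lambda>j. q powi (j\<^sup>2)) has_sum (P * (E / P)\<^sup>2)) UNIV"
    using s1 by (intro has_sum_int_pairs) simp_all
  then have "ramanujan_phi q = P * (E / P)\<^sup>2" unfolding ramanujan_phi_def by (rule infsumI)
  also have "\<dots> = E\<^sup>2 / P" using P0 by (simp add: power2_eq_square)
  also have "\<dots> = exp (log_euler (q\<^sup>2) - 2 * log_euler (- q))"
    by (simp add: E_def P_def exp_diff exp_minus field_simps power2_eq_square flip: exp_add)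
  finally show ?thesis .
qed

section \<open>Lattice sums\<close>

text \<open>Because of \<open>2 / 0 = 0\<close> the weight vanishes at \<open>0\<close>, so the origin may be kept in lattice sums.\<close>

definition weight :: "real \<Rightarrow> real \<Rightarrow> real" where
  "weight z q = 2 / q - 2 * q / (q\<^sup>2 + z\<^sup>2)"

lemma weight_nonneg: "q \<ge> 0 \<Longrightarrow> weight z q \<ge> 0"
proof (cases "q = 0")
  case False
  assume "q \<ge> 0"
  then have q: "q > 0" using False by simp
  have "2 * q / (q\<^sup>2 + z\<^sup>2) \<le> 2 * q / (q\<^sup>2)"
    using q by (intro divide_left_mono mult_pos_pos add_pos_nonneg) auto
  also have "\<dots> = 2 / q" using q by (simp add: power2_eq_square)
  finally show ?thesis by (simp add: weight_def)
qed (simp add: weight_def)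

lemma weight_le: "q \<ge> 0 \<Longrightarrow> weight z q \<le> 2 / q"
  by (simp add: weight_def)

text \<open>The denominators containing \<open>of_real 0\<close> are kept so that both halves have
  the shape of \<open>cot_sum_partial_fractions\<close>, once at 0 and once at
  \<open>w\<close>.\<close>

lemma weight_partial_fractions:
  assumes "q > 0"
  shows "complex_of_real (weight w q) = (1 / (of_real q + \<i> * of_real 0) + 1 / (of_real q - \<i> * of_real 0)) -
           (1 / (of_real q + \<i> * of_real w) + 1 / (of_real q - \<i> * of_real w))"
proof -
  have nz: "of_real q + \<i> * complex_of_real w \<noteq> 0" "of_real q - \<i> * complex_of_real w \<noteq> 0"
    using assms by (auto simp: complex_eq_iff)
  have "(of_real q + \<i> * of_real w) * (of_real q - \<i> * of_real w) = complex_of_real (q\<^sup>2 + w\<^sup>2)"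
    by (simp add: power2_eq_square algebra_simps)
  then have "1 / (of_real q + \<i> * of_real w) + 1 / (of_real q - \<i> * of_real w) = 2 * of_real q / complex_of_real (q\<^sup>2 + w\<^sup>2)"
    using nz by (simp add: add_frac_eq)
  then show ?thesis by (simp add: weight_def)
qed

lemma weight_le_inverse_square:
  "weight w (real d) \<le> 2 * w\<^sup>2 * inverse (real d ^ 2)"
proof (cases "d = 0")
  case False
  then have d: "real d \<ge> 1" by simp
  have p: "(real d)\<^sup>2 + w\<^sup>2 > 0" using d by (intro add_pos_nonneg) auto
  have "weight w (real d) = 2 * w\<^sup>2 / (real d * ((real d)\<^sup>2 + w\<^sup>2))"
    using d p by (simp add: weight_def field_simps power2_eq_square)
  also have "\<dots> \<le> 2 * w\<^sup>2 / (1 * (real d)\<^sup>2)"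
    using d p by (intro divide_left_mono mult_mono mult_pos_pos) auto
  finally show ?thesis by (simp add: field_simps)
qed (simp add: weight_def)

text \<open>The weight becomes the real part of a difference of two reciprocals whose denominators
  differ by an imaginary constant. For \<open>p\<close> a square plus a constant, both reciprocals
  are of the kind summed in \<open>line_sum\<close>.\<close>

lemma weight_complex:
  assumes a: "a > 0"
  shows "weight z (a * p) = 2 / a * Re (1 / of_real p - 1 / (of_real p + \<i> * of_real (z / a)))"
proof -
  have "Re (1 / (of_real p + \<i> * complex_of_real (z / a))) = p / (p\<^sup>2 + (z / a)\<^sup>2)"
    by (simp add: Re_divide)
  moreover have "p / (p\<^sup>2 + (z / a)\<^sup>2) = a\<^sup>2 * p / ((a * p)\<^sup>2 + z\<^sup>2)"
  proof -
    have "(a * p)\<^sup>2 + z\<^sup>2 = a\<^sup>2 * (p\<^sup>2 + (z / a)\<^sup>2)"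
      using a by (simp add: power2_eq_square field_simps)
    then show ?thesis using a by simp
  qed
  ultimately have "2 / a * Re (1 / of_real p - 1 / (of_real p + \<i> * of_real (z / a))) =
      2 / a * (1 / p - a\<^sup>2 * p / ((a * p)\<^sup>2 + z\<^sup>2))" by simp
  also have "\<dots> = weight z (a * p)"
    using a by (simp add: weight_def power2_eq_square field_simps)
  finally show ?thesis ..
qed

lemma has_sum_int_even:
  fixes g :: "nat \<Rightarrow> real"
  assumes g: "g sums S" "\<And>k. g k \<ge> 0"
  shows "((\<lambda>m :: int. g (nat \<bar>m\<bar>)) has_sum (2 * S - g 0)) UNIV"
proof (rule has_sum_int_pairs)
  have sg: "summable g" using g by (simp add: sums_iff)
  then show "summable (\<lambda>k. norm (g (nat \<bar>int k\<bar>)))" using g(2) by simp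
  have nat: "nat \<bar>- 1 - int k\<bar> = Suc k" for k by simp
  show "summable (\<lambda>k. norm (g (nat \<bar>- 1 - int k\<bar>)))"
    unfolding nat using sg g(2) by (simp add: summable_Suc_iff)
  have "(\<lambda>k. g (Suc k)) sums (S - g 0)" using g(1) by (subst sums_Suc_iff) simp
  from sums_add[OF g(1) this]
  show "(\<lambda>k. g (nat \<bar>int k\<bar>) + g (nat \<bar>- 1 - int k\<bar>)) sums (2 * S - g 0)"
    unfolding nat by simp
qed

text \<open>The half-row on the axis: as the cut-off recedes, the terms rise to 2 / (a k^2), which
  also dominate them. Counted in both directions the limit becomes the term
  \<open>pi * Y / 6\<close> of \<open>lattice_sum\<close>.\<close>

lemma weight_axis_limit:
  assumes a: "a > 0"
  shows "summable (\<lambda>k. weight z (a * (real (Suc k))\<^sup>2))"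
    and "((\<lambda>z. \<Sum>k. weight z (a * (real (Suc k))\<^sup>2)) \<longlongrightarrow> pi\<^sup>2 / (3 * a)) at_top"
proof -
  have s: "(\<lambda>k. 2 / (a * (real (Suc k))\<^sup>2)) sums (2 / a * (pi\<^sup>2 / 6))"
    using sums_mult[OF inverse_squares_sums, of "2 / a"] by (simp add: add.commute)
  have b: "norm (weight z (a * (real (Suc k))\<^sup>2)) \<le> 2 / (a * (real (Suc k))\<^sup>2)" for z k
    using weight_nonneg[of "a * (real (Suc k))\<^sup>2" z] weight_le[of "a * (real (Suc k))\<^sup>2" z] a by simp
  show "summable (\<lambda>k. weight z (a * (real (Suc k))\<^sup>2))"
    by (rule summable_comparison_test'[OF sums_summable[OF s], where N = 0]) (rule b)
  have "((\<lambda>z. \<Sum>k. weight z (a * (real (Suc k))\<^sup>2)) \<longlongrightarrow> (\<Sum>k. 2 / (a * (real (Suc k))\<^sup>2))) at_top"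
  proof (rule tannerys_theorem[THEN conjunct2, THEN conjunct2])
    show "((\<lambda>z. weight z (a * (real (Suc k))\<^sup>2)) \<longlongrightarrow> 2 / (a * (real (Suc k))\<^sup>2)) at_top" for k
    proof -
      define q where "q = a * (real (Suc k))\<^sup>2"
      have "((\<lambda>z. 2 / q - 2 * q / (q\<^sup>2 + z\<^sup>2)) \<longlongrightarrow> 2 / q) at_top" by real_asymp
      then show ?thesis by (simp add: weight_def q_def)
    qed
    show "summable (\<lambda>k. 2 / (a * (real (Suc k))\<^sup>2))" by (rule sums_summable[OF s])
    show "\<forall>\<^sub>F (k, z) in at_top \<times>\<^sub>F at_top. norm (weight z (a * (real (Suc k))\<^sup>2)) \<le> 2 / (a * (real (Suc k))\<^sup>2)"
      using b by (intro always_eventually) auto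
  qed auto
  then show "((\<lambda>z. \<Sum>k. weight z (a * (real (Suc k))\<^sup>2)) \<longlongrightarrow> pi\<^sup>2 / (3 * a)) at_top"
    using sums_unique[OF s] by simp
qed

text \<open>\<open>line_sum\<close> is used with b = Y k for the uncut part and with b = Y c for the
  cut-off. Writing the cut-off as \<open>a * Y\<^sup>2 * Z\<^sup>2\<close> makes (Y c)^2 the squared
  height plus the imaginary shift of \<open>weight_complex\<close>; \<open>e\<close> is the phase
  due to the horizontal displacement \<open>h * m\<close>.\<close>

lemma has_sum_weight_line:
  fixes a Y h Z :: real and m :: int
  assumes a: "a > 0" and Y: "Y > 0" and h: "h = 0 \<or> h = 1 / 2" and Z: "Z > 0" and m: "m \<noteq> 0"
  defines "k \<equiv> nat \<bar>m\<bar>"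
  defines "e \<equiv> (if h = 0 then 1 else -1 :: real) ^ k"
  defines "c \<equiv> csqrt (of_real ((real k)\<^sup>2) + \<i> * of_real (Z\<^sup>2))"
  defines "U \<equiv> e * exp (- 2 * pi * Y) ^ k"
  defines "V \<equiv> of_real e * exp (- 2 * of_real pi * (of_real Y * c))"
  shows "((\<lambda>n :: int. weight (a * Y\<^sup>2 * Z\<^sup>2) (a * ((of_int n + h * of_int m)\<^sup>2 + (Y * of_int m)\<^sup>2))) has_sum
      (2 * pi / (a * Y) * ((1 + U) / (real k * (1 - U)) - Re ((1 + V) / (c * (1 - V)))))) UNIV"
proof -
  define x where "x = h * of_int m"
  have k0: "k > 0" using m by (simp add: k_def)
  have rk: "(real k)\<^sup>2 = (of_int m)\<^sup>2" by (simp add: k_def)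
  have e1: "e = 1 \<or> e = -1"
    unfolding e_def by (cases "even k") auto
  have ex: "exp (2 * of_real pi * \<i> * complex_of_real x) = of_real e"
  proof (cases "h = 0")
    case False
    then have hx: "x = of_int m / 2" using h by (simp add: x_def)
    have "2 * of_real pi * \<i> * complex_of_real x = of_int m * (of_real pi * \<i>)"
      by (simp only: hx) simp
    also have "exp (of_int m * (of_real pi * \<i>)) = (exp (of_real pi * \<i>) :: complex) powi m"
      by (rule exp_power_int[symmetric])
    also have "exp (of_real pi * \<i>) = (-1 :: complex)" by (rule exp_pi_i)
    also have "(-1 :: complex) powi m = (-1) ^ k"
      by (auto simp: power_int_def k_def)
    finally show ?thesis using False by (simp add: e_def)
  qed (simp add: x_def e_def)
  note B = csqrt_line_bounds[of "real k" Z, folded c_def, OF _ Z]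
  have c0: "c \<noteq> 0" using B(3) by auto
  have c2: "c\<^sup>2 = of_real ((real k)\<^sup>2) + \<i> * of_real (Z\<^sup>2)" by (simp add: c_def)
  have l1: "((\<lambda>n :: int. 1 / ((of_int n + of_real x)\<^sup>2 + (of_real (Y * real k))\<^sup>2)) has_sum
      (of_real pi / of_real (Y * real k) * ((1 + of_real U) / (1 - of_real U)) :: complex)) UNIV"
  proof -
    have "of_real e * exp (- 2 * of_real pi * complex_of_real (Y * real k)) = of_real U"
    proof -
      have "exp (- 2 * pi * Y) ^ k = exp (- 2 * pi * (Y * real k))"
        by (simp add: exp_of_nat_mult[symmetric] mult_ac)
      then show ?thesis by (simp add: U_def flip: exp_of_real)
    qed
    then show ?thesis
      using line_sum[of "of_real (Y * real k)" x e, OF _ ex e1] Y k0 by simp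
  qed
  have l2: "((\<lambda>n :: int. 1 / ((of_int n + of_real x)\<^sup>2 + (of_real Y * c)\<^sup>2)) has_sum
      (of_real pi / (of_real Y * c) * ((1 + V) / (1 - V)))) UNIV"
    unfolding V_def using Y B(3) by (intro line_sum[OF _ ex e1]) simp
  have "((\<lambda>n :: int. 2 / a * Re (1 / ((of_int n + of_real x)\<^sup>2 + (of_real (Y * real k))\<^sup>2) -
        1 / ((of_int n + of_real x)\<^sup>2 + (of_real Y * c)\<^sup>2))) has_sum
      (2 / a * Re (of_real pi / of_real (Y * real k) * ((1 + of_real U) / (1 - of_real U)) -
         of_real pi / (of_real Y * c) * ((1 + V) / (1 - V))))) UNIV"
    using has_sum_cmult_right[OF has_sum_Re[OF has_sum_add[OF l1 has_sum_uminusI[OF l2]]], of "2 / a"]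
    by (simp only: add_uminus_conv_diff)
  moreover have "2 / a * Re (1 / ((of_int n + of_real x)\<^sup>2 + (of_real (Y * real k))\<^sup>2) -
        1 / ((of_int n + of_real x)\<^sup>2 + (of_real Y * c)\<^sup>2)) =
      weight (a * Y\<^sup>2 * Z\<^sup>2) (a * ((of_int n + h * of_int m)\<^sup>2 + (Y * of_int m)\<^sup>2))" for n :: int
  proof -
    have n1: "(of_int n + complex_of_real x)\<^sup>2 = of_real ((of_int n + h * of_int m)\<^sup>2)"
      by (simp add: x_def)
    have "(Y * real k)\<^sup>2 = (Y * of_int m)\<^sup>2" by (simp only: power_mult_distrib rk)
    then have "(complex_of_real (Y * real k))\<^sup>2 = of_real ((Y * of_int m)\<^sup>2)"
      by (metis of_real_power)
    then have "(of_int n + complex_of_real x)\<^sup>2 + (of_real (Y * real k))\<^sup>2 =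
        of_real ((of_int n + h * of_int m)\<^sup>2 + (Y * of_int m)\<^sup>2)"
      unfolding n1 by simp
    moreover have "(of_real Y * c)\<^sup>2 = of_real ((Y * of_int m)\<^sup>2) + \<i> * of_real (a * Y\<^sup>2 * Z\<^sup>2 / a)"
      unfolding power_mult_distrib c2 rk using a by (simp add: algebra_simps)
    then have "(of_int n + of_real x)\<^sup>2 + (of_real Y * c)\<^sup>2 =
        of_real ((of_int n + h * of_int m)\<^sup>2 + (Y * of_int m)\<^sup>2) + \<i> * of_real (a * Y\<^sup>2 * Z\<^sup>2 / a)"
      unfolding n1 by simp
    ultimately show ?thesis unfolding weight_complex[OF a] by simp
  qed
  moreover have "2 / a * Re (of_real pi / of_real (Y * real k) * ((1 + of_real U) / (1 - of_real U)) -
         of_real pi / (of_real Y * c) * ((1 + V) / (1 - V))) =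
      2 * pi / (a * Y) * ((1 + U) / (real k * (1 - U)) - Re ((1 + V) / (c * (1 - V))))"
  proof -
    have "complex_of_real pi / of_real (Y * real k) * ((1 + of_real U) / (1 - of_real U)) =
        of_real (pi / Y * ((1 + U) / (real k * (1 - U))))"
      by simp
    moreover have "of_real pi / (of_real Y * c) * ((1 + V) / (1 - V)) =
        of_real (pi / Y) * ((1 + V) / (c * (1 - V)))"
      by simp
    moreover have "Re (of_real A - of_real B * w) = A - B * Re w" for A B w by simp
    ultimately have "Re (of_real pi / of_real (Y * real k) * ((1 + of_real U) / (1 - of_real U)) -
         of_real pi / (of_real Y * c) * ((1 + V) / (1 - V))) =
        pi / Y * ((1 + U) / (real k * (1 - U))) - pi / Y * Re ((1 + V) / (c * (1 - V)))"
      by (simp only:)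
    then show ?thesis
      by (simp only: right_diff_distrib) simp
  qed
  ultimately show ?thesis by simp
qed

text \<open>A form of Kronecker's limit formula: \<open>pi * Y / 6 + 2 * log_euler Q\<close> is
  minus twice the logarithm of the absolute value of the eta function at h + i Y. The term
  \<open>ln (a * Y\<^sup>2) / 2\<close> comes from converting the row parameter Z into z = a Y^2
  Z^2.\<close>

theorem lattice_sum:
  fixes a Y h :: real
  assumes a: "a > 0" and Y: "Y > 0" and h: "h = 0 \<or> h = 1 / 2"
  defines "Q \<equiv> (if h = 0 then 1 else -1) * exp (- 2 * pi * Y)"
  obtains T :: "real \<Rightarrow> real" where
    "\<And>z. z > 0 \<Longrightarrow> ((\<lambda>(m :: int, n :: int). weight z (a * ((of_int n + h * of_int m)\<^sup>2 + (Y * of_int m)\<^sup>2)))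
        has_sum T z) (UNIV \<times> UNIV)"
    "((\<lambda>z. T z - 2 * pi / (a * Y) * ln z) \<longlongrightarrow>
        4 * pi / (a * Y) * (pi * Y / 6 + 2 * log_euler Q + euler_mascheroni - ln 2 - ln (a * Y\<^sup>2) / 2)) at_top"
proof -
  define r where "r = exp (- 2 * pi * Y)"
  define eps where "eps = (if h = 0 then 1 else -1 :: real)"
  have r: "0 < r" "r < 1" using Y by (auto simp: r_def)
  have Qr: "Q = eps * r" "\<bar>Q\<bar> = r" using r by (auto simp: Q_def r_def eps_def)
  have Q1: "\<bar>Q\<bar> < 1" using r Qr by simp
  define c where "c = (\<lambda>Z (k :: nat). csqrt (of_real ((real k)\<^sup>2) + \<i> * of_real (Z\<^sup>2)))"
  define V where "V = (\<lambda>Z k. of_real (eps ^ k) * exp (- 2 * of_real pi * (of_real Y * c Z k)))"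
  define R where "R = (\<lambda>Z k. (1 + Q ^ k) / (real k * (1 - Q ^ k)) - Re ((1 + V Z k) / (c Z k * (1 - V Z k))))"
  \<comment> \<open>A row is a multiple of 2 \<open>s1\<close> + \<open>s2\<close> -
    \<open>s3\<close>. The exponential part of the first cotangent yields \<open>log_euler\<close>,
    the two main parts together yield the logarithm, and the exponential part of the second is O(1 /
    Z) in total because |c| is at least Z / 2.\<close>
  define s1 where "s1 = (\<lambda>k. Q ^ Suc k / (real (Suc k) * (1 - Q ^ Suc k)))"
  define s2 where "s2 = (\<lambda>Z k. 1 / real (Suc k) - Re (1 / c Z (Suc k)))"
  define s3 where "s3 = (\<lambda>Z k. Re (2 * V Z (Suc k) / (c Z (Suc k) * (1 - V Z (Suc k)))))"
  have Bc: "Re (c Z k) > 0" "Re (c Z k) \<ge> real k" "norm (c Z k) \<ge> Z / 2" if "Z > 0" for Z k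
  proof -
    show "Re (c Z k) > 0" "Re (c Z k) \<ge> real k"
      using csqrt_line_bounds(3,4)[of "real k" Z] that unfolding c_def by auto
    have "sqrt (Z\<^sup>2) \<le> sqrt ((real k)\<^sup>2 + Z\<^sup>2)" by (rule real_sqrt_le_mono) simp
    then have "Z / 2 \<le> sqrt ((real k)\<^sup>2 + Z\<^sup>2) / 2" using that by simp
    also have "\<dots> \<le> norm (c Z k)" unfolding c_def by (rule csqrt_line_bounds(2)) (use that in auto)
    finally show "norm (c Z k) \<ge> Z / 2" .
  qed
  have nV: "norm (V Z k) \<le> r ^ k" if "Z > 0" for Z k
  proof -
    have "norm (V Z k) = exp (- 2 * pi * (Y * Re (c Z k)))"
      by (simp add: V_def norm_mult eps_def norm_power)
    also have "\<dots> \<le> exp (- 2 * pi * (Y * real k))"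
      using Bc(2)[OF that, of k] Y by simp
    also have "\<dots> = r ^ k" by (simp add: r_def exp_of_nat_mult[symmetric] mult_ac)
    finally show ?thesis .
  qed
  have rk: "r ^ Suc k \<le> r" for k using r power_decreasing[of 1 "Suc k" r] by simp
  have s3_le: "norm (s3 Z k) \<le> r ^ k * (4 / (1 - r)) * (1 / Z)" if Z: "Z > 0" for Z k
  proof -
    have nv: "norm (V Z (Suc k)) \<le> r ^ Suc k" by (rule nV[OF Z])
    have "1 - r \<le> 1 - norm (V Z (Suc k))" using nv rk[of k] by linarith
    also have "\<dots> \<le> norm (1 - V Z (Suc k))"
      using norm_triangle_ineq2[of 1 "V Z (Suc k)"] by simp
    finally have d: "1 - r \<le> norm (1 - V Z (Suc k))" .
    have "norm (s3 Z k) \<le> norm (2 * V Z (Suc k) / (c Z (Suc k) * (1 - V Z (Suc k))))"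
      unfolding s3_def real_norm_def by (rule abs_Re_le_cmod)
    also have "\<dots> = 2 * norm (V Z (Suc k)) / (norm (c Z (Suc k)) * norm (1 - V Z (Suc k)))"
      by (simp add: norm_divide norm_mult)
    also have "\<dots> \<le> 2 * r ^ k / (Z / 2 * (1 - r))"
    proof (rule frac_le)
      have "r ^ Suc k \<le> r ^ k" using r by (intro power_decreasing) auto
      then show "2 * norm (V Z (Suc k)) \<le> 2 * r ^ k" using nv by linarith
      show "0 < Z / 2 * (1 - r)" using Z r by simp
      show "Z / 2 * (1 - r) \<le> norm (c Z (Suc k)) * norm (1 - V Z (Suc k))"
        using Bc(3)[OF Z, of "Suc k"] d Z r by (intro mult_mono) auto
    qed (use r in auto)
    also have "\<dots> = r ^ k * (4 / (1 - r)) * (1 / Z)" using Z r by (simp add: field_simps)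
    finally show ?thesis .
  qed
  have geo: "summable (\<lambda>k. r ^ k * (4 / (1 - r)))"
    using r by (intro summable_mult2 summable_geometric) auto
  define C where "C = (\<Sum>k. r ^ k * (4 / (1 - r)))"
  have s3: "summable (s3 Z)" "\<bar>suminf (s3 Z)\<bar> \<le> C / Z" if Z: "Z > 0" for Z
  proof -
    have sg: "summable (\<lambda>k. r ^ k * (4 / (1 - r)) * (1 / Z))" by (rule summable_mult2[OF geo])
    have sn: "summable (\<lambda>k. norm (s3 Z k))"
      by (rule summable_comparison_test'[OF sg, where N = 0]) (use s3_le[OF Z] in simp)
    then show "summable (s3 Z)" by (rule summable_norm_cancel)
    have "norm (suminf (s3 Z)) \<le> (\<Sum>k. norm (s3 Z k))" by (rule summable_norm[OF sn])
    also have "\<dots> \<le> (\<Sum>k. r ^ k * (4 / (1 - r)) * (1 / Z))"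
      by (rule suminf_le[OF s3_le[OF Z] sn sg])
    also have "\<dots> = C / Z" unfolding C_def using suminf_mult2[OF geo, of "1 / Z"] by simp
    finally show "\<bar>suminf (s3 Z)\<bar> \<le> C / Z" by simp
  qed
  have s1: "summable s1" "suminf s1 = log_euler Q"
    unfolding s1_def log_euler_def by (rule summable_norm_cancel[OF summable_log_euler[OF Q1]]) (rule refl)
  have s2: "summable (s2 Z)" "\<bar>suminf (s2 Z) - (euler_mascheroni - ln 2 + ln Z)\<bar> \<le> 8 / Z" if "Z > 0" for Z
    using sum_inverse_csqrt[OF that] unfolding s2_def c_def by auto
  have R_eq: "R Z (Suc k) = 2 * s1 k + s2 Z k - s3 Z k" if Z: "Z > 0" for Z k
  proof -
    have "\<bar>Q ^ Suc k\<bar> \<le> r" using rk[of k] Qr by (simp add: power_abs abs_mult)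
    then have U1: "1 - Q ^ Suc k \<noteq> 0" using r by auto
    have V1: "1 - V Z (Suc k) \<noteq> 0"
    proof
      assume "1 - V Z (Suc k) = 0"
      then have "norm (V Z (Suc k)) = 1" by simp
      then show False using nV[OF Z, of "Suc k"] rk[of k] r by simp
    qed
    have c0: "c Z (Suc k) \<noteq> 0" using Bc(1)[OF Z, of "Suc k"] by auto
    have "(1 + Q ^ Suc k) / (real (Suc k) * (1 - Q ^ Suc k)) = 2 * s1 k + 1 / real (Suc k)"
      using U1 by (simp add: s1_def divide_simps del: power_Suc of_nat_Suc)
    moreover have "(1 + V Z (Suc k)) / (c Z (Suc k) * (1 - V Z (Suc k))) =
        1 / c Z (Suc k) + 2 * V Z (Suc k) / (c Z (Suc k) * (1 - V Z (Suc k)))"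
      using V1 c0 by (simp add: divide_simps)
    ultimately show ?thesis unfolding R_def s2_def s3_def by simp
  qed
  have R_sums: "(\<lambda>k. R Z (Suc k)) sums (2 * log_euler Q + suminf (s2 Z) - suminf (s3 Z))" if Z: "Z > 0" for Z
    unfolding R_eq[OF Z] s1(2)[symmetric]
    by (intro sums_diff sums_add sums_mult summable_sums s1 s2 s3 Z)
  define A where "A = (\<lambda>z. \<Sum>k. weight z (a * (real (Suc k))\<^sup>2))"
  define Zf where "Zf = (\<lambda>z. sqrt (z / (a * Y\<^sup>2)))"
  define T where "T = (\<lambda>z. 2 * A z + 4 * pi / (a * Y) *
      (2 * log_euler Q + suminf (s2 (Zf z)) - suminf (s3 (Zf z))))"
  have aY: "a * Y\<^sup>2 > 0" using a Y by simp
  have Zf: "Zf z > 0" "z = a * Y\<^sup>2 * (Zf z)\<^sup>2" if "z > 0" for z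
    using that aY a Y by (simp_all add: Zf_def)
  let ?w = "\<lambda>z (m :: int, n :: int). weight z (a * ((of_int n + h * of_int m)\<^sup>2 + (Y * of_int m)\<^sup>2))"
  have w_nonneg: "?w z x \<ge> 0" for z x
    using a by (cases x) (auto intro!: weight_nonneg mult_nonneg_nonneg)
  have main: "(?w z has_sum T z) (UNIV \<times> UNIV)" if z: "z > 0" for z
  proof -
    define g where "g = (\<lambda>k. if k = 0 then 2 * A z else 2 * pi / (a * Y) * R (Zf z) k)"
    have row: "((\<lambda>n. ?w z (m, n)) has_sum g (nat \<bar>m\<bar>)) UNIV" for m
    proof (cases "m = 0")
      case True
      have "(\<lambda>k. weight z (a * (real (Suc k))\<^sup>2)) sums A z"
        unfolding A_def by (rule summable_sums[OF weight_axis_limit(1)[OF a]])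
      then have "(\<lambda>k. weight z (a * (real k)\<^sup>2)) sums (A z + weight z (a * (real 0)\<^sup>2))"
        by (rule sums_Suc_iff[of "\<lambda>k. weight z (a * (real k)\<^sup>2)", THEN iffD1])
      then have "(\<lambda>k. weight z (a * (real k)\<^sup>2)) sums A z" by (simp add: weight_def)
      then have "((\<lambda>n :: int. weight z (a * (real (nat \<bar>n\<bar>))\<^sup>2)) has_sum (2 * A z - weight z (a * (real 0)\<^sup>2))) UNIV"
        by (rule has_sum_int_even) (use a in \<open>auto intro: weight_nonneg\<close>)
      then show ?thesis using True by (simp add: g_def weight_def)
    next
      case False
      have "((\<lambda>n. ?w (a * Y\<^sup>2 * (Zf z)\<^sup>2) (m, n)) has_sum g (nat \<bar>m\<bar>)) UNIV"
        using has_sum_weight_line[OF a Y h Zf(1)[OF z] False] False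
        by (simp add: g_def R_def V_def c_def eps_def Qr(1) r_def power_mult_distrib flip: of_real_power)
      then show ?thesis using Zf(2)[OF z] by simp
    qed
    have g_nonneg: "g k \<ge> 0" for k
    proof -
      have "g (nat \<bar>int k\<bar>) \<ge> 0" by (rule has_sum_nonneg[OF row]) (rule w_nonneg)
      then show ?thesis by simp
    qed
    have "(\<lambda>k. g (Suc k)) sums (2 * pi / (a * Y) * (2 * log_euler Q + suminf (s2 (Zf z)) - suminf (s3 (Zf z))))"
      unfolding g_def using sums_mult[OF R_sums[OF Zf(1)[OF z]], of "2 * pi / (a * Y)"] by simp
    then have "g sums (2 * pi / (a * Y) * (2 * log_euler Q + suminf (s2 (Zf z)) - suminf (s3 (Zf z))) + g 0)"
      by (rule sums_Suc_iff[THEN iffD1])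
    from has_sum_int_even[OF this g_nonneg]
    have gT: "((\<lambda>m :: int. g (nat \<bar>m\<bar>)) has_sum T z) UNIV"
      by (simp add: T_def g_def algebra_simps)
    have "?w z summable_on (UNIV \<times> UNIV)"
      by (rule summable_on_SigmaI[OF row has_sum_imp_summable[OF gT]]) (use w_nonneg[of z] in auto)
    then obtain S where S: "(?w z has_sum S) (UNIV \<times> UNIV)" by (auto simp: summable_on_def)
    have "((\<lambda>m :: int. g (nat \<bar>m\<bar>)) has_sum S) UNIV"
      by (rule has_sum_SigmaD[OF S row])
    then have "S = T z" using gT has_sum_unique by blast
    then show ?thesis using S by simp
  qed
  have Zlim: "filterlim Zf at_top at_top"
    unfolding Zf_def using aY
    by (intro filterlim_compose[OF sqrt_at_top] filterlim_at_top_mult_tendsto_pos[OF tendsto_const _ filterlim_ident, of "1 / (a * Y\<^sup>2)", simplified]) auto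
  have small: "((\<lambda>z. B / Zf z) \<longlongrightarrow> 0) at_top" for B
    by (rule tendsto_divide_0[OF tendsto_const filterlim_at_top_imp_at_infinity[OF Zlim]])
  have ev0: "\<forall>\<^sub>F z in at_top. (z :: real) > 0" by (rule eventually_gt_at_top)
  have e2: "((\<lambda>z. suminf (s2 (Zf z)) - (euler_mascheroni - ln 2 + ln (Zf z))) \<longlongrightarrow> 0) at_top"
    by (rule Lim_null_comparison[OF _ small[of 8]])
       (use s2(2) Zf(1) in \<open>auto intro!: eventually_mono[OF ev0]\<close>)
  have e3: "((\<lambda>z. suminf (s3 (Zf z))) \<longlongrightarrow> 0) at_top"
    by (rule Lim_null_comparison[OF _ small[of C]])
       (use s3(2) Zf(1) in \<open>auto intro!: eventually_mono[OF ev0]\<close>)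
  have "((\<lambda>z. 2 * A z + 4 * pi / (a * Y) * (2 * log_euler Q +
      (suminf (s2 (Zf z)) - (euler_mascheroni - ln 2 + ln (Zf z))) +
      (euler_mascheroni - ln 2 - ln (a * Y\<^sup>2) / 2) - suminf (s3 (Zf z)))) \<longlongrightarrow>
      2 * (pi\<^sup>2 / (3 * a)) + 4 * pi / (a * Y) * (2 * log_euler Q + 0 +
      (euler_mascheroni - ln 2 - ln (a * Y\<^sup>2) / 2) - 0)) at_top"
    unfolding A_def by (intro tendsto_intros weight_axis_limit(2)[OF a] e2 e3)
  also have "2 * (pi\<^sup>2 / (3 * a)) + 4 * pi / (a * Y) * (2 * log_euler Q + 0 +
      (euler_mascheroni - ln 2 - ln (a * Y\<^sup>2) / 2) - 0) =
      4 * pi / (a * Y) * (pi * Y / 6 + 2 * log_euler Q + euler_mascheroni - ln 2 - ln (a * Y\<^sup>2) / 2)"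
    using a Y by (simp add: field_simps power2_eq_square)
  finally have lim: "((\<lambda>z. 2 * A z + 4 * pi / (a * Y) * (2 * log_euler Q +
      (suminf (s2 (Zf z)) - (euler_mascheroni - ln 2 + ln (Zf z))) +
      (euler_mascheroni - ln 2 - ln (a * Y\<^sup>2) / 2) - suminf (s3 (Zf z)))) \<longlongrightarrow>
      4 * pi / (a * Y) * (pi * Y / 6 + 2 * log_euler Q + euler_mascheroni - ln 2 - ln (a * Y\<^sup>2) / 2)) at_top" .
  have "((\<lambda>z. T z - 2 * pi / (a * Y) * ln z) \<longlongrightarrow>
      4 * pi / (a * Y) * (pi * Y / 6 + 2 * log_euler Q + euler_mascheroni - ln 2 - ln (a * Y\<^sup>2) / 2)) at_top"
  proof (rule Lim_transform_eventually[OF lim eventually_mono[OF ev0]])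
    fix z :: real assume z: "z > 0"
    have "ln (Zf z) = (ln z - ln (a * Y\<^sup>2)) / 2"
      using z a Y aY by (simp add: Zf_def ln_sqrt ln_div)
    then have lnz: "ln z = 2 * ln (Zf z) + ln (a * Y\<^sup>2)" by simp
    show "2 * A z + 4 * pi / (a * Y) * (2 * log_euler Q +
      (suminf (s2 (Zf z)) - (euler_mascheroni - ln 2 + ln (Zf z))) +
      (euler_mascheroni - ln 2 - ln (a * Y\<^sup>2) / 2) - suminf (s3 (Zf z))) = T z - 2 * pi / (a * Y) * ln z"
      unfolding T_def lnz using a Y by (simp add: field_simps)
  qed
  with main show thesis by (rule that)
qed

section \<open>Harmonic sums of an exponential profile\<close>

text \<open>Serves in place of convergence of improper integrals: an antiderivative with small
  increments beyond \<open>s\<close> has a limit, at infinity and, after inversion of the variable,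
  at 0.\<close>

lemma tendsto_at_top_Cauchy:
  fixes h g :: "real \<Rightarrow> real"
  assumes hg: "\<And>s t. 1 \<le> s \<Longrightarrow> s \<le> t \<Longrightarrow> \<bar>h t - h s\<bar> \<le> g s" and g: "(g \<longlongrightarrow> 0) at_top"
  obtains L where "(h \<longlongrightarrow> L) at_top"
proof -
  have ev: "\<exists>N\<ge>1. \<forall>s\<ge>N. g s < e" if "e > 0" for e
  proof -
    have "eventually (\<lambda>s. g s < e) at_top" using order_tendstoD(2)[OF g that] .
    then obtain N where "\<forall>s\<ge>N. g s < e" by (auto simp: eventually_at_top_linorder)
    then show ?thesis by (intro exI[of _ "max 1 N"]) auto
  qed
  have "Cauchy (\<lambda>n. h (real n))"
  proof (rule metric_CauchyI)
    fix e :: real assume "e > 0"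
    then obtain N where N: "N \<ge> 1" "\<And>s. s \<ge> N \<Longrightarrow> g s < e / 2" using ev[of "e / 2"] by auto
    have "dist (h (real m)) (h (real n)) < e" if "m \<ge> nat \<lceil>N\<rceil>" "n \<ge> nat \<lceil>N\<rceil>" for m n
    proof -
      have "real m \<ge> N" "real n \<ge> N" using that by linarith+
      then have "\<bar>h (real m) - h N\<bar> \<le> g N" "\<bar>h (real n) - h N\<bar> \<le> g N" using hg N(1) by auto
      then show ?thesis using N(2)[of N] by (simp add: dist_real_def)
    qed
    then show "\<exists>M. \<forall>m\<ge>M. \<forall>n\<ge>M. dist (h (real m)) (h (real n)) < e" by blast
  qed
  then obtain L where L: "(\<lambda>n. h (real n)) \<longlonglongrightarrow> L" using Cauchy_convergent convergent_def by blast
  have "\<bar>L - h s\<bar> \<le> g s" if "s \<ge> 1" for s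
  proof (rule LIMSEQ_le_const2)
    show "(\<lambda>n. \<bar>h (real n) - h s\<bar>) \<longlonglongrightarrow> \<bar>L - h s\<bar>" by (intro tendsto_intros L)
    show "\<exists>N. \<forall>n\<ge>N. \<bar>h (real n) - h s\<bar> \<le> g s"
      using hg[OF that] by (intro exI[of _ "nat \<lceil>s\<rceil>"]) (auto simp: nat_ceiling_le_eq)
  qed
  then have "eventually (\<lambda>s. norm (h s - L) \<le> g s) at_top"
    by (intro eventually_at_top_linorderI[of 1]) (auto simp: abs_minus_commute)
  then have "((\<lambda>s. h s - L) \<longlongrightarrow> 0) at_top" by (rule Lim_null_comparison[OF _ g])
  then have "(h \<longlongrightarrow> L) at_top" by (simp add: LIM_zero_iff)
  then show thesis by (rule that)
qed

lemma abs_diff_le_by_derivative: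
  fixes h g :: "real \<Rightarrow> real"
  assumes st: "s \<le> t"
    and h: "\<And>x. s \<le> x \<Longrightarrow> x \<le> t \<Longrightarrow> (h has_real_derivative h' x) (at x)"
    and g: "\<And>x. s \<le> x \<Longrightarrow> x \<le> t \<Longrightarrow> (g has_real_derivative g' x) (at x)"
    and le: "\<And>x. s \<le> x \<Longrightarrow> x \<le> t \<Longrightarrow> \<bar>h' x\<bar> \<le> g' x"
  shows "\<bar>h t - h s\<bar> \<le> g t - g s"
proof (cases "s = t")
  case False
  have "norm (h t - h s) \<le> g t - g s"
  proof (rule differentiable_bound_general)
    show "s < t" using st False by simp
    show "continuous_on {s..t} h" "continuous_on {s..t} g"
      by (rule DERIV_continuous_on, rule has_field_derivative_at_within, rule h g, simp, simp)+
    show "(h has_vector_derivative h' x) (at x)" "(g has_vector_derivative g' x) (at x)"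
      if "s < x" "x < t" for x
      using h[of x] g[of x] that by (auto simp: has_real_derivative_iff_has_vector_derivative)
    show "norm (h' x) \<le> g' x" if "s < x" "x < t" for x using le[of x] that by simp
  qed
  then show ?thesis by simp
qed simp

text \<open>Summing over one divisor in closed form leaves series with the terms (R(1) - R(exp (- a
  / e))) / e. Vanishing of \<open>R\<close> at 0 makes the profile R(exp (- t)) decay like exp (-
  t), and the bound on the derivative keeps it within C t of \<open>R 1\<close> near 0.\<close>

locale exp_profile =
  fixes R R' :: "real \<Rightarrow> real" and C :: real
  assumes R_0: "R 0 = 0"
    and R_deriv: "\<And>x. 0 \<le> x \<Longrightarrow> x \<le> 1 \<Longrightarrow> (R has_real_derivative R' x) (at x)"
    and R'_bound: "\<And>x. 0 \<le> x \<Longrightarrow> x \<le> 1 \<Longrightarrow> \<bar>R' x\<bar> \<le> C"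
begin

definition F :: "real \<Rightarrow> real" where "F t = R (exp (- t))"

lemma C_nonneg: "C \<ge> 0"
  using R'_bound[of 0] by simp

lemma R_lipschitz: "0 \<le> x \<Longrightarrow> x \<le> y \<Longrightarrow> y \<le> 1 \<Longrightarrow> \<bar>R y - R x\<bar> \<le> C * (y - x)"
  using abs_diff_le_by_derivative[of x y R R' "\<lambda>x. C * x" "\<lambda>_. C"] R_deriv R'_bound
  by (auto intro!: derivative_eq_intros simp: right_diff_distrib)

lemma F_le: "t \<ge> 0 \<Longrightarrow> \<bar>F t\<bar> \<le> C * exp (- t)"
  using R_lipschitz[of 0 "exp (- t)"] by (simp add: F_def R_0)

lemma F_near_0:
  assumes "t \<ge> 0" shows "\<bar>R 1 - F t\<bar> \<le> C * t"
proof -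
  have "\<bar>R 1 - F t\<bar> \<le> C * (1 - exp (- t))"
    unfolding F_def using assms by (intro R_lipschitz) auto
  also have "\<dots> \<le> C * t"
    using exp_ge_add_one_self[of "- t"] C_nonneg by (intro mult_left_mono) linarith+
  finally show ?thesis .
qed

lemma F_deriv: "t \<ge> 0 \<Longrightarrow> (F has_real_derivative - exp (- t) * R' (exp (- t))) (at t)"
proof -
  assume "t \<ge> 0"
  then have "(R has_real_derivative R' (exp (- t))) (at (exp (- t)))" by (intro R_deriv) auto
  moreover have "((\<lambda>t. exp (- t)) has_real_derivative - exp (- t)) (at t)"
    by (auto intro!: derivative_eq_intros)
  ultimately have "((\<lambda>t. R (exp (- t))) has_real_derivative R' (exp (- t)) * - exp (- t)) (at t)"
    by (rule DERIV_chain2)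
  then show ?thesis unfolding F_def[abs_def] by (simp add: mult.commute)
qed

text \<open>\<open>K\<close> is the integral of F(u) / u from t to infinity, and \<open>K0\<close>
  is its finite part at 0, left after the singularity - R(1) ln t has been removed.\<close>

lemma F_antiderivative:
  obtains K K0 where
    "\<And>t. t > 0 \<Longrightarrow> (K has_real_derivative - (F t / t)) (at t)"
    "(K \<longlongrightarrow> 0) at_top" "((\<lambda>t. K t + R 1 * ln t) \<longlongrightarrow> K0) (at_right 0)"
proof -
  have "\<exists>K. \<forall>x :: real. 0 < ereal x \<longrightarrow> ereal x < \<infinity> \<longrightarrow> (K has_vector_derivative - (F x / x)) (at x)"
  proof (rule einterval_antiderivative)
    fix x :: real assume "0 < ereal x"
    then have x: "x > 0" by simp
    have "isCont F x" using F_deriv[of x] x by (intro DERIV_isCont) auto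
    then show "isCont (\<lambda>x. - (F x / x)) x" using x by (intro continuous_intros) auto
  qed simp
  then obtain K1 where K1: "\<And>t. t > 0 \<Longrightarrow> (K1 has_real_derivative - (F t / t)) (at t)"
    by (auto simp: has_real_derivative_iff_has_vector_derivative)
  have "\<bar>K1 t - K1 s\<bar> \<le> C * exp (- s)" if st: "1 \<le> s" "s \<le> t" for s t
  proof -
    have "\<bar>K1 t - K1 s\<bar> \<le> (- C * exp (- t)) - (- C * exp (- s))"
    proof (rule abs_diff_le_by_derivative[OF st(2)])
      fix x assume x: "s \<le> x" "x \<le> t"
      show "(K1 has_real_derivative - (F x / x)) (at x)" using K1 x st by simp
      show "((\<lambda>x. - C * exp (- x)) has_real_derivative C * exp (- x)) (at x)"
        by (auto intro!: derivative_eq_intros)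
      have "\<bar>F x\<bar> / x \<le> \<bar>F x\<bar> / 1" using x st by (intro divide_left_mono) auto
      also have "\<dots> \<le> C * exp (- x)" using F_le[of x] x st by simp
      finally show "\<bar>- (F x / x)\<bar> \<le> C * exp (- x)" using x st by (simp add: abs_divide)
    qed
    also have "\<dots> \<le> C * exp (- s)" using C_nonneg by simp
    finally show ?thesis .
  qed
  moreover have "((\<lambda>s. C * exp (- s)) \<longlongrightarrow> 0) at_top" by real_asymp
  ultimately obtain L where L: "(K1 \<longlongrightarrow> L) at_top" by (rule tendsto_at_top_Cauchy)
  define K where "K = (\<lambda>t. K1 t - L)"
  have K: "(K has_real_derivative - (F t / t)) (at t)" if "t > 0" for t
    unfolding K_def using K1[OF that] by (auto intro!: derivative_eq_intros)
  have Klim: "(K \<longlongrightarrow> 0) at_top" using L by (simp add: K_def LIM_zero)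
  let ?H = "\<lambda>t. K t + R 1 * ln t"
  have "\<bar>?H (inverse t) - ?H (inverse s)\<bar> \<le> C * inverse s" if st: "1 \<le> s" "s \<le> t" for s t
  proof -
    have i: "inverse t > 0" "inverse t \<le> inverse s" using st by (auto intro: le_imp_inverse_le)
    have "\<bar>?H (inverse s) - ?H (inverse t)\<bar> \<le> C * inverse s - C * inverse t"
    proof (rule abs_diff_le_by_derivative[OF i(2)])
      fix x assume "inverse t \<le> x"
      then have x: "x > 0" using i(1) by linarith
      show "(?H has_real_derivative (R 1 - F x) / x) (at x)"
        using x by (auto intro!: derivative_eq_intros K simp: field_simps)
      show "((*) C has_real_derivative C) (at x)" by (auto intro!: derivative_eq_intros)
      show "\<bar>(R 1 - F x) / x\<bar> \<le> C" using F_near_0[of x] x by (simp add: abs_divide field_simps)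
    qed
    also have "\<dots> \<le> C * inverse s" using C_nonneg i by simp
    finally show ?thesis by (simp add: abs_minus_commute)
  qed
  moreover have "((\<lambda>s. C * inverse s) \<longlongrightarrow> 0) at_top" by real_asymp
  ultimately obtain K0 where "((\<lambda>t. ?H (inverse t)) \<longlongrightarrow> K0) at_top"
    by (rule tendsto_at_top_Cauchy)
  then have "(?H \<longlongrightarrow> K0) (at_right 0)" by (simp add: filterlim_at_right_to_top)
  with K Klim show thesis by (rule that)
qed

text \<open>These are the derivative and the majorant for \<open>sum_antiderivative_bound\<close>.
  At t = a / x the estimate (1 + t) exp (- t) \<le> 2 exp (- t / 2) leads to exp (- a / (2 x)) /
  x^2, which has an elementary antiderivative with total increase \<open>4 * C / a\<close>.\<close>

lemma profile_variation:
  assumes a: "a > 0" and x: "x > 0"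
  shows "((\<lambda>x. F (a / x) / x) has_real_derivative
           (- (F (a / x) - a / x * (exp (- (a / x)) * R' (exp (- (a / x))))) / x\<^sup>2)) (at x)"
    and "((\<lambda>x. 4 * C / a * exp (- (a / (2 * x)))) has_real_derivative 2 * C * exp (- (a / (2 * x))) / x\<^sup>2) (at x)"
    and "\<bar>- (F (a / x) - a / x * (exp (- (a / x)) * R' (exp (- (a / x))))) / x\<^sup>2\<bar> \<le> 2 * C * exp (- (a / (2 * x))) / x\<^sup>2"
proof -
  let ?t = "a / x"
  have t: "?t > 0" using a x by simp
  show "((\<lambda>x. F (a / x) / x) has_real_derivative
           (- (F ?t - ?t * (exp (- ?t) * R' (exp (- ?t)))) / x\<^sup>2)) (at x)"
  proof -
    have "((\<lambda>x. a / x) has_real_derivative - a / x\<^sup>2) (at x)"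
      using x by (auto intro!: derivative_eq_intros simp: power2_eq_square)
    then have "((\<lambda>x. F (a / x)) has_real_derivative (- exp (- ?t) * R' (exp (- ?t))) * (- a / x\<^sup>2)) (at x)"
      using t by (intro DERIV_chain2[OF F_deriv]) auto
    then have "((\<lambda>x. F (a / x) / x) has_real_derivative
        (((- exp (- ?t) * R' (exp (- ?t))) * (- a / x\<^sup>2)) * x - F ?t * 1) / (x * x)) (at x)"
      using x by (intro DERIV_divide DERIV_ident) auto
    moreover have "(((- exp (- ?t) * R' (exp (- ?t))) * (- a / x\<^sup>2)) * x - F ?t * 1) / (x * x) =
        - (F ?t - ?t * (exp (- ?t) * R' (exp (- ?t)))) / x\<^sup>2"
    proof -
      have "(((- u * v) * (- a / x\<^sup>2)) * x - w * 1) / (x * x) = - (w - a / x * (u * v)) / x\<^sup>2" for u v w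
        using x by (simp add: field_simps power2_eq_square)
      then show ?thesis .
    qed
    ultimately show ?thesis by simp
  qed
  show "((\<lambda>x. 4 * C / a * exp (- (a / (2 * x)))) has_real_derivative 2 * C * exp (- (a / (2 * x))) / x\<^sup>2) (at x)"
    using x a by (auto intro!: derivative_eq_intros simp: field_simps power2_eq_square)
  have "\<bar>F ?t - ?t * (exp (- ?t) * R' (exp (- ?t)))\<bar> \<le> \<bar>F ?t\<bar> + ?t * (exp (- ?t) * \<bar>R' (exp (- ?t))\<bar>)"
    using abs_triangle_ineq4[of "F ?t" "?t * (exp (- ?t) * R' (exp (- ?t)))"] a x
    by (simp add: abs_mult)
  also have "\<dots> \<le> C * exp (- ?t) + ?t * (exp (- ?t) * C)"
    using F_le[of ?t] R'_bound[of "exp (- ?t)"] t by (intro add_mono mult_left_mono) auto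
  also have "\<dots> = C * ((1 + ?t) * exp (- ?t))" by (simp add: algebra_simps)
  also have "\<dots> \<le> C * (2 * exp (?t / 2) * exp (- ?t))"
  proof -
    have "1 + ?t \<le> 2 * exp (?t / 2)" using exp_ge_add_one_self[of "?t / 2"] t by argo
    then show ?thesis using C_nonneg by (intro mult_left_mono mult_right_mono) auto
  qed
  also have "\<dots> = 2 * C * exp (- (a / (2 * x)))"
    by (simp add: mult_exp_exp)
  finally show "\<bar>- (F ?t - ?t * (exp (- ?t) * R' (exp (- ?t)))) / x\<^sup>2\<bar> \<le> 2 * C * exp (- (a / (2 * x))) / x\<^sup>2"
    by (simp add: abs_divide divide_right_mono)
qed

lemma summable_profile:
  assumes "a > 0"
  shows "summable (\<lambda>e. \<bar>(R 1 - F (a / real (Suc e))) / real (Suc e)\<bar>)"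
proof (rule summable_comparison_test'[where N = 0])
  show "summable (\<lambda>e. C * a * inverse (real (Suc e) ^ 2))"
    using summable_Suc_iff[of "\<lambda>m. inverse (real m ^ 2)"] inverse_power_summable[of 2, where ?'a = real]
    by (intro summable_mult) simp
  fix e :: nat
  let ?x = "real (Suc e)"
  have "\<bar>R 1 - F (a / ?x)\<bar> / ?x \<le> C * (a / ?x) / ?x"
    using assms by (intro divide_right_mono F_near_0) auto
  then show "norm \<bar>(R 1 - F (a / ?x)) / ?x\<bar> \<le> C * a * inverse (?x ^ 2)"
    by (simp add: abs_divide power2_eq_square field_simps)
qed

text \<open>\<open>K (a / x)\<close> is an antiderivative of F(a / x) / x, and the comparison of sum
  and increment is accurate to O(1 / a) for any number of terms. Letting this number grow, the
  harmonic sum supplies Euler's constant, and the behaviour of \<open>K\<close> at 0 supplies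
  \<open>R 1 * ln a\<close> and \<open>K0\<close>.\<close>

lemma profile_sum_asymptotics:
  assumes K: "\<And>t. t > 0 \<Longrightarrow> (K has_real_derivative - (F t / t)) (at t)"
    and K_inf: "(K \<longlongrightarrow> 0) at_top" and K_0: "((\<lambda>t. K t + R 1 * ln t) \<longlongrightarrow> K0) (at_right 0)"
  shows "((\<lambda>a. (\<Sum>e. (R 1 - F (a / real (Suc e))) / real (Suc e)) - R 1 * ln a) \<longlongrightarrow>
            R 1 * euler_mascheroni - K0) at_top"
proof -
  have bound: "\<bar>((\<Sum>e. (R 1 - F (a / real (Suc e))) / real (Suc e)) - R 1 * ln a) -
      (R 1 * euler_mascheroni - K0) + F a - K a\<bar> \<le> 4 * C / a" if a: "a > 0" for a
  proof -
    let ?f = "\<lambda>x. F (a / x) / x" and ?g = "\<lambda>x. 4 * C / a * exp (- (a / (2 * x)))"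
    have part: "\<bar>(\<Sum>m\<in>{1<..N}. ?f (real m)) - (K (a / real N) - K a)\<bar> \<le> 4 * C / a" if N: "N \<ge> 1" for N
    proof -
      have "norm ((\<Sum>m\<in>{1<..N}. ?f (real m)) - (K (a / real N) - K (a / real 1))) \<le> ?g (real N) - ?g (real 1)"
      proof (rule sum_antiderivative_bound[OF N, where Phi = "\<lambda>x. K (a / x)"])
        fix x :: real assume "real 1 \<le> x"
        then have x: "x > 0" by simp
        have "((\<lambda>x. a / x) has_real_derivative - a / x\<^sup>2) (at x)"
          using x by (auto intro!: derivative_eq_intros simp: power2_eq_square)
        then have "((\<lambda>x. K (a / x)) has_real_derivative - (F (a / x) / (a / x)) * (- a / x\<^sup>2)) (at x)"
          using a x by (intro DERIV_chain2[OF K]) auto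
        moreover have "- (F (a / x) / (a / x)) * (- a / x\<^sup>2) = ?f x"
          using a x by (simp add: power2_eq_square)
        ultimately show "((\<lambda>x. K (a / x)) has_vector_derivative ?f x) (at x)"
          by (simp add: has_real_derivative_iff_has_vector_derivative)
        show "(?f has_vector_derivative (- (F (a / x) - a / x * (exp (- (a / x)) * R' (exp (- (a / x))))) / x\<^sup>2)) (at x)"
          unfolding has_real_derivative_iff_has_vector_derivative[symmetric] by (rule profile_variation(1)[OF a x])
        show "(?g has_real_derivative 2 * C * exp (- (a / (2 * x))) / x\<^sup>2) (at x)"
          by (rule profile_variation(2)[OF a x])
        show "norm (- (F (a / x) - a / x * (exp (- (a / x)) * R' (exp (- (a / x))))) / x\<^sup>2) \<le> 2 * C * exp (- (a / (2 * x))) / x\<^sup>2"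
          unfolding real_norm_def by (rule profile_variation(3)[OF a x])
      qed
      also have "\<dots> \<le> 4 * C / a"
      proof -
        have "4 * C / a * exp (- (a / (2 * real N))) \<le> 4 * C / a * 1"
          using a C_nonneg by (intro mult_left_mono) auto
        moreover have "4 * C / a * exp (- (a / (2 * real 1))) \<ge> 0" using a C_nonneg by simp
        ultimately show ?thesis by linarith
      qed
      finally show ?thesis by simp
    qed
    let ?s = "\<lambda>e. (R 1 - F (a / real (Suc e))) / real (Suc e)"
    have "summable ?s" using summable_profile[OF a] by (rule summable_rabs_cancel)
    then have lim1: "(\<lambda>N. \<Sum>e<N. ?s e) \<longlonglongrightarrow> suminf ?s" by (rule summable_LIMSEQ)
    \<comment> \<open>The comparison starts at 1, so the first term is split off. It equals
      \<open>F a\<close> and disappears, together with \<open>K a\<close>, as \<open>a\<close>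
      grows.\<close>
    have eq: "(\<Sum>e<N. ?s e) = R 1 * harm N - ?f 1 - (\<Sum>m\<in>{1<..N}. ?f (real m))" if N: "N \<ge> 1" for N
    proof -
      have "(\<Sum>e<N. ?s e) = R 1 * harm N - (\<Sum>e<N. ?f (real (Suc e)))"
        by (simp add: diff_divide_distrib sum_subtractf harm_altdef sum_distrib_left inverse_eq_divide del: of_nat_Suc)
      also have "(\<Sum>e<N. ?f (real (Suc e))) = (\<Sum>m\<in>{1..N}. ?f (real m))"
        by (rule sum.reindex_bij_witness[of _ "\<lambda>m. m - 1" Suc]) auto
      also have "{1..N} = insert 1 {1<..N}" using N by auto
      finally show ?thesis by simp
    qed
    have KL: "(\<lambda>N. K (a / real N) + R 1 * ln (a / real N)) \<longlonglongrightarrow> K0"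
    proof (rule filterlim_compose[OF K_0])
      have "filterlim (\<lambda>N. a / real N) (nhds 0) sequentially" by real_asymp
      then show "filterlim (\<lambda>N. a / real N) (at_right 0) sequentially"
        using a by (intro tendsto_imp_filterlim_at_right eventually_sequentiallyI[of 1]) auto
    qed
    define E where "E = R 1 * ln a - F a + K a"
    define L where "L = (\<lambda>N. R 1 * (harm N - ln (real N)) + E - (K (a / real N) + R 1 * ln (a / real N)))"
    have "L \<longlonglongrightarrow> R 1 * euler_mascheroni + E - K0"
      unfolding L_def
      by (rule tendsto_diff[OF tendsto_add[OF tendsto_mult[OF tendsto_const euler_mascheroni_LIMSEQ] tendsto_const] KL])
    then have "(\<lambda>N. \<bar>(\<Sum>e<N. ?s e) - L N\<bar>) \<longlonglongrightarrow> \<bar>suminf ?s - (R 1 * euler_mascheroni + E - K0)\<bar>"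
      by (intro tendsto_rabs tendsto_diff lim1)
    then have "\<bar>suminf ?s - (R 1 * euler_mascheroni + E - K0)\<bar> \<le> 4 * C / a"
    proof (rule LIMSEQ_le_const2)
      show "\<exists>N. \<forall>n\<ge>N. \<bar>(\<Sum>e<n. ?s e) - L n\<bar> \<le> 4 * C / a"
      proof (intro exI[of _ 1] allI impI)
        fix n :: nat assume n: "1 \<le> n"
        have "R 1 * ln (a / real n) = R 1 * ln a - R 1 * ln (real n)"
          using a n by (simp add: ln_div right_diff_distrib)
        then have "(\<Sum>e<n. ?s e) - L n = - ((\<Sum>m\<in>{1<..n}. ?f (real m)) - (K (a / real n) - K a))"
          unfolding eq[OF n] L_def E_def by (simp add: algebra_simps)
        then show "\<bar>(\<Sum>e<n. ?s e) - L n\<bar> \<le> 4 * C / a"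
          using part[OF n] by (simp only: abs_minus_cancel)
      qed
    qed
    then have "\<bar>suminf ?s - (R 1 * euler_mascheroni + (R 1 * ln a - F a + K a) - K0)\<bar> \<le> 4 * C / a"
      unfolding E_def .
    then show ?thesis by (simp add: algebra_simps)
  qed
  have Fa: "(F \<longlongrightarrow> 0) at_top"
  proof (rule Lim_null_comparison)
    show "eventually (\<lambda>t. norm (F t) \<le> C * exp (- t)) at_top"
      using F_le by (intro eventually_at_top_linorderI[of 0]) auto
    show "((\<lambda>t. C * exp (- t)) \<longlongrightarrow> 0) at_top" by real_asymp
  qed
  have "((\<lambda>a. ((\<Sum>e. (R 1 - F (a / real (Suc e))) / real (Suc e)) - R 1 * ln a) -
      (R 1 * euler_mascheroni - K0) + F a - K a) \<longlongrightarrow> 0) at_top"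
  proof (rule Lim_null_comparison)
    show "eventually (\<lambda>a. norm (((\<Sum>e. (R 1 - F (a / real (Suc e))) / real (Suc e)) - R 1 * ln a) -
      (R 1 * euler_mascheroni - K0) + F a - K a) \<le> 4 * C / a) at_top"
      using bound by (intro eventually_at_top_linorderI[of 1]) auto
    show "((\<lambda>a. 4 * C / a) \<longlongrightarrow> 0) at_top" by real_asymp
  qed
  from tendsto_add[OF tendsto_diff[OF this Fa] K_inf]
  have "((\<lambda>a. (((\<Sum>e. (R 1 - F (a / real (Suc e))) / real (Suc e)) - R 1 * ln a) -
      (R 1 * euler_mascheroni - K0)) + F a - K a - F a + K a) \<longlongrightarrow> 0) at_top"
    by (simp only: diff_0_right add_0_right)
  moreover have "x + F a - K a - F a + K a = x" for x a by simp
  ultimately have "((\<lambda>a. ((\<Sum>e. (R 1 - F (a / real (Suc e))) / real (Suc e)) - R 1 * ln a) -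
      (R 1 * euler_mascheroni - K0)) \<longlongrightarrow> 0) at_top" by (simp only:)
  then show ?thesis by (rule LIM_zero_cancel)
qed

end

section \<open>Odd characters and the Gamma function\<close>

text \<open>The terms exp (- h m) / m add up to - ln (1 - exp (- h)). After subtraction of 1 / m the
  summand is increasing, hence its own majorant in \<open>sum_antiderivative_bound\<close>, and
  comparison with \<open>K\<close> fixes the finite part up to 2 h.\<close>

lemma exp_integral_constant:
  fixes K :: "real \<Rightarrow> real"
  assumes K: "\<And>t. t > 0 \<Longrightarrow> (K has_real_derivative - (exp (- t) / t)) (at t)"
    and K_inf: "(K \<longlongrightarrow> 0) at_top" and K_0: "((\<lambda>t. K t + ln t) \<longlongrightarrow> K0) (at_right 0)"
  shows "K0 = - euler_mascheroni"
proof -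
  have bound: "\<bar>- ln (1 - exp (- h)) - euler_mascheroni - K h\<bar> \<le> 2 * h" if h: "h > 0" for h
  proof -
    define f where "f = (\<lambda>x. (exp (- h * x) - 1) / x)"
    define f' where "f' = (\<lambda>x. (1 - exp (- h * x) * (1 + h * x)) / x\<^sup>2)"
    define Phi where "Phi = (\<lambda>x. - K (h * x) - ln x)"
    define x where "x = exp (- h)"
    have x: "0 < x" "x < 1" using h by (auto simp: x_def)
    have df: "(f has_real_derivative f' t) (at t)" if "t \<ge> 1" for t
      unfolding f_def f'_def using that
      by (auto intro!: derivative_eq_intros simp: field_simps power2_eq_square)
    have f1: "- h \<le> f 1" "f 1 \<le> 0"
      using exp_ge_add_one_self[of "- h"] h by (auto simp: f_def)
    have part: "\<bar>(\<Sum>m\<in>{1<..N}. f (real m)) - (Phi (real N) - Phi 1)\<bar> \<le> h" if N: "N \<ge> 1" for N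
    proof -
      have "norm ((\<Sum>m\<in>{1<..N}. f (real m)) - (Phi (real N) - Phi (real 1))) \<le> f (real N) - f (real 1)"
      proof (rule sum_antiderivative_bound[OF N])
        fix t :: real assume "real 1 \<le> t"
        then have t: "t \<ge> 1" by simp
        show "(f has_vector_derivative f' t) (at t)" "(f has_real_derivative f' t) (at t)"
          using df[OF t] by (simp_all add: has_real_derivative_iff_has_vector_derivative)
        have "((\<lambda>x. K (h * x)) has_real_derivative - (exp (- (h * t)) / (h * t)) * h) (at t)"
          by (rule DERIV_chain2[OF K]) (use h t in \<open>auto intro!: derivative_eq_intros\<close>)
        then have "(Phi has_real_derivative f t) (at t)"
          unfolding Phi_def f_def using h t by (auto intro!: derivative_eq_intros simp: field_simps)
        then show "(Phi has_vector_derivative f t) (at t)"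
          by (simp add: has_real_derivative_iff_has_vector_derivative)
        have "exp (- h * t) * (1 + h * t) \<le> exp (- h * t) * exp (h * t)"
          using exp_ge_add_one_self[of "h * t"] by (intro mult_left_mono) auto
        also have "\<dots> = 1" by (simp add: mult_exp_exp)
        finally have "f' t \<ge> 0" by (simp add: f'_def)
        then show "norm (f' t) \<le> f' t" by simp
      qed
      moreover have "f (real N) \<le> 0" using h N by (auto simp: f_def divide_nonpos_pos)
      ultimately show ?thesis using f1 by simp
    qed
    have ser: "(\<lambda>k. x ^ Suc k / real (Suc k)) sums - ln (1 - x)"
    proof -
      have "(\<lambda>n. - ((- (- x)) ^ n) / real n) sums ln (1 + - x)" using x by (intro ln_series') auto
      then have "(\<lambda>n. - (- (x ^ n) / real n)) sums - ln (1 - x)" by (intro sums_minus) simp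
      then show ?thesis
        using sums_Suc_iff[of "\<lambda>n. x ^ n / real n" "- ln (1 - x)"] by (simp del: power_Suc of_nat_Suc)
    qed
    have eq: "(\<Sum>m\<in>{1<..N}. f (real m)) = (\<Sum>k<N. x ^ Suc k / real (Suc k)) - harm N - f 1" if N: "N \<ge> 1" for N
    proof -
      have "(\<Sum>m\<in>{1..N}. f (real m)) = (\<Sum>k<N. f (real (Suc k)))"
        by (rule sum.reindex_bij_witness[of _ Suc "\<lambda>m. m - 1"]) auto
      also have "f (real (Suc k)) = x ^ Suc k / real (Suc k) - inverse (real (Suc k))" for k
      proof -
        have "exp (- h * real (Suc k)) = x ^ Suc k"
          unfolding x_def by (metis exp_of_nat_mult mult.commute)
        then show ?thesis by (simp add: f_def diff_divide_distrib inverse_eq_divide del: of_nat_Suc power_Suc)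
      qed
      then have "(\<Sum>k<N. f (real (Suc k))) = (\<Sum>k<N. x ^ Suc k / real (Suc k)) - harm N"
        by (simp add: sum_subtractf harm_altdef del: of_nat_Suc power_Suc)
      moreover have "{1..N} = insert 1 {1<..N}" using N by auto
      ultimately show ?thesis by simp
    qed
    have KN: "(\<lambda>N. K (h * real N)) \<longlonglongrightarrow> 0"
    proof (rule filterlim_compose[OF K_inf])
      show "filterlim (\<lambda>N. h * real N) at_top sequentially" using h by real_asymp
    qed
    have "(\<lambda>N. (\<Sum>k<N. x ^ Suc k / real (Suc k)) - (harm N - ln (real N)) - (f 1 + K h) + K (h * real N))
        \<longlonglongrightarrow> - ln (1 - x) - euler_mascheroni - (f 1 + K h) + 0"
      using ser unfolding sums_def
      by (intro tendsto_add[OF tendsto_diff[OF tendsto_diff[OF _ euler_mascheroni_LIMSEQ] tendsto_const] KN])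
    then have "(\<lambda>N. \<bar>(\<Sum>k<N. x ^ Suc k / real (Suc k)) - (harm N - ln (real N)) - (f 1 + K h) + K (h * real N)\<bar>)
        \<longlonglongrightarrow> \<bar>- ln (1 - x) - euler_mascheroni - (f 1 + K h) + 0\<bar>"
      by (rule tendsto_rabs)
    then have "\<bar>- ln (1 - x) - euler_mascheroni - (f 1 + K h) + 0\<bar> \<le> h"
    proof (rule LIMSEQ_le_const2)
      show "\<exists>N. \<forall>n\<ge>N. \<bar>(\<Sum>k<n. x ^ Suc k / real (Suc k)) - (harm n - ln (real n)) - (f 1 + K h) + K (h * real n)\<bar> \<le> h"
      proof (intro exI[of _ 1] allI impI)
        fix n :: nat assume n: "1 \<le> n"
        have "(\<Sum>k<n. x ^ Suc k / real (Suc k)) - (harm n - ln (real n)) - (f 1 + K h) + K (h * real n) =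
            (\<Sum>m\<in>{1<..n}. f (real m)) - (Phi (real n) - Phi 1)"
          unfolding eq[OF n] Phi_def by simp
        then show "\<bar>(\<Sum>k<n. x ^ Suc k / real (Suc k)) - (harm n - ln (real n)) - (f 1 + K h) + K (h * real n)\<bar> \<le> h"
          using part[OF n] by simp
      qed
    qed
    then show ?thesis using f1 unfolding x_def by linarith
  qed
  have "((\<lambda>h. (ln h - ln (1 - exp (- h))) - euler_mascheroni - (K h + ln h)) \<longlongrightarrow> 0 - euler_mascheroni - K0) (at_right 0)"
  proof (intro tendsto_diff tendsto_const K_0)
    show "((\<lambda>h :: real. ln h - ln (1 - exp (- h))) \<longlongrightarrow> 0) (at_right 0)" by real_asymp
  qed
  moreover have "((\<lambda>h. (ln h - ln (1 - exp (- h))) - euler_mascheroni - (K h + ln h)) \<longlongrightarrow> 0) (at_right 0)"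
  proof (rule Lim_null_comparison)
    show "\<forall>\<^sub>F h in at_right 0. norm ((ln h - ln (1 - exp (- h))) - euler_mascheroni - (K h + ln h)) \<le> 2 * h"
    proof (rule eventually_mono[OF eventually_at_right_less[of 0]])
      fix h :: real assume "0 < h"
      from bound[OF this] show "norm ((ln h - ln (1 - exp (- h))) - euler_mascheroni - (K h + ln h)) \<le> 2 * h"
        by simp
    qed
    show "((\<lambda>h. 2 * h) \<longlongrightarrow> (0 :: real)) (at_right 0)" by real_asymp
  qed
  ultimately have "0 - euler_mascheroni - K0 = 0"
    by (rule tendsto_unique[rotated]) simp
  then show ?thesis by simp
qed

text \<open>The condition \<open>gauss\<close> says that the finite Fourier transform of
  \<open>chi\<close> is a multiple of \<open>chi\<close>, also at non-units, as for a primitive real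
  character. The factor is imaginary because \<open>chi\<close> is odd; \<open>Gs\<close> may have
  either sign.\<close>

locale odd_character =
  fixes chi :: "nat \<Rightarrow> int" and f :: nat and Gs :: real
  assumes f_gt_1: "f > 1"
    and periodic: "\<And>m. chi (m + f) = chi m"
    and odd: "\<And>m. m \<le> f \<Longrightarrow> chi (f - m) = - chi m"
    and bounded: "\<And>m. \<bar>chi m\<bar> \<le> 1"
    and gauss: "\<And>j. (\<Sum>m<f. of_int (chi m) * exp (2 * of_real pi * \<i> * of_nat m * of_nat j / of_nat f)) =
                  \<i> * complex_of_real Gs * of_int (chi j)"
begin

text \<open>\<open>R\<close> is the generating function of \<open>chi\<close>. As the quotient of a
  polynomial by 1 - x^f it would be indeterminate at x = 1, where its value and derivative are
  wanted. Summation by parts extracts 1 - x from the numerator and leaves \<open>P1\<close> over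
  \<open>Dn\<close>, the latter being at least 1 for x \<ge> 0.\<close>

definition psum :: "nat \<Rightarrow> real" where "psum m = (\<Sum>i\<le>m. of_int (chi i))"
definition P1 :: "real \<Rightarrow> real" where "P1 x = (\<Sum>m<f. psum m * x ^ m)"
definition P1' :: "real \<Rightarrow> real" where "P1' x = (\<Sum>m<f. psum m * (real m * x ^ (m - 1)))"
definition Dn :: "real \<Rightarrow> real" where "Dn x = (\<Sum>m<f. x ^ m)"
definition Dn' :: "real \<Rightarrow> real" where "Dn' x = (\<Sum>m<f. real m * x ^ (m - 1))"
definition R :: "real \<Rightarrow> real" where "R x = P1 x / Dn x"
definition R' :: "real \<Rightarrow> real" where "R' x = (P1' x * Dn x - P1 x * Dn' x) / (Dn x * Dn x)"

lemma chi_0 [simp]: "chi 0 = 0"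
  using odd[of 0] periodic[of 0] by simp

lemma chi_add_mult: "chi (f * k + m) = chi m"
proof (induction k)
  case (Suc k)
  have "f * Suc k + m = (f * k + m) + f" by simp
  then show ?case using Suc.IH periodic by metis
qed simp

lemma sum_chi: "(\<Sum>m<f. chi m) = 0"
  using gauss[of 0] by (simp flip: of_int_sum)

lemma psum_last: "psum (f - 1) = 0"
proof -
  have "{..f - 1} = {..<f}" using f_gt_1 by auto
  then have "psum (f - 1) = of_int (\<Sum>m<f. chi m)" by (simp add: psum_def)
  then show ?thesis by (simp add: sum_chi)
qed

lemma Dn_pos: "x \<ge> 0 \<Longrightarrow> Dn x \<ge> 1"
proof -
  assume x: "x \<ge> 0"
  have "{..<f} = insert 0 {1..<f}" using f_gt_1 by auto
  then have "Dn x = 1 + (\<Sum>m\<in>{1..<f}. x ^ m)" by (simp add: Dn_def)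
  then show ?thesis using x by (simp add: sum_nonneg)
qed

lemma P1_mult: "(1 - x) * P1 x = (\<Sum>m<f. of_int (chi m) * x ^ m)"
proof -
  have "(\<Sum>m<n. of_int (chi m) * x ^ m) = (1 - x) * (\<Sum>m<n. psum m * x ^ m) + (if n = 0 then 0 else psum (n - 1) * x ^ n)" for n
  proof (induction n)
    case (Suc n)
    have "psum n = (if n = 0 then 0 else psum (n - 1)) + of_int (chi n)"
      by (cases n) (simp_all add: psum_def)
    then have c: "of_int (chi n) = psum n - (if n = 0 then 0 else psum (n - 1))" by simp
    show ?case using Suc.IH by (simp add: c algebra_simps)
  qed simp
  from this[of f] show ?thesis using psum_last f_gt_1 by (simp add: P1_def)
qed

lemma Dn_mult: "(1 - x) * Dn x = 1 - x ^ f"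
  unfolding Dn_def by (simp add: one_diff_power_eq)

lemma R_eq: "0 < x \<Longrightarrow> x < 1 \<Longrightarrow> R x = (\<Sum>m<f. of_int (chi m) * x ^ m) / (1 - x ^ f)"
  unfolding P1_mult[symmetric] Dn_mult[symmetric] R_def by simp

lemma exp_profile_R: obtains C where "exp_profile R R' C"
proof -
  have dP: "(P1 has_real_derivative P1' x) (at x)" and dD: "(Dn has_real_derivative Dn' x) (at x)" for x
    unfolding P1_def[abs_def] P1'_def Dn_def[abs_def] Dn'_def
    by (auto intro!: derivative_eq_intros sum.cong simp: mult_ac)
  have cont: "continuous_on {0..1} R'"
  proof -
    have "continuous_on {0..1} P1" "continuous_on {0..1} Dn"
      by (rule DERIV_continuous_on, rule has_field_derivative_at_within, rule dP dD)+
    moreover have "continuous_on {0..1} P1'" "continuous_on {0..1} Dn'"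
      unfolding P1'_def[abs_def] Dn'_def[abs_def] by (intro continuous_intros)+
    moreover have "Dn x * Dn x \<noteq> 0" if "x \<in> {0..1}" for x using Dn_pos[of x] that by simp
    ultimately show ?thesis unfolding R'_def[abs_def] by (intro continuous_intros) auto
  qed
  have "bounded (R' ` {0..1})"
    by (rule compact_imp_bounded[OF compact_continuous_image[OF cont]]) simp
  then obtain C where "\<forall>y\<in>R' ` {0..1}. norm y \<le> C" by (auto simp: bounded_iff)
  then have C: "\<And>x. x \<in> {0..1} \<Longrightarrow> norm (R' x) \<le> C" by blast
  have "exp_profile R R' C"
  proof
    have "P1 0 = 0"
    proof -
      have "P1 0 = (\<Sum>m<f. if m = 0 then psum 0 else 0)"
        unfolding P1_def by (rule sum.cong) auto
      then show ?thesis by (simp add: psum_def)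
    qed
    then show "R 0 = 0" by (simp add: R_def)
    fix x :: real assume x: "0 \<le> x" "x \<le> 1"
    show "(R has_real_derivative R' x) (at x)"
      unfolding R_def[abs_def] R'_def using Dn_pos[OF x(1)] by (intro DERIV_divide dP dD) auto
    show "\<bar>R' x\<bar> \<le> C" using C[of x] x by simp
  qed
  then show thesis by (rule that)
qed

lemma R_1: "R 1 = - (\<Sum>m<f. of_int (chi m) * real m) / real f"
proof -
  have "(\<Sum>m<n. psum m) = real n * (\<Sum>m<n. of_int (chi m)) - (\<Sum>m<n. of_int (chi m) * real m)" for n
    by (induction n) (simp_all add: psum_def lessThan_Suc_atMost[symmetric] algebra_simps)
  then have "P1 1 = real f * of_int (\<Sum>m<f. chi m) - (\<Sum>m<f. of_int (chi m) * real m)"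
    by (simp add: P1_def)
  then show ?thesis by (simp add: R_def Dn_def sum_chi)
qed

lemma sum_blocks:
  fixes g :: "nat \<Rightarrow> 'a :: comm_monoid_add"
  shows "(\<Sum>j<f * N. g j) = (\<Sum>k<N. \<Sum>m<f. g (f * k + m))"
proof (induction N)
  case (Suc N)
  have "(\<Sum>j<f * Suc N. g j) = (\<Sum>j<f * N. g j) + (\<Sum>j\<in>{f * N..<f * N + f}. g j)"
    by (subst sum.union_disjoint[symmetric]) (auto intro!: sum.cong)
  also have "(\<Sum>j\<in>{f * N..<f * N + f}. g j) = (\<Sum>m<f. g (f * N + m))"
    by (rule sum.reindex_bij_witness[of _ "\<lambda>m. f * N + m" "\<lambda>j. j - f * N"]) auto
  finally show ?case using Suc.IH by simp
qed simp

lemma sum_chi_blocks: "(\<Sum>j<f * N. chi j) = 0"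
  unfolding sum_blocks chi_add_mult by (simp add: sum_chi)

text \<open>Full periods form a geometric progression in x^f. The remainder is exact, and this is
  what allows \<open>gamma_sum\<close> to compare \<open>K\<close> with finitely many exponential
  integrals.\<close>

lemma R_partial:
  assumes x: "0 < x" "x < 1"
  shows "(\<Sum>j<f * N. of_int (chi j) * x ^ j) = R x * (1 - x ^ (f * N))"
proof -
  have xf: "x ^ f < 1" using x f_gt_1 by (simp add: power_less_one_iff)
  have "(\<Sum>j<f * N. of_int (chi j) * x ^ j) = (\<Sum>k<N. (x ^ f) ^ k * (\<Sum>m<f. of_int (chi m) * x ^ m))"
    unfolding sum_blocks chi_add_mult power_add power_mult by (simp add: sum_distrib_left mult_ac)
  also have "\<dots> = (\<Sum>k<N. (x ^ f) ^ k) * (\<Sum>m<f. of_int (chi m) * x ^ m)"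
    by (simp add: sum_distrib_right)
  also have "(\<Sum>k<N. (x ^ f) ^ k) = (1 - x ^ (f * N)) / (1 - x ^ f)"
    using xf by (simp add: sum_gp_strict power_mult)
  finally show ?thesis using R_eq[OF x] by simp
qed

lemma R_series:
  assumes x: "0 < x" "x < 1"
  shows "(\<lambda>j. of_int (chi j) * x ^ j) sums R x"
proof -
  have "summable (\<lambda>j. of_int (chi j) * x ^ j)"
  proof (rule summable_comparison_test'[where N = 0])
    show "summable (\<lambda>j. x ^ j)" using x by (intro summable_geometric) auto
    fix n :: nat
    have "real_of_int \<bar>chi n\<bar> * x ^ n \<le> 1 * x ^ n"
      using bounded[of n] x by (intro mult_right_mono) (auto simp del: of_int_abs)
    then show "norm (of_int (chi n) * x ^ n) \<le> x ^ n" using x by (simp add: abs_mult)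
  qed
  then have s: "(\<lambda>j. of_int (chi j) * x ^ j) sums suminf (\<lambda>j. of_int (chi j) * x ^ j)"
    by (rule summable_sums)
  then have "(\<lambda>N. \<Sum>j<f * N. of_int (chi j) * x ^ j) \<longlonglongrightarrow> suminf (\<lambda>j. of_int (chi j) * x ^ j)"
    unfolding sums_def using f_gt_1
    by (intro LIMSEQ_subseq_LIMSEQ[of _ _ "\<lambda>N. f * N", unfolded o_def]) (auto simp: strict_mono_def)
  moreover have "(\<lambda>N. R x * (1 - x ^ (f * N))) \<longlonglongrightarrow> R x * (1 - 0)"
  proof (intro tendsto_intros)
    have "(\<lambda>N. (x ^ f) ^ N) \<longlonglongrightarrow> 0" using x f_gt_1 by (intro LIMSEQ_realpow_zero) (auto simp: power_less_one_iff)
    then show "(\<lambda>N. x ^ (f * N)) \<longlonglongrightarrow> 0" by (simp add: power_mult)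
  qed
  ultimately have "suminf (\<lambda>j. of_int (chi j) * x ^ j) = R x"
    unfolding R_partial[OF x] using LIMSEQ_unique by fastforce
  then show ?thesis using s by simp
qed

end

lemma sum_from_1:
  fixes g :: "nat \<Rightarrow> 'a :: comm_monoid_add"
  assumes "g 0 = 0" "n > 0"
  shows "(\<Sum>m<n. g m) = (\<Sum>m\<in>{1..<n}. g m)"
proof -
  have "{..<n} = insert 0 {1..<n}" using assms(2) by auto
  then show ?thesis using assms(1) by simp
qed

context odd_character
begin

text \<open>This sum is evaluated in two ways: by powers of exp (- 2 \<pi> w / f), where the Gauss
  sum produces \<open>R\<close>, and by partial fractions, where the weights of the integers
  appear.\<close>

definition cot_sum :: "real \<Rightarrow> complex" where
  "cot_sum w = (\<Sum>m\<in>{1..<f}. of_int (chi m) * cot (of_real pi * ((of_nat m + \<i> * of_real w) / of_nat f)))"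

lemma sum_from_1_f:
  fixes g :: "nat \<Rightarrow> 'a :: comm_monoid_add"
  shows "g 0 = 0 \<Longrightarrow> (\<Sum>m<f. g m) = (\<Sum>m\<in>{1..<f}. g m)"
  using sum_from_1[of g f] f_gt_1 by simp

lemma not_Ints_residue:
  assumes m: "m \<in> {1..<f}"
  shows "(of_nat m + \<i> * of_real w) / of_nat f \<notin> (\<int> :: complex set)"
proof
  assume "(of_nat m + \<i> * of_real w) / of_nat f \<in> (\<int> :: complex set)"
  then obtain n where "(of_nat m + \<i> * of_real w) / of_nat f = (of_int n :: complex)" by (auto elim: Ints_cases)
  then have "of_nat m + \<i> * of_real w = (of_int n * of_nat f :: complex)"
    using f_gt_1 by (simp add: field_simps)
  then have "Re (of_nat m + \<i> * of_real w) = Re (of_int n * of_nat f :: complex)" by simp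
  then have "real m = of_int n * real f" by simp
  then have "int m = n * int f" by (metis of_int_eq_iff of_int_mult of_int_of_nat_eq)
  then have "int f dvd int m" by simp
  then have "f dvd m" by (simp only: int_dvd_int_iff)
  then show False using m by (auto dest: dvd_imp_le)
qed

text \<open>Each cotangent is - i - 2 i times a geometric series in \<open>y m\<close>, a root of
  unity times \<open>x\<close>. Against \<open>chi\<close> the constants cancel, and the j-th powers
  give i Gs chi(j) x^j, whose sum is i Gs R(x).\<close>

lemma cot_sum_pos:
  assumes w: "w > 0"
  shows "cot_sum w = of_real (2 * Gs * R (exp (- 2 * pi * w / real f)))"
proof -
  define x where "x = exp (- 2 * pi * w / real f)"
  have x: "0 < x" "x < 1" using w f_gt_1 by (auto simp: x_def)
  define y where "y = (\<lambda>m :: nat. exp (2 * \<i> * (of_real pi * ((of_nat m + \<i> * of_real w) / of_nat f))))"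
  have ypow: "y m ^ j = exp (2 * of_real pi * \<i> * of_nat m * of_nat j / of_nat f) * of_real (x ^ j)" for m j
  proof -
    have "y m ^ j = exp (of_nat j * (2 * \<i> * (of_real pi * ((of_nat m + \<i> * of_real w) / of_nat f))))"
      unfolding y_def by (rule exp_of_nat_mult[symmetric])
    also have "of_nat j * (2 * \<i> * (of_real pi * ((of_nat m + \<i> * of_real w) / of_nat f))) =
        2 * of_real pi * \<i> * of_nat m * of_nat j / of_nat f + of_real (real j * (- 2 * pi * w / real f))"
      using f_gt_1 by (simp add: field_simps)
    also have "exp \<dots> = exp (2 * of_real pi * \<i> * of_nat m * of_nat j / of_nat f) * of_real (exp (real j * (- 2 * pi * w / real f)))"
      by (simp only: exp_add exp_of_real)
    also have "exp (real j * (- 2 * pi * w / real f)) = x ^ j"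
      unfolding x_def by (rule exp_of_nat_mult)
    finally show ?thesis .
  qed
  have ny: "norm (y m) < 1" for m
  proof -
    have "norm (exp (2 * of_real pi * \<i> * of_nat m * of_nat 1 / of_nat f)) = 1" by simp
    then have "norm (y m) = x" using ypow[of m 1] x by (simp add: norm_mult)
    then show ?thesis using x by simp
  qed
  have y1: "1 - y m \<noteq> 0" for m using ny[of m] by auto
  have cot: "cot (of_real pi * ((of_nat m + \<i> * of_real w) / of_nat f)) = - \<i> - 2 * \<i> * (y m / (1 - y m))"
    if m: "m \<in> {1..<f}" for m
  proof -
    have "cot (of_real pi * ((of_nat m + \<i> * of_real w) / of_nat f)) = \<i> * (y m + 1) / (y m - 1)"
      unfolding y_def by (rule cot_exp[OF sin_pi_nonzero[OF not_Ints_residue[OF m]]])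
    also have "\<dots> = - \<i> - 2 * \<i> * (y m / (1 - y m))"
    proof -
      have "y m - 1 = - (1 - y m)" by simp
      then have "\<i> * (y m + 1) / (y m - 1) = - (\<i> * (y m + 1) / (1 - y m))"
        by (simp only: minus_divide_right[symmetric])
      also have "\<dots> = - \<i> - 2 * \<i> * (y m / (1 - y m))" using y1[of m] by (simp add: field_simps)
      finally show ?thesis .
    qed
    finally show ?thesis .
  qed
  have "(\<lambda>j. \<Sum>m\<in>{1..<f}. of_int (chi m) * y m ^ Suc j) sums (\<Sum>m\<in>{1..<f}. of_int (chi m) * (y m * (1 / (1 - y m))))"
    unfolding power_Suc by (intro sums_sum sums_mult geometric_sums ny)
  moreover have "(\<Sum>m\<in>{1..<f}. of_int (chi m) * y m ^ j) = \<i> * of_real Gs * of_real (of_int (chi j) * x ^ j)" for j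
  proof -
    have "(\<Sum>m\<in>{1..<f}. of_int (chi m) * y m ^ j) = (\<Sum>m<f. of_int (chi m) * y m ^ j)"
      by (rule sum_from_1_f[symmetric]) simp
    also have "\<dots> = (\<Sum>m<f. of_int (chi m) * exp (2 * of_real pi * \<i> * of_nat m * of_nat j / of_nat f)) * of_real (x ^ j)"
      unfolding ypow sum_distrib_right by (simp only: mult.assoc)
    finally show ?thesis unfolding gauss by simp
  qed
  moreover have "(\<lambda>j. \<i> * of_real Gs * of_real (of_int (chi (Suc j)) * x ^ Suc j)) sums (\<i> * of_real Gs * of_real (R x))"
  proof (intro sums_mult sums_of_real)
    show "(\<lambda>j. of_int (chi (Suc j)) * x ^ Suc j) sums R x"
      using R_series[OF x] sums_Suc_iff[of "\<lambda>j. of_int (chi j) * x ^ j" "R x"] by (simp del: power_Suc)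
  qed
  ultimately have "(\<Sum>m\<in>{1..<f}. of_int (chi m) * (y m * (1 / (1 - y m)))) = \<i> * of_real Gs * of_real (R x)"
    by (simp only: sums_unique2)
  then have S: "(\<Sum>m\<in>{1..<f}. of_int (chi m) * (y m / (1 - y m))) = \<i> * of_real Gs * of_real (R x)"
    by simp
  have c0: "(\<Sum>m\<in>{1..<f}. of_int (chi m)) = (0 :: complex)"
    using sum_from_1_f[of chi] sum_chi by (simp flip: of_int_sum)
  have "cot_sum w = (\<Sum>m\<in>{1..<f}. of_int (chi m) * (- \<i> - 2 * \<i> * (y m / (1 - y m))))"
    unfolding cot_sum_def by (intro sum.cong refl) (simp only: cot)
  also have "\<dots> = - \<i> * (\<Sum>m\<in>{1..<f}. of_int (chi m)) - 2 * \<i> * (\<Sum>m\<in>{1..<f}. of_int (chi m) * (y m / (1 - y m)))"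
    unfolding sum_distrib_left sum_subtractf[symmetric] by (intro sum.cong refl) (simp only: right_diff_distrib mult_ac)
  also have "\<dots> = of_real (2 * Gs * R x)" unfolding S c0 by simp
  finally show ?thesis by (simp add: x_def)
qed

text \<open>At w = 0 the numbers \<open>y m\<close> lie on the unit circle, outside the reach of the
  geometric series. The formula extends there because both sides are continuous from the
  right.\<close>

lemma cot_sum_0: "cot_sum 0 = of_real (2 * Gs * R 1)"
proof -
  obtain C where "exp_profile R R' C" by (rule exp_profile_R)
  then interpret pr: exp_profile R R' C .
  have "(cot_sum \<longlongrightarrow> cot_sum 0) (at_right 0)"
    unfolding cot_sum_def
  proof (intro tendsto_sum tendsto_mult tendsto_const)
    fix m assume m: "m \<in> {1..<f}"
    have "((\<lambda>w. of_real pi * ((of_nat m + \<i> * of_real w) / of_nat f)) \<longlongrightarrow>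
        of_real pi * ((of_nat m + \<i> * complex_of_real 0) / of_nat f)) (at_right 0)"
      using f_gt_1 by (intro tendsto_intros) auto
    then show "((\<lambda>w. cot (of_real pi * ((of_nat m + \<i> * of_real w) / of_nat f))) \<longlongrightarrow>
        cot (of_real pi * ((of_nat m + \<i> * complex_of_real 0) / of_nat f))) (at_right 0)"
      unfolding cot_def
      by (intro tendsto_divide tendsto_sin tendsto_cos sin_pi_nonzero[OF not_Ints_residue[OF m]])
  qed
  moreover have "((\<lambda>w. complex_of_real (2 * Gs * R (exp (- 2 * pi * w / real f)))) \<longlongrightarrow> of_real (2 * Gs * R 1)) (at_right 0)"
  proof (intro tendsto_intros isCont_tendsto_compose[of _ R])
    show "isCont R 1" by (rule DERIV_isCont[OF pr.R_deriv]) auto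
    have "((\<lambda>w. exp (- 2 * pi * w / real f)) \<longlongrightarrow> exp (- 2 * pi * 0 / real f)) (at_right 0)"
      using f_gt_1 by (intro tendsto_intros) auto
    then show "((\<lambda>w. exp (- 2 * pi * w / real f)) \<longlongrightarrow> 1) (at_right 0)" by simp
  qed
  then have "(cot_sum \<longlongrightarrow> of_real (2 * Gs * R 1)) (at_right 0)"
    by (rule Lim_transform_eventually) (auto intro: eventually_mono[OF eventually_at_right_less[of 0]] simp: cot_sum_pos)
  ultimately show ?thesis by (rule tendsto_unique[rotated]) simp
qed

text \<open>In the terms belonging to negative integers \<open>m\<close> is replaced by
  \<open>f - m\<close>. The sign from the oddness of \<open>chi\<close> cancels the sign of the
  denominator, and the conjugate fractions appear.\<close>

lemma cot_sum_partial_fractions: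
  "(\<lambda>k. \<Sum>m\<in>{1..<f}. of_int (chi m) * (1 / (of_nat (f * k + m) + \<i> * of_real w) + 1 / (of_nat (f * k + m) - \<i> * of_real w)))
     sums (of_real (pi / real f) * cot_sum w)"
proof -
  let ?z = "\<lambda>m. (of_nat m + \<i> * of_real w) / (of_nat f :: complex)"
  have f0: "(of_nat f :: complex) \<noteq> 0" using f_gt_1 by simp
  have "(\<lambda>k. \<Sum>m\<in>{1..<f}. of_int (chi m) / of_nat f * (1 / (?z m + of_nat k) + 1 / (?z m - 1 - of_nat k)))
      sums (\<Sum>m\<in>{1..<f}. of_int (chi m) / of_nat f * (of_real pi * cot (of_real pi * ?z m)))"
    by (intro sums_sum sums_mult cot_partial_fractions not_Ints_residue)
  moreover have "(\<Sum>m\<in>{1..<f}. of_int (chi m) / of_nat f * (of_real pi * cot (of_real pi * ?z m))) =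
      of_real (pi / real f) * cot_sum w"
    unfolding cot_sum_def sum_distrib_left by (intro sum.cong refl) simp
  moreover have "(\<Sum>m\<in>{1..<f}. of_int (chi m) / of_nat f * (1 / (?z m + of_nat k) + 1 / (?z m - 1 - of_nat k))) =
      (\<Sum>m\<in>{1..<f}. of_int (chi m) * (1 / (of_nat (f * k + m) + \<i> * of_real w) + 1 / (of_nat (f * k + m) - \<i> * of_real w)))" for k
  proof -
    have r1: "of_int (chi m) / of_nat f * (1 / (?z m + of_nat k)) = of_int (chi m) * (1 / (of_nat (f * k + m) + \<i> * of_real w))" for m
    proof -
      have "?z m + of_nat k = (of_nat (f * k + m) + \<i> * of_real w) / of_nat f"
        using f0 by (simp add: field_simps)
      then show ?thesis using f0 by simp
    qed
    have r2: "of_int (chi m) / of_nat f * (1 / (?z m - 1 - of_nat k)) = of_int (chi m) * (1 / (of_nat m + \<i> * of_real w - of_nat (f * k + f)))" for m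
    proof -
      have "?z m - 1 - of_nat k = (of_nat m + \<i> * of_real w - of_nat (f * k + f)) / of_nat f"
        using f0 by (simp add: field_simps)
      then show ?thesis using f0 by simp
    qed
    have "(\<Sum>m\<in>{1..<f}. of_int (chi m) * (1 / (of_nat m + \<i> * of_real w - of_nat (f * k + f)))) =
        (\<Sum>m\<in>{1..<f}. of_int (chi (f - m)) * (1 / (of_nat (f - m) + \<i> * of_real w - of_nat (f * k + f))))"
      by (rule sum.reindex_bij_witness[of _ "\<lambda>m. f - m" "\<lambda>m. f - m"]) auto
    also have "\<dots> = (\<Sum>m\<in>{1..<f}. of_int (chi m) * (1 / (of_nat (f * k + m) - \<i> * of_real w)))"
    proof (rule sum.cong[OF refl])
      fix m assume m: "m \<in> {1..<f}"
      have "of_nat (f - m) + \<i> * of_real w - of_nat (f * k + f) = - (of_nat (f * k + m) - \<i> * complex_of_real w)"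
        using m by (simp add: of_nat_diff)
      then show "of_int (chi (f - m)) * (1 / (of_nat (f - m) + \<i> * of_real w - of_nat (f * k + f))) =
          of_int (chi m) * (1 / (of_nat (f * k + m) - \<i> * complex_of_real w))"
        using odd[of m] m by (simp only: minus_divide_right[symmetric]) simp
    qed
    finally show ?thesis unfolding distrib_left sum.distrib r1 r2 by simp
  qed
  ultimately show ?thesis by simp
qed

lemma summable_chi_weight: "summable (\<lambda>d. \<bar>of_int (chi d) * weight w (real d)\<bar>)"
proof (rule summable_comparison_test'[where N = 0])
  show "summable (\<lambda>d. 2 * w\<^sup>2 * inverse (real d ^ 2))"
    by (intro summable_mult inverse_power_summable) simp
  fix d :: nat
  have "real_of_int \<bar>chi d\<bar> * weight w (real d) \<le> 1 * weight w (real d)"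
    using bounded[of d] weight_nonneg[of "real d" w] by (intro mult_right_mono) (auto simp del: of_int_abs)
  then show "norm \<bar>of_int (chi d) * weight w (real d)\<bar> \<le> 2 * w\<^sup>2 * inverse (real d ^ 2)"
    using weight_le_inverse_square[of w d] weight_nonneg[of "real d" w] by (simp add: abs_mult)
qed

text \<open>By \<open>weight_partial_fractions\<close> the series is the difference of the partial
  fraction series of \<open>cot_sum\<close> at 0 and at \<open>w\<close>, taken in blocks of length
  \<open>f\<close>. Absolute convergence identifies the limit along blocks with the sum.\<close>

theorem chi_weight_sums:
  assumes w: "w > 0"
  shows "(\<lambda>d. of_int (chi d) * weight w (real d)) sums
           (2 * pi * Gs / real f * (R 1 - R (exp (- 2 * pi * w / real f))))"
proof -
  let ?h = "\<lambda>d. of_int (chi d) * weight w (real d)" and ?v = "2 * pi * Gs / real f * (R 1 - R (exp (- 2 * pi * w / real f)))"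
  have s: "?h sums suminf ?h" by (rule summable_sums[OF summable_rabs_cancel[OF summable_chi_weight]])
  have "(\<lambda>k. \<Sum>m\<in>{1..<f}. complex_of_real (?h (f * k + m))) sums
      (of_real (pi / real f) * cot_sum 0 - of_real (pi / real f) * cot_sum w)"
  proof -
    have "(\<Sum>m\<in>{1..<f}. complex_of_real (?h (f * k + m))) =
        (\<Sum>m\<in>{1..<f}. of_int (chi m) * (1 / (of_nat (f * k + m) + \<i> * of_real 0) + 1 / (of_nat (f * k + m) - \<i> * of_real 0))) -
        (\<Sum>m\<in>{1..<f}. of_int (chi m) * (1 / (of_nat (f * k + m) + \<i> * of_real w) + 1 / (of_nat (f * k + m) - \<i> * of_real w)))" for k
      unfolding sum_subtractf[symmetric]
    proof (rule sum.cong[OF refl])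
      fix m assume "m \<in> {1..<f}"
      then have "f * k + m > 0" by simp
      then have q: "real (f * k + m) > 0" by (simp only: of_nat_0_less_iff)
      show "complex_of_real (?h (f * k + m)) =
        of_int (chi m) * (1 / (of_nat (f * k + m) + \<i> * of_real 0) + 1 / (of_nat (f * k + m) - \<i> * of_real 0)) -
        of_int (chi m) * (1 / (of_nat (f * k + m) + \<i> * of_real w) + 1 / (of_nat (f * k + m) - \<i> * of_real w))"
        using weight_partial_fractions[OF q, of w]
        by (simp only: chi_add_mult of_real_mult of_real_of_int_eq of_real_of_nat_eq right_diff_distrib)
    qed
    then show ?thesis by (simp only:) (intro sums_diff cot_sum_partial_fractions)
  qed
  also have "of_real (pi / real f) * cot_sum 0 - of_real (pi / real f) * cot_sum w = complex_of_real ?v"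
    unfolding cot_sum_0 cot_sum_pos[OF w] by (simp add: algebra_simps)
  finally have "(\<lambda>k. complex_of_real (\<Sum>m\<in>{1..<f}. ?h (f * k + m))) sums complex_of_real ?v"
    by simp
  then have "(\<lambda>k. \<Sum>m\<in>{1..<f}. ?h (f * k + m)) sums ?v" by (simp only: sums_of_real_iff)
  moreover have "(\<Sum>m\<in>{1..<f}. ?h (f * k + m)) = (\<Sum>m<f. ?h (f * k + m))" for k
    by (rule sum_from_1_f[symmetric]) (simp add: chi_add_mult[of _ 0, simplified])
  ultimately have "(\<lambda>N. \<Sum>k<N. \<Sum>m<f. ?h (f * k + m)) \<longlonglongrightarrow> ?v" by (simp only: sums_def)
  then have "(\<lambda>N. \<Sum>j<f * N. ?h j) \<longlonglongrightarrow> ?v" by (simp only: sum_blocks)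
  moreover have "(\<lambda>N. \<Sum>j<f * N. ?h j) \<longlonglongrightarrow> suminf ?h"
    using s unfolding sums_def using f_gt_1
    by (intro LIMSEQ_subseq_LIMSEQ[of _ _ "\<lambda>N. f * N", unfolded o_def]) (auto simp: strict_mono_def)
  ultimately have "suminf ?h = ?v" using LIMSEQ_unique by blast
  then show ?thesis using s by simp
qed

text \<open>By \<open>R_partial\<close>, \<open>K\<close> is close to \<open>\<Sum>j<f N. \<chi>(j) E(j t) + R 1 E(f N t)\<close> with the exponential
  integral \<open>E\<close>; letting \<open>t \<rightarrow> 0\<close> leaves \<open>\<Sum>j<f N. \<chi>(j) ln j\<close>, which also arises from Gauss' limit for
  \<open>\<Gamma>(m / f)\<close>.\<close>

theorem gamma_sum:
  assumes K: "\<And>t. t > 0 \<Longrightarrow> (K has_real_derivative - (R (exp (- t)) / t)) (at t)"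
    and K_inf: "(K \<longlongrightarrow> 0) at_top" and K_0: "((\<lambda>t. K t + R 1 * ln t) \<longlongrightarrow> K0) (at_right 0)"
  shows "(\<Sum>m\<in>{1..<f}. of_int (chi m) * ln (Gamma (real m / real f))) = K0 + R 1 * (ln (real f) + euler_mascheroni)"
proof -
  obtain C where "exp_profile R R' C" by (rule exp_profile_R)
  then interpret pr: exp_profile R R' C .
  interpret e1: exp_profile "\<lambda>x. x" "\<lambda>_. 1" 1 by unfold_locales auto
  obtain E E0 where E: "\<And>t. t > 0 \<Longrightarrow> (E has_real_derivative - (e1.F t / t)) (at t)"
    "(E \<longlongrightarrow> 0) at_top" "((\<lambda>t. E t + 1 * ln t) \<longlongrightarrow> E0) (at_right 0)"
    using e1.F_antiderivative by blast
  have dE: "(E has_real_derivative - (exp (- t) / t)) (at t)" if "t > 0" for t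
    using E(1)[OF that] by (simp add: e1.F_def)
  have E0: "E0 = - euler_mascheroni"
    using exp_integral_constant[OF dE E(2)] E(3) by simp
  define AN where "AN = (\<lambda>N. - (\<Sum>j\<in>{1..<f * N}. of_int (chi j) * ln (real j)))"
  have sum0: "(\<Sum>j\<in>{1..<f * N}. real_of_int (chi j)) = 0" if "N > 0" for N
    using sum_from_1[of "\<lambda>j. real_of_int (chi j)" "f * N"] that f_gt_1 sum_chi_blocks[of N]
    by (simp flip: of_int_sum)
  have main: "\<bar>K0 - AN N + R 1 * euler_mascheroni + R 1 * ln (real (f * N))\<bar> \<le> C / real (f * N)" if N: "N > 0" for N
  proof -
    let ?M = "real (f * N)"
    have M: "?M > 0" using N f_gt_1 by simp
    \<comment> \<open>In the derivative of \<open>h\<close>, \<open>R_partial\<close> leaves only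
      the factor R(1) - R(exp (- t)) times exp (- M t) / t. This is at most C exp (- M t), so
      \<open>h\<close>, which vanishes at infinity, is at most C / M on the whole half-line.\<close>
    define h where "h = (\<lambda>t. K t - (\<Sum>j\<in>{1..<f * N}. of_int (chi j) * E (real j * t)) - R 1 * E (?M * t))"
    have dEc: "((\<lambda>t. E (c * t)) has_real_derivative - (exp (- (c * t)) / t)) (at t)" if "c > 0" "t > 0" for c t
    proof -
      have "((\<lambda>t. E (c * t)) has_real_derivative - (exp (- (c * t)) / (c * t)) * c) (at t)"
        by (rule DERIV_chain2[OF dE]) (use that in \<open>auto intro!: derivative_eq_intros\<close>)
      then show ?thesis using that by (simp add: field_simps)
    qed
    have dh: "(h has_real_derivative (R 1 - R (exp (- t))) * exp (- (?M * t)) / t) (at t)" if t: "t > 0" for t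
    proof -
      have "(h has_real_derivative - (R (exp (- t)) / t) - (\<Sum>j\<in>{1..<f * N}. of_int (chi j) * - (exp (- (real j * t)) / t))
          - R 1 * - (exp (- (?M * t)) / t)) (at t)"
        unfolding h_def using t M
        by (intro DERIV_diff DERIV_sum DERIV_cmult K dEc) auto
      moreover have "(\<Sum>j\<in>{1..<f * N}. of_int (chi j) * - (exp (- (real j * t)) / t)) =
          - (R (exp (- t)) * (1 - exp (- (?M * t))) / t)"
      proof -
        have pw: "exp (- (real j * t)) = exp (- t) ^ j" for j
          by (metis exp_of_nat_mult mult_minus_right)
        have "(\<Sum>j\<in>{1..<f * N}. of_int (chi j) * exp (- t) ^ j) = (\<Sum>j<f * N. of_int (chi j) * exp (- t) ^ j)"
          using N f_gt_1 by (intro sum_from_1[symmetric]) auto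
        also have "\<dots> = R (exp (- t)) * (1 - exp (- t) ^ (f * N))" using t by (intro R_partial) auto
        finally have "(\<Sum>j\<in>{1..<f * N}. of_int (chi j) * exp (- (real j * t))) = R (exp (- t)) * (1 - exp (- (?M * t)))"
          unfolding pw .
        moreover have "(\<Sum>j\<in>{1..<f * N}. of_int (chi j) * - (exp (- (real j * t)) / t)) =
            - ((\<Sum>j\<in>{1..<f * N}. of_int (chi j) * exp (- (real j * t))) / t)"
          by (simp add: sum_negf sum_divide_distrib)
        ultimately show ?thesis by simp
      qed
      moreover have "- (r / t) - - (r * (1 - x) / t) - R 1 * - (x / t) = (R 1 - r) * x / t" for r x
        using t by (simp add: field_simps)
      ultimately show ?thesis by simp
    qed
    have hle: "\<bar>h t - h s\<bar> \<le> C / ?M" if st: "0 < s" "s \<le> t" for s t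
    proof -
      have "\<bar>h t - h s\<bar> \<le> - (C / ?M * exp (- (?M * t))) - - (C / ?M * exp (- (?M * s)))"
      proof (rule abs_diff_le_by_derivative[OF st(2)])
        fix x assume "s \<le> x"
        then have x: "x > 0" using st by simp
        show "(h has_real_derivative (R 1 - R (exp (- x))) * exp (- (?M * x)) / x) (at x)" by (rule dh[OF x])
        have "((\<lambda>x. - (c * exp (- (a * x)))) has_real_derivative c * a * exp (- (a * x))) (at x)" for a c :: real
          by (auto intro!: derivative_eq_intros)
        from this[of "C / ?M" ?M]
        show "((\<lambda>x. - (C / ?M * exp (- (?M * x)))) has_real_derivative C * exp (- (?M * x))) (at x)"
          using M by (simp del: of_nat_mult)
        have "\<bar>(R 1 - R (exp (- x))) * exp (- (?M * x)) / x\<bar> = \<bar>R 1 - pr.F x\<bar> * exp (- (?M * x)) / x"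
          using x by (simp add: pr.F_def abs_mult abs_divide)
        also have "\<dots> \<le> (C * x) * exp (- (?M * x)) / x"
          using pr.F_near_0[of x] x by (intro divide_right_mono mult_right_mono) auto
        finally show "\<bar>(R 1 - R (exp (- x))) * exp (- (?M * x)) / x\<bar> \<le> C * exp (- (?M * x))"
          using x by simp
      qed
      moreover have "C / ?M * exp (- (?M * t)) \<ge> 0" using pr.C_nonneg M by (simp del: of_nat_mult)
      moreover have "C / ?M * exp (- (?M * s)) \<le> C / ?M * 1"
        using pr.C_nonneg M st by (intro mult_left_mono) (simp_all del: of_nat_mult)
      ultimately show ?thesis by linarith
    qed
    have Ec: "((\<lambda>t. E (c * t)) \<longlongrightarrow> 0) at_top" if "c > 0" for c
      by (rule filterlim_compose[OF E(2)]) (use that in real_asymp)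
    have "(h \<longlongrightarrow> 0 - (\<Sum>j\<in>{1..<f * N}. of_int (chi j) * 0) - R 1 * 0) at_top"
      unfolding h_def using M by (intro tendsto_diff tendsto_sum tendsto_mult tendsto_const K_inf Ec) auto
    then have h_inf: "(h \<longlongrightarrow> 0) at_top" by simp
    have hs: "\<bar>h s\<bar> \<le> C / ?M" if s: "s > 0" for s
    proof (rule tendsto_upperbound)
      show "((\<lambda>t. \<bar>h t - h s\<bar>) \<longlongrightarrow> \<bar>h s\<bar>) at_top"
        using tendsto_rabs[OF tendsto_diff[OF h_inf tendsto_const[of "h s"]]] by simp
      show "\<forall>\<^sub>F t in at_top. \<bar>h t - h s\<bar> \<le> C / ?M"
        by (rule eventually_at_top_linorderI[of s]) (rule hle[OF s])
    qed simp
    have E0c: "((\<lambda>t. E (c * t) + ln (c * t)) \<longlongrightarrow> - euler_mascheroni) (at_right 0)" if "c > 0" for c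
    proof -
      have "filterlim (\<lambda>t. c * t) (at_right 0) (at_right 0)" using that by real_asymp
      from filterlim_compose[OF E(3) this] show ?thesis unfolding E0 by simp
    qed
    \<comment> \<open>The inserted logarithms add up to zero: inside the sum \<open>ln t\<close>
      drops out because \<open>chi\<close> sums to zero, the terms \<open>R 1 * ln t\<close> occur
      with both signs, and the rest is compensated by \<open>AN N\<close> and
      \<open>ln ?M\<close>.\<close>
    have "((\<lambda>t. (K t + R 1 * ln t) - (\<Sum>j\<in>{1..<f * N}. of_int (chi j) * (E (real j * t) + ln (real j * t)))
          + (- AN N) - R 1 * (E (?M * t) + ln (?M * t)) + R 1 * ln ?M) \<longlongrightarrow>
        K0 - (\<Sum>j\<in>{1..<f * N}. of_int (chi j) * - euler_mascheroni) + (- AN N) - R 1 * - euler_mascheroni + R 1 * ln ?M) (at_right 0)"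
      using M by (intro tendsto_add tendsto_diff tendsto_sum tendsto_mult tendsto_const K_0 E0c) auto
    moreover have "(\<Sum>j\<in>{1..<f * N}. of_int (chi j) * - euler_mascheroni) = (0 :: real)"
      using sum0[OF N] by (simp add: sum_negf flip: sum_distrib_right)
    ultimately have lim: "((\<lambda>t. (K t + R 1 * ln t) - (\<Sum>j\<in>{1..<f * N}. of_int (chi j) * (E (real j * t) + ln (real j * t)))
          + (- AN N) - R 1 * (E (?M * t) + ln (?M * t)) + R 1 * ln ?M) \<longlongrightarrow>
        K0 - AN N + R 1 * euler_mascheroni + R 1 * ln ?M) (at_right 0)" by simp
    have "(h \<longlongrightarrow> K0 - AN N + R 1 * euler_mascheroni + R 1 * ln ?M) (at_right 0)"
    proof (rule Lim_transform_eventually[OF lim eventually_mono[OF eventually_at_right_less[of 0]]])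
      fix t :: real assume t: "0 < t"
      have "(\<Sum>j\<in>{1..<f * N}. of_int (chi j) * (E (real j * t) + ln (real j * t))) =
          (\<Sum>j\<in>{1..<f * N}. of_int (chi j) * E (real j * t) + of_int (chi j) * ln (real j) + of_int (chi j) * ln t)"
        using t by (intro sum.cong refl) (simp add: ln_mult algebra_simps)
      also have "\<dots> = (\<Sum>j\<in>{1..<f * N}. of_int (chi j) * E (real j * t)) - AN N"
        using sum0[OF N] by (simp add: sum.distrib AN_def flip: sum_distrib_right)
      finally have S: "(\<Sum>j\<in>{1..<f * N}. of_int (chi j) * (E (real j * t) + ln (real j * t))) =
          (\<Sum>j\<in>{1..<f * N}. of_int (chi j) * E (real j * t)) - AN N" .
      have lnM: "ln (?M * t) = ln ?M + ln t" using t M by (simp add: ln_mult del: of_nat_mult)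
      show "(K t + R 1 * ln t) - (\<Sum>j\<in>{1..<f * N}. of_int (chi j) * (E (real j * t) + ln (real j * t)))
          + (- AN N) - R 1 * (E (?M * t) + ln (?M * t)) + R 1 * ln ?M = h t"
        unfolding S lnM h_def by (simp add: algebra_simps del: of_nat_mult)
    qed
    then have "((\<lambda>t. \<bar>h t\<bar>) \<longlongrightarrow> \<bar>K0 - AN N + R 1 * euler_mascheroni + R 1 * ln ?M\<bar>) (at_right 0)"
      by (rule tendsto_rabs)
    then show ?thesis
    proof (rule tendsto_upperbound)
      show "\<forall>\<^sub>F t in at_right 0. \<bar>h t\<bar> \<le> C / ?M"
        by (rule eventually_mono[OF eventually_at_right_less]) (rule hs)
    qed simp
  qed
  define A where "A = (\<Sum>m\<in>{1..<f}. of_int (chi m) * ln (Gamma (real m / real f)))"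
  have f0: "real f > 0" using f_gt_1 by simp
  have "(\<lambda>n. \<Sum>m\<in>{1..<f}. of_int (chi m) * ln (Gamma_series (real m / real f) n)) \<longlonglongrightarrow> A"
    unfolding A_def
  proof (intro tendsto_sum tendsto_mult tendsto_const tendsto_ln Gamma_series_LIMSEQ)
    fix m assume "m \<in> {1..<f}"
    then have "Gamma (real m / real f) > 0" using f0 by (intro Gamma_real_pos) auto
    then show "Gamma (real m / real f) \<noteq> 0" by simp
  qed
  \<comment> \<open>In the logarithm of Gauss' product everything independent of \<open>m\<close>
    cancels against \<open>chi\<close>. The power of n contributes the sum of chi(m) m / f, which is
    - R(1), and the denominators of all residues together run through the integers below f (n +
    1).\<close>
  moreover have "(\<Sum>m\<in>{1..<f}. of_int (chi m) * ln (Gamma_series (real m / real f) n)) = AN (Suc n) - R 1 * ln (real n)"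
    if n: "n > 0" for n
  proof -
    have c0: "(\<Sum>m\<in>{1..<f}. real_of_int (chi m)) = 0" using sum0[of 1] by simp
    have l: "ln (Gamma_series (real m / real f) n) = (ln (fact n) + real (Suc n) * ln (real f)) + real m * (ln (real n) / real f)
        - (\<Sum>k<Suc n. ln (real (f * k + m)))" if m: "m \<in> {1..<f}" for m
    proof -
      have x0: "real m / real f > 0" using m f0 by simp
      have "ln (Gamma_series (real m / real f) n) = ln (fact n) + real m / real f * ln (real n) - ln (\<Prod>k<Suc n. real m / real f + real k)"
        using n x0 by (simp add: Gamma_series_def ln_div ln_mult pochhammer_prod prod_pos add_pos_nonneg lessThan_Suc_atMost atLeast0AtMost atLeast0LessThan del: prod.lessThan_Suc)
      also have "ln (\<Prod>k<Suc n. real m / real f + real k) = (\<Sum>k<Suc n. ln (real m / real f + real k))"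
        using x0 by (intro ln_prod) (auto intro: add_pos_nonneg)
      also have "\<dots> = (\<Sum>k<Suc n. ln (real (f * k + m)) - ln (real f))"
      proof (intro sum.cong refl)
        fix k
        have e: "real m / real f + real k = real (f * k + m) / real f" using f0 by (simp add: field_simps)
        have "f * k + m > 0" using m by simp
        then have "real (f * k + m) > 0" by (simp only: of_nat_0_less_iff)
        then show "ln (real m / real f + real k) = ln (real (f * k + m)) - ln (real f)"
          unfolding e ln_div using f0 by (simp del: of_nat_mult of_nat_add)
      qed
      finally show ?thesis by (simp add: sum_subtractf)
    qed
    have "(\<Sum>m\<in>{1..<f}. of_int (chi m) * ln (Gamma_series (real m / real f) n)) =
        (\<Sum>m\<in>{1..<f}. of_int (chi m) * (ln (fact n) + real (Suc n) * ln (real f)) + of_int (chi m) * real m * (ln (real n) / real f)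
          - (\<Sum>k<Suc n. of_int (chi m) * ln (real (f * k + m))))"
      by (intro sum.cong refl) (simp only: l right_diff_distrib distrib_left sum_distrib_left mult.assoc)
    also have "\<dots> = (\<Sum>m\<in>{1..<f}. of_int (chi m) * real m) * (ln (real n) / real f)
        - (\<Sum>m\<in>{1..<f}. \<Sum>k<Suc n. of_int (chi m) * ln (real (f * k + m)))"
      using c0 by (simp only: sum.distrib sum_subtractf sum_distrib_right[symmetric] mult_zero_left add_0_left)
    also have "(\<Sum>m\<in>{1..<f}. of_int (chi m) * real m) = - R 1 * real f"
      using R_1 f0 sum_from_1_f[of "\<lambda>m. of_int (chi m) * real m"] by simp
    also have "(\<Sum>m\<in>{1..<f}. \<Sum>k<Suc n. of_int (chi m) * ln (real (f * k + m))) = - AN (Suc n)"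
    proof -
      have "(\<Sum>m\<in>{1..<f}. \<Sum>k<Suc n. of_int (chi m) * ln (real (f * k + m))) =
          (\<Sum>k<Suc n. \<Sum>m<f. of_int (chi (f * k + m)) * ln (real (f * k + m)))"
        by (subst sum.swap) (simp only: chi_add_mult sum_from_1_f[of "\<lambda>m. of_int (chi m) * ln (real (f * _ + m))"] chi_0 of_int_0 mult_zero_left)
      also have "\<dots> = (\<Sum>j<f * Suc n. of_int (chi j) * ln (real j))" by (rule sum_blocks[symmetric])
      also have "\<dots> = - AN (Suc n)" unfolding AN_def using f_gt_1 by (subst sum_from_1) auto
      finally show ?thesis .
    qed
    finally show ?thesis using f0 by simp
  qed
  then have "\<forall>\<^sub>F n in sequentially. (\<Sum>m\<in>{1..<f}. of_int (chi m) * ln (Gamma_series (real m / real f) n)) = AN (Suc n) - R 1 * ln (real n)"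
    by (intro eventually_sequentiallyI[of 1]) auto
  ultimately have Alim: "(\<lambda>n. AN (Suc n) - R 1 * ln (real n)) \<longlonglongrightarrow> A"
    by (rule Lim_transform_eventually)
  have "(\<lambda>n. K0 - AN (Suc n) + R 1 * euler_mascheroni + R 1 * ln (real (f * Suc n))) \<longlonglongrightarrow> 0"
  proof (rule Lim_null_comparison)
    show "\<forall>\<^sub>F n in sequentially. norm (K0 - AN (Suc n) + R 1 * euler_mascheroni + R 1 * ln (real (f * Suc n))) \<le> C / real (f * Suc n)"
      unfolding real_norm_def by (intro always_eventually allI main) simp
    show "(\<lambda>n. C / real (f * Suc n)) \<longlonglongrightarrow> 0" using f0 by (simp only: of_nat_mult) real_asymp
  qed
  from tendsto_add[OF this Alim]
  have "(\<lambda>n. K0 - AN (Suc n) + R 1 * euler_mascheroni + R 1 * ln (real (f * Suc n)) + (AN (Suc n) - R 1 * ln (real n))) \<longlonglongrightarrow> A" by simp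
  moreover have "\<forall>\<^sub>F n in sequentially. K0 - AN (Suc n) + R 1 * euler_mascheroni + R 1 * ln (real (f * Suc n)) + (AN (Suc n) - R 1 * ln (real n))
      = K0 + R 1 * euler_mascheroni + R 1 * ln (real f) + R 1 * (ln (real (Suc n)) - ln (real n))"
  proof (intro always_eventually allI)
    fix n
    have l: "ln (real (f * Suc n)) = ln (real f) + ln (real (Suc n))"
      unfolding of_nat_mult using f0 by (simp add: ln_mult del: of_nat_Suc)
    show "K0 - AN (Suc n) + R 1 * euler_mascheroni + R 1 * ln (real (f * Suc n)) + (AN (Suc n) - R 1 * ln (real n))
      = K0 + R 1 * euler_mascheroni + R 1 * ln (real f) + R 1 * (ln (real (Suc n)) - ln (real n))"
      unfolding l by (simp add: distrib_left right_diff_distrib del: of_nat_Suc)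
  qed
  ultimately have "(\<lambda>n. K0 + R 1 * euler_mascheroni + R 1 * ln (real f) + R 1 * (ln (real (Suc n)) - ln (real n))) \<longlonglongrightarrow> A"
    by (rule Lim_transform_eventually)
  moreover have "(\<lambda>n. K0 + R 1 * euler_mascheroni + R 1 * ln (real f) + R 1 * (ln (real (Suc n)) - ln (real n))) \<longlonglongrightarrow>
      K0 + R 1 * euler_mascheroni + R 1 * ln (real f) + R 1 * 0"
  proof (intro tendsto_add tendsto_mult tendsto_const)
    show "(\<lambda>n. ln (real (Suc n)) - ln (real n)) \<longlonglongrightarrow> 0" by real_asymp
  qed
  ultimately have "A = K0 + R 1 * euler_mascheroni + R 1 * ln (real f) + R 1 * 0" by (rule LIMSEQ_unique)
  then show ?thesis by (simp add: A_def algebra_simps)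
qed

end

section \<open>The value at 1 of the quadratic character modulo 37\<close>

lemma sum_by_parts_bound:
  fixes b v :: "nat \<Rightarrow> real"
  assumes B: "\<And>n. \<bar>\<Sum>k<n. b k\<bar> \<le> M"
    and dec: "\<And>k. v (Suc k) \<le> v k" and nonneg: "\<And>k. v k \<ge> 0"
  shows "m \<le> n \<Longrightarrow> \<bar>\<Sum>k\<in>{m..<n}. b k * v k\<bar> \<le> 2 * M * v m"
proof -
  assume mn: "m \<le> n"
  define s where "s = (\<lambda>n. \<Sum>k<n. b k)"
  have M0: "M \<ge> 0" using B[of 0] by simp
  have id: "(\<Sum>k\<in>{m..<n}. b k * v k) = s n * v n - s m * v m + (\<Sum>k\<in>{m..<n}. s (Suc k) * (v k - v (Suc k)))"
    using mn
  proof (induction n rule: dec_induct)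
    case (step n)
    then show ?case by (simp add: s_def algebra_simps)
  qed simp
  have tel: "(\<Sum>k\<in>{m..<n}. v k - v (Suc k)) = v m - v n"
    using mn by (induction n rule: dec_induct) auto
  have "\<bar>\<Sum>k\<in>{m..<n}. s (Suc k) * (v k - v (Suc k))\<bar> \<le> (\<Sum>k\<in>{m..<n}. \<bar>s (Suc k) * (v k - v (Suc k))\<bar>)"
    by (rule sum_abs)
  also have "\<dots> \<le> (\<Sum>k\<in>{m..<n}. M * (v k - v (Suc k)))"
  proof (rule sum_mono)
    fix k
    have "\<bar>s (Suc k)\<bar> * (v k - v (Suc k)) \<le> M * (v k - v (Suc k))"
      unfolding s_def using dec[of k] by (intro mult_right_mono B) simp
    then show "\<bar>s (Suc k) * (v k - v (Suc k))\<bar> \<le> M * (v k - v (Suc k))"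
      using dec[of k] by (simp add: abs_mult)
  qed
  also have "\<dots> = M * (v m - v n)" by (simp add: tel flip: sum_distrib_left)
  finally have 1: "\<bar>\<Sum>k\<in>{m..<n}. s (Suc k) * (v k - v (Suc k))\<bar> \<le> M * (v m - v n)" .
  have 2: "\<bar>s k * v k\<bar> \<le> M * v k" for k
    using B[of k] nonneg[of k] by (simp add: s_def abs_mult mult_right_mono)
  have "M * (v m - v n) = M * v m - M * v n" by (rule right_diff_distrib)
  then show ?thesis unfolding id using 1 2[of n] 2[of m] unfolding abs_le_iff by linarith
qed

text \<open>The limiting series is in general only conditionally convergent, so domination is no
  help. Summation by parts bounds the tails uniformly in the parameter. It yields both Abel's limit
  for L(1) and the limit z \<rightarrow> \<infinity> of the difference of the two forms.\<close>

lemma tendsto_sum_bounded_partials: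
  fixes b c :: "nat \<Rightarrow> real" and v :: "nat \<Rightarrow> 'a \<Rightarrow> real"
  assumes B: "\<And>n. \<bar>\<Sum>k<n. b k\<bar> \<le> M"
    and v: "\<And>p k. p \<in> P \<Longrightarrow> v (Suc k) p \<le> v k p" "\<And>p k. p \<in> P \<Longrightarrow> v k p \<ge> 0"
      "\<And>p k. p \<in> P \<Longrightarrow> v k p \<le> C / real (Suc k)"
    and ev: "eventually (\<lambda>p. p \<in> P) F" and F: "F \<noteq> bot"
    and lim: "\<And>k. (v k \<longlongrightarrow> c k) F"
  shows "((\<lambda>p. \<Sum>k. b k * v k p) \<longlongrightarrow> (\<Sum>k. b k * c k)) F"
proof -
  have c: "c (Suc k) \<le> c k" "c k \<ge> 0" "c k \<le> C / real (Suc k)" for k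
  proof -
    show "c (Suc k) \<le> c k"
      by (rule tendsto_le[OF F lim lim]) (use v(1) ev in \<open>auto elim: eventually_mono\<close>)
    show "c k \<ge> 0"
      by (rule tendsto_lowerbound[OF lim _ F]) (use v(2) ev in \<open>auto elim: eventually_mono\<close>)
    show "c k \<le> C / real (Suc k)"
      by (rule tendsto_upperbound[OF lim _ F]) (use v(3) ev in \<open>auto elim: eventually_mono\<close>)
  qed
  have M0: "M \<ge> 0" using B[of 0] by simp
  have C0: "C \<ge> 0" using c(2)[of 0] c(3)[of 0] by simp
  have tail: "summable (\<lambda>k. b k * w k) \<and> (\<forall>N. \<bar>(\<Sum>k. b k * w k) - (\<Sum>k<N. b k * w k)\<bar> \<le> 2 * M * C / real (Suc N))"
    if w: "\<And>k. w (Suc k) \<le> w k" "\<And>k. w k \<ge> 0" "\<And>k. w k \<le> C / real (Suc k)" for w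
  proof -
    have bd: "\<bar>\<Sum>k\<in>{m..<n}. b k * w k\<bar> \<le> 2 * M * C / real (Suc m)" if "m \<le> n" for m n
    proof -
      have "\<bar>\<Sum>k\<in>{m..<n}. b k * w k\<bar> \<le> 2 * M * w m" by (rule sum_by_parts_bound[where b = b and v = w, OF B w(1,2) that])
      also have "\<dots> \<le> 2 * M * (C / real (Suc m))" using M0 w(3) by (intro mult_left_mono) auto
      finally show ?thesis by simp
    qed
    have sm: "summable (\<lambda>k. b k * w k)"
    proof (rule summable_Cauchy'[where g = "\<lambda>m. 2 * M * C / real (Suc m)"])
      show "\<forall>\<^sub>F m in sequentially. \<forall>n\<ge>m. norm (\<Sum>k\<in>{m..<n}. b k * w k) \<le> 2 * M * C / real (Suc m)"
        using bd by (intro always_eventually) simp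
      show "(\<lambda>m. 2 * M * C / real (Suc m)) \<longlonglongrightarrow> 0" by real_asymp
    qed
    moreover have "\<bar>(\<Sum>k. b k * w k) - (\<Sum>k<N. b k * w k)\<bar> \<le> 2 * M * C / real (Suc N)" for N
    proof (rule LIMSEQ_le_const2)
      show "(\<lambda>n. \<bar>(\<Sum>k<n. b k * w k) - (\<Sum>k<N. b k * w k)\<bar>) \<longlonglongrightarrow> \<bar>(\<Sum>k. b k * w k) - (\<Sum>k<N. b k * w k)\<bar>"
        by (intro tendsto_intros summable_LIMSEQ sm)
      show "\<exists>K. \<forall>n\<ge>K. \<bar>(\<Sum>k<n. b k * w k) - (\<Sum>k<N. b k * w k)\<bar> \<le> 2 * M * C / real (Suc N)"
      proof (intro exI[of _ N] allI impI)
        fix n assume n: "N \<le> n"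
        have "(\<Sum>k<n. b k * w k) = (\<Sum>k<N. b k * w k) + (\<Sum>k\<in>{N..<n}. b k * w k)"
          by (subst ivl_disj_un_one(2)[OF n, symmetric], rule sum.union_disjoint) auto
        then have "(\<Sum>k<n. b k * w k) - (\<Sum>k<N. b k * w k) = (\<Sum>k\<in>{N..<n}. b k * w k)" by simp
        then show "\<bar>(\<Sum>k<n. b k * w k) - (\<Sum>k<N. b k * w k)\<bar> \<le> 2 * M * C / real (Suc N)"
          using bd[OF n] by simp
      qed
    qed
    ultimately show ?thesis by blast
  qed
  show ?thesis
  proof (rule tendstoI)
    fix e :: real assume e: "e > 0"
    have "(\<lambda>N. 2 * M * C / real (Suc N)) \<longlonglongrightarrow> 0" by real_asymp
    then have "\<forall>\<^sub>F N in sequentially. 2 * M * C / real (Suc N) < e / 3"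
      using e by (intro order_tendstoD) auto
    then obtain N where N: "2 * M * C / real (Suc N) < e / 3" by (auto simp: eventually_sequentially)
    have "((\<lambda>p. \<Sum>k<N. b k * v k p) \<longlongrightarrow> (\<Sum>k<N. b k * c k)) F"
      by (intro tendsto_intros lim)
    then have "\<forall>\<^sub>F p in F. dist (\<Sum>k<N. b k * v k p) (\<Sum>k<N. b k * c k) < e / 3"
      using e by (intro tendstoD) auto
    then show "\<forall>\<^sub>F p in F. dist (\<Sum>k. b k * v k p) (\<Sum>k. b k * c k) < e"
      using ev
    proof eventually_elim
      case (elim p)
      have "\<bar>(\<Sum>k. b k * v k p) - (\<Sum>k<N. b k * v k p)\<bar> \<le> 2 * M * C / real (Suc N)"
        using tail[of "\<lambda>k. v k p"] v elim(2) by blast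
      moreover have "\<bar>(\<Sum>k. b k * c k) - (\<Sum>k<N. b k * c k)\<bar> \<le> 2 * M * C / real (Suc N)"
        using tail[of c] c by blast
      ultimately show ?case using elim(1) N unfolding dist_real_def by linarith
    qed
  qed
qed

section \<open>The Gauss sum and cyclotomic products modulo 37\<close>

definition zeta37 :: complex where "zeta37 = exp (2 * of_real pi * \<i> / 37)"

lemma zeta37_pow: "zeta37 ^ n = exp (2 * of_real pi * \<i> * of_nat n / 37)"
  unfolding zeta37_def by (simp add: exp_of_nat_mult[symmetric] field_simps)

lemma zeta37_37: "zeta37 ^ 37 = 1"
proof -
  have "zeta37 ^ 37 = exp (2 * of_real pi * \<i>)" unfolding zeta37_pow by (rule arg_cong[of _ _ exp]) simp
  then show ?thesis by (simp only: exp_two_pi_i)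
qed

lemma zeta37_mod: "zeta37 ^ (n mod 37) = zeta37 ^ n"
proof -
  have "zeta37 ^ n = zeta37 ^ (37 * (n div 37) + n mod 37)" by simp
  also have "\<dots> = zeta37 ^ (n mod 37)" by (simp only: power_add power_mult zeta37_37 power_one mult_1)
  finally show ?thesis ..
qed

lemma zeta37_neq_1: "0 < n \<Longrightarrow> n < 37 \<Longrightarrow> zeta37 ^ n \<noteq> 1"
proof
  assume n: "0 < n" "n < 37" and "zeta37 ^ n = 1"
  then have "exp (2 * of_real pi * \<i> * of_nat n / 37) = 1" by (simp add: zeta37_pow)
  then obtain k :: int where "Im (2 * of_real pi * \<i> * of_nat n / 37) = of_int (2 * k) * pi"
    by (auto simp: exp_eq_1)
  then have "real n = 37 * of_int k" by simp
  then have "int n = 37 * k" by linarith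
  then show False using n by presburger
qed

text \<open>Lists of length 37 represent the elements of \<open>\<int>[x] / (x\<^bsup>37\<^esup> - 1)\<close>. The products over the quadratic
  residues and nonresidues are evaluated in this ring.\<close>

definition ev37 :: "int list \<Rightarrow> complex" where
  "ev37 v = (\<Sum>k<37. of_int (v ! k) * zeta37 ^ k)"

text \<open>Multiplication by x^a shifts the coefficients cyclically to the right, whereas
  \<open>rotate\<close> shifts to the left; hence the complement \<open>37 - a\<close>.\<close>

lemma ev37_rotate:
  assumes v: "length v = 37" and a: "a \<le> 37"
  shows "ev37 (rotate (37 - a) v) = zeta37 ^ a * ev37 v"
proof -
  have "ev37 (rotate (37 - a) v) = (\<Sum>k<37. of_int (v ! ((37 - a + k) mod 37)) * zeta37 ^ k)"
    unfolding ev37_def using v by (intro sum.cong refl) (simp add: nth_rotate)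
  also have "\<dots> = (\<Sum>k<37. of_int (v ! k) * zeta37 ^ ((a + k) mod 37))"
  proof (rule sum.reindex_bij_witness[of _ "\<lambda>k. (a + k) mod 37" "\<lambda>k. (37 - a + k) mod 37"])
    fix k :: nat assume "k \<in> {..<37}"
    then show "(a + (37 - a + k) mod 37) mod 37 = k"
      using a by (simp add: mod_add_right_eq)
    then show "of_int (v ! ((37 - a + k) mod 37)) * zeta37 ^ ((a + (37 - a + k) mod 37) mod 37) =
        of_int (v ! ((37 - a + k) mod 37)) * zeta37 ^ k" by simp
    show "(37 - a + (a + k) mod 37) mod 37 = k" if "k \<in> {..<37}" for k
    proof -
      have "(37 - a + (a + k) mod 37) mod 37 = (37 - a + (a + k)) mod 37" by (rule mod_add_right_eq)
      also have "37 - a + (a + k) = 37 + k" using a by simp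
      finally show ?thesis using that by simp
    qed
  qed auto
  also have "\<dots> = zeta37 ^ a * ev37 v"
    unfolding zeta37_mod ev37_def sum_distrib_left by (intro sum.cong refl) (simp add: power_add)
  finally show ?thesis .
qed

definition axpy :: "int \<Rightarrow> int list \<Rightarrow> int list \<Rightarrow> int list" where
  "axpy c w v = map2 (\<lambda>x y. x + c * y) v w"

lemma ev37_axpy: "length v = 37 \<Longrightarrow> length w = 37 \<Longrightarrow> ev37 (axpy c w v) = ev37 v + of_int c * ev37 w"
  unfolding ev37_def axpy_def sum_distrib_left sum.distrib[symmetric]
  by (intro sum.cong refl) (simp add: algebra_simps)

lemma length_axpy [simp]: "length v = 37 \<Longrightarrow> length w = 37 \<Longrightarrow> length (axpy c w v) = 37"
  by (simp add: axpy_def)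

definition mul_one_minus :: "nat \<Rightarrow> int list \<Rightarrow> int list" where
  "mul_one_minus a v = axpy (-1) (rotate (37 - a) v) v"

lemma ev37_fold_mul:
  "length v = 37 \<Longrightarrow> \<forall>a\<in>set as. a \<le> 37 \<Longrightarrow>
     length (fold mul_one_minus as v) = 37 \<and> ev37 (fold mul_one_minus as v) = (\<Prod>a\<leftarrow>as. 1 - zeta37 ^ a) * ev37 v"
proof (induction as arbitrary: v)
  case (Cons a as)
  have "length (mul_one_minus a v) = 37" "ev37 (mul_one_minus a v) = (1 - zeta37 ^ a) * ev37 v"
    using Cons.prems by (simp_all add: mul_one_minus_def ev37_axpy ev37_rotate algebra_simps)
  then show ?case using Cons.IH[of "mul_one_minus a v"] Cons.prems by (simp add: mult_ac)
qed simp

lemma ev37_fold_axpy: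
  "length v = 37 \<Longrightarrow> length w = 37 \<Longrightarrow> \<forall>a\<in>set as. a \<le> 37 \<Longrightarrow>
     length (fold (\<lambda>a. axpy (c a) (rotate (37 - a) w)) as v) = 37 \<and>
     ev37 (fold (\<lambda>a. axpy (c a) (rotate (37 - a) w)) as v) = ev37 v + (\<Sum>a\<leftarrow>as. of_int (c a) * zeta37 ^ a) * ev37 w"
proof (induction as arbitrary: v)
  case (Cons a as)
  have "length (axpy (c a) (rotate (37 - a) w) v) = 37"
    "ev37 (axpy (c a) (rotate (37 - a) w) v) = ev37 v + of_int (c a) * zeta37 ^ a * ev37 w"
    using Cons.prems by (simp_all add: ev37_axpy ev37_rotate)
  then show ?case using Cons.IH[of "axpy (c a) (rotate (37 - a) w) v"] Cons.prems by (simp add: algebra_simps)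
qed simp

definition qr37 :: "nat list" where "qr37 = [1, 3, 4, 7, 9, 10, 11, 12, 16, 21, 25, 26, 27, 28, 30, 33, 34, 36]"
definition nr37 :: "nat list" where "nr37 = [2, 5, 6, 8, 13, 14, 15, 17, 18, 19, 20, 22, 23, 24, 29, 31, 32, 35]"
text \<open>The values of the quadratic character, as an element of the ring; its evaluation at
  \<open>zeta37\<close> is the Gauss sum.\<close>

definition c37 :: "int list" where
  "c37 = [0,1,-1,1,1,-1,-1,1,-1,1,1,1,1,-1,-1,-1,1,-1,-1,-1,-1,1,-1,-1,-1,1,1,1,1,-1,1,-1,-1,1,1,-1,1]"

text \<open>The list of 36 and entries -1 is 37 minus the sum of all powers, hence 37 at
  \<open>zeta37\<close>. The product is invariant under x \<mapsto> x^r for residues r and vanishes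
  at x = 1, so it must be a combination of that list and \<open>c37\<close>. The coefficient 6, with
  opposite signs for residues and nonresidues, is that of the unit 6 + \<surd>37.\<close>

lemma fold_qr37: "fold mul_one_minus qr37 (1 # replicate 36 0) = axpy (-6) c37 (36 # replicate 36 (-1))"
  by code_simp

lemma fold_nr37: "fold mul_one_minus nr37 (1 # replicate 36 0) = axpy 6 c37 (36 # replicate 36 (-1))"
  by code_simp

lemma fold_c37: "fold (\<lambda>a. axpy (c37 ! a) (rotate (37 - a) c37)) [0..<37] (replicate 37 0) = 36 # replicate 36 (-1)"
  by code_simp

lemma length_c37 [simp]: "length c37 = 37"
  by (simp add: c37_def)

lemma ev37_all: "ev37 (36 # replicate 36 (-1)) = 37"
proof -
  have "(\<Sum>k<37. zeta37 ^ k) = 0"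
    using zeta37_neq_1[of 1] zeta37_37 by (simp add: geometric_sum)
  moreover have "ev37 (36 # replicate 36 (-1)) = (\<Sum>k<37. (if k = 0 then 37 else 0) - zeta37 ^ k)"
    unfolding ev37_def by (intro sum.cong refl) (auto simp: nth_Cons split: nat.splits)
  ultimately show ?thesis by (simp add: sum_subtractf)
qed

lemma ev37_one: "ev37 (1 # replicate 36 0) = 1"
proof -
  have "ev37 (1 # replicate 36 0) = (\<Sum>k<(37::nat). if k = 0 then 1 else 0)"
    unfolding ev37_def by (intro sum.cong refl) (auto simp: nth_Cons split: nat.splits)
  then show ?thesis by simp
qed

lemma gauss37_square: "ev37 c37 * ev37 c37 = 37"
proof -
  have z: "ev37 (replicate 37 0) = 0" unfolding ev37_def by (intro sum.neutral) simp
  have "ev37 (fold (\<lambda>a. axpy (c37 ! a) (rotate (37 - a) c37)) [0..<37] (replicate 37 0)) =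
      (\<Sum>a\<leftarrow>[0..<37]. of_int (c37 ! a) * zeta37 ^ a) * ev37 c37"
    using ev37_fold_axpy[of "replicate 37 0" c37 "[0..<37]" "\<lambda>a. c37 ! a"] z by simp
  moreover have "(\<Sum>a\<leftarrow>[0..<37]. of_int (c37 ! a) * zeta37 ^ a) = ev37 c37"
    unfolding ev37_def by (subst sum_set_upt_conv_sum_list_nat[symmetric]) (simp only: atLeast0LessThan set_upt)
  ultimately show ?thesis unfolding fold_c37 ev37_all by simp
qed

text \<open>The square of the Gauss sum is 37, which leaves two signs; \<open>s\<close> carries the
  choice along.\<close>

lemma gauss37:
  obtains s :: real where "s = 1 \<or> s = -1" "ev37 c37 = of_real (s * sqrt 37)"
proof -
  have "(ev37 c37 - of_real (sqrt 37)) * (ev37 c37 + of_real (sqrt 37)) = ev37 c37 * ev37 c37 - of_real (sqrt 37 * sqrt 37)"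
    by (simp only: of_real_mult) (simp add: algebra_simps)
  also have "\<dots> = 0" unfolding gauss37_square by simp
  finally have "ev37 c37 = of_real (1 * sqrt 37) \<or> ev37 c37 = of_real (-1 * sqrt 37)"
    by (auto simp: eq_neg_iff_add_eq_0)
  then show thesis using that by blast
qed

lemma prod_qr37: "(\<Prod>a\<leftarrow>qr37. 1 - zeta37 ^ a) = 37 - 6 * ev37 c37"
  using ev37_fold_mul[of "1 # replicate 36 0" qr37] ev37_axpy[of "36 # replicate 36 (-1)" c37 "-6"]
  unfolding fold_qr37 ev37_all ev37_one by (simp add: qr37_def)

lemma prod_nr37: "(\<Prod>a\<leftarrow>nr37. 1 - zeta37 ^ a) = 37 + 6 * ev37 c37"
  using ev37_fold_mul[of "1 # replicate 36 0" nr37] ev37_axpy[of "36 # replicate 36 (-1)" c37 6]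
  unfolding fold_nr37 ev37_all ev37_one by (simp add: nr37_def)

lemma chi37_table: "chi37 m = c37 ! (m mod 37)"
proof -
  let ?r = "m mod 37"
  have r: "?r < 37" by simp
  have z: "[int m = 0] (mod 37) \<longleftrightarrow> ?r = 0"
  proof -
    have "int m mod 37 = int ?r" by (simp add: zmod_int)
    then show ?thesis by (simp add: cong_def)
  qed
  have q: "QuadRes 37 (int m) \<longleftrightarrow> int ?r \<in> set (map (\<lambda>y. y * y mod 37) [0..36])"
  proof -
    have "QuadRes 37 (int m) \<longleftrightarrow> (\<exists>y. y * y mod 37 = int ?r)"
      by (simp add: QuadRes_def cong_def zmod_int power2_eq_square)
    also have "\<dots> \<longleftrightarrow> (\<exists>y\<in>{0..36}. y * y mod 37 = int ?r)"
    proof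
      assume "\<exists>y. y * y mod 37 = int ?r"
      then obtain y where "y * y mod 37 = int ?r" by blast
      then have "(y mod 37) * (y mod 37) mod 37 = int ?r" by (simp add: mod_mult_eq)
      moreover have "y mod 37 \<in> {0..36}" by auto
      ultimately show "\<exists>y\<in>{0..36}. y * y mod 37 = int ?r" by blast
    qed auto
    also have "\<dots> \<longleftrightarrow> int ?r \<in> (\<lambda>y. y * y mod 37) ` {0..36}"
      unfolding image_iff by (intro bex_cong refl) (rule eq_commute)
    finally show ?thesis by simp
  qed
  have tab: "\<forall>r\<in>set [0..<37]. c37 ! r = (if r = 0 then 0 else if int r \<in> set (map (\<lambda>y. y * y mod 37) [0..36]) then 1 else -1)"
    by code_simp
  have "?r \<in> set [0..<37]" using r by simp
  from tab[rule_format, OF this] show ?thesis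
    unfolding chi37_def Legendre_def z q by simp
qed

lemma chi37_mod: "chi37 (m mod 37) = chi37 m"
  by (simp add: chi37_table)

lemma chi37_bounded: "\<bar>chi37 m\<bar> \<le> 1" and chi37_square: "\<not> 37 dvd m \<Longrightarrow> chi37 m * chi37 m = 1"
  by (auto simp: chi37_def Legendre_def cong_0_iff) presburger+

lemma sum_chi37: "(\<Sum>k<37. chi37 k) = 0"
proof -
  have "(\<Sum>k<37. chi37 k) = sum_list (map (\<lambda>k. c37 ! k) [0..<37])"
    unfolding sum_set_upt_conv_sum_list_nat[symmetric]
    by (intro sum.cong) (auto simp: chi37_table)
  also have "\<dots> = 0" by code_simp
  finally show ?thesis .
qed

lemma chi37_partial_sums: "\<bar>\<Sum>k<n. chi37 k\<bar> \<le> 37"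
proof -
  have per: "(\<Sum>k<n + 37. chi37 k) = (\<Sum>k<n. chi37 k)" for n
  proof (induction n)
    case (Suc n)
    have c: "chi37 (n + 37) = chi37 n" by (simp add: chi37_table)
    have e: "Suc n + 37 = Suc (n + 37)" by simp
    show ?case unfolding e sum.lessThan_Suc c Suc.IH ..
  qed (simp add: sum_chi37)
  have "(\<Sum>k<37 * q + r. chi37 k) = (\<Sum>k<r. chi37 k)" for q r
  proof (induction q)
    case (Suc q)
    have "37 * Suc q + r = (37 * q + r) + 37" by simp
    then show ?case using Suc.IH per by metis
  qed simp
  from this[of "n div 37" "n mod 37"] have "(\<Sum>k<n. chi37 k) = (\<Sum>k<n mod 37. chi37 k)" by simp
  also have "\<bar>\<dots>\<bar> \<le> (\<Sum>k<n mod 37. \<bar>chi37 k\<bar>)" by (rule sum_abs)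
  also have "\<dots> \<le> (\<Sum>k<n mod 37. 1)" by (intro sum_mono chi37_bounded)
  finally show ?thesis by simp
qed

text \<open>For \<open>j\<close> prime to 37, multiplication by \<open>j\<close> permutes the
  residue classes and \<open>chi37 j\<close> is its own inverse; for multiples of 37 both sides
  vanish.\<close>

lemma gauss37_twist: "(\<Sum>b<37. of_int (chi37 b) * zeta37 ^ (b * j)) = of_int (chi37 j) * ev37 c37"
proof (cases "37 dvd j")
  case True
  then obtain q where q: "j = 37 * q" by blast
  have "zeta37 ^ (b * j) = 1" for b
    unfolding q by (simp add: mult.left_commute[of b] power_mult zeta37_37)
  moreover have "(\<Sum>b<37. of_int (chi37 b)) = (0 :: complex)"
    using sum_chi37 by (simp flip: of_int_sum)
  moreover have "chi37 j = 0" using True by (simp add: chi37_table c37_def)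
  ultimately show ?thesis by simp
next
  case False
  have cop: "coprime j 37"
  proof -
    have "prime (37 :: nat)" by simp
    then show ?thesis using False prime_imp_coprime coprime_commute by blast
  qed
  have inj: "inj_on (\<lambda>b. b * j mod 37) {..<37}"
  proof (rule inj_onI)
    fix a b :: nat assume ab: "a \<in> {..<37}" "b \<in> {..<37}" "a * j mod 37 = b * j mod 37"
    then have "[a * j = b * j] (mod 37)" by (simp add: cong_def)
    then have "[a = b] (mod 37)" using cop cong_mult_rcancel_nat by blast
    then show "a = b" using ab by (simp add: cong_def)
  qed
  have im: "(\<lambda>b. b * j mod 37) ` {..<37} = {..<37}"
    by (rule endo_inj_surj[OF _ _ inj]) auto
  have "ev37 c37 = (\<Sum>k<37. of_int (chi37 k) * zeta37 ^ k)"
    unfolding ev37_def by (intro sum.cong refl) (simp add: chi37_table)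
  also have "\<dots> = (\<Sum>k\<in>(\<lambda>b. b * j mod 37) ` {..<37}. of_int (chi37 k) * zeta37 ^ k)" unfolding im ..
  also have "\<dots> = (\<Sum>b<37. of_int (chi37 (b * j mod 37)) * zeta37 ^ (b * j mod 37))"
    by (subst sum.reindex[OF inj]) simp
  also have "\<dots> = (\<Sum>b<37. of_int (chi37 j) * (of_int (chi37 b) * zeta37 ^ (b * j)))"
    unfolding chi37_mod zeta37_mod chi37_mult by (simp add: mult_ac)
  also have "\<dots> = of_int (chi37 j) * (\<Sum>b<37. of_int (chi37 b) * zeta37 ^ (b * j))"
    by (rule sum_distrib_left[symmetric])
  finally have "of_int (chi37 j) * ev37 c37 = of_int (chi37 j * chi37 j) * (\<Sum>b<37. of_int (chi37 b) * zeta37 ^ (b * j))"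
    by simp
  then show ?thesis using chi37_square[OF False] by simp
qed

definition L37 :: real where "L37 = (\<Sum>k. of_int (chi37 (Suc k)) * (1 / real (Suc k)))"

lemma chi37_Suc_partial_sums: "\<bar>\<Sum>k<n. real_of_int (chi37 (Suc k))\<bar> \<le> 37"
proof -
  have "(\<Sum>k<Suc n. chi37 k) = chi37 0 + (\<Sum>k<n. chi37 (Suc k))" by (rule sum.lessThan_Suc_shift)
  moreover have "chi37 0 = 0" by (simp add: chi37_table c37_def)
  ultimately have "(\<Sum>k<n. real_of_int (chi37 (Suc k))) = of_int (\<Sum>k<Suc n. chi37 k)" by simp
  then show ?thesis using chi37_partial_sums[of "Suc n"] by linarith
qed

lemma sum_ln_list:
  assumes "distinct as" "\<And>a. a \<in> set as \<Longrightarrow> g a \<noteq> (0 :: complex)"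
  shows "(\<Sum>a\<in>set as. ln (norm (g a))) = ln (norm (\<Prod>a\<leftarrow>as. g a)) \<and> (\<Prod>a\<leftarrow>as. g a) \<noteq> 0"
  using assms by (induction as) (auto simp: norm_mult ln_mult)

text \<open>Expressing \<open>chi37\<close> by its Gauss sum turns the series into logarithms of |1
  - zeta37^b|, first at r < 1 and then by Abel's limit. Residues and nonresidues contribute the
  products 37 - 6 g and 37 + 6 g. Reversing the sign of \<open>g\<close> exchanges these and also
  flips the factor in front, so the value is the same for both signs.\<close>

lemma L37_eq: "L37 = 2 * ln (6 + sqrt 37) / sqrt 37"
proof -
  obtain s :: real where s: "s = 1 \<or> s = -1" and G: "ev37 c37 = of_real (s * sqrt 37)" by (rule gauss37)
  define g where "g = s * sqrt 37"
  have g0: "g \<noteq> 0" using s by (auto simp: g_def)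
  have eval: "(\<Sum>k. of_int (chi37 (Suc k)) * (r ^ Suc k / real (Suc k))) =
      - (1 / g) * (\<Sum>b<37. of_int (chi37 b) * ln (norm (1 - of_real r * zeta37 ^ b)))"
    if r: "0 < r" "r < 1" for r :: real
  proof -
    have nz: "norm (of_real r * zeta37 ^ b) < 1" for b
      using r by (simp add: norm_mult norm_power zeta37_def)
    have Ln: "(\<lambda>n. (of_real r * zeta37 ^ b) ^ n / of_nat n) sums (- Ln (1 - of_real r * zeta37 ^ b))" for b
    proof -
      have "(\<lambda>n. - ((-1) ^ Suc n / of_nat n * (- (of_real r * zeta37 ^ b)) ^ n)) sums - Ln (1 + - (of_real r * zeta37 ^ b))"
        by (intro sums_minus Ln_series) (use nz[of b] in simp)
      moreover have "- ((-1) ^ Suc n / of_nat n * (- z) ^ n) = z ^ n / (of_nat n :: complex)" for n z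
      proof -
        have "(-1) ^ n * (- z) ^ n = z ^ n" by (simp flip: power_mult_distrib)
        moreover have "- ((-1) ^ Suc n / of_nat n * (- z) ^ n) = ((-1) ^ n * (- z) ^ n) / of_nat n" by simp
        ultimately show ?thesis by (simp only:)
      qed
      ultimately show ?thesis by (simp only: add_uminus_conv_diff)
    qed
    have "(\<lambda>n. 1 / of_real g * (\<Sum>b<37. of_int (chi37 b) * ((of_real r * zeta37 ^ b) ^ n / of_nat n))) sums
        (1 / of_real g * (\<Sum>b<37. of_int (chi37 b) * (- Ln (1 - of_real r * zeta37 ^ b))))"
      by (intro sums_mult sums_sum Ln)
    moreover have "1 / of_real g * (\<Sum>b<37. of_int (chi37 b) * ((of_real r * zeta37 ^ b) ^ n / of_nat n)) =
        complex_of_real (of_int (chi37 n) * (r ^ n / real n))" for n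
    proof -
      have "(\<Sum>b<37. of_int (chi37 b) * ((of_real r * zeta37 ^ b) ^ n / of_nat n)) =
          (\<Sum>b<37. of_int (chi37 b) * zeta37 ^ (b * n)) * (of_real (r ^ n) / of_nat n)"
        unfolding sum_distrib_right by (intro sum.cong refl) (simp add: power_mult_distrib power_mult)
      then show ?thesis unfolding gauss37_twist G g_def[symmetric] using g0 by simp
    qed
    ultimately have "(\<lambda>n. Re (complex_of_real (of_int (chi37 n) * (r ^ n / real n)))) sums
        Re (1 / of_real g * (\<Sum>b<37. of_int (chi37 b) * (- Ln (1 - of_real r * zeta37 ^ b))))"
      by (intro sums_Re) simp
    moreover have "Re (1 / of_real g * (\<Sum>b<37. of_int (chi37 b) * (- Ln (1 - of_real r * zeta37 ^ b)))) =
        - (1 / g) * (\<Sum>b<37. of_int (chi37 b) * ln (norm (1 - of_real r * zeta37 ^ b)))"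
    proof -
      have "1 - of_real r * zeta37 ^ b \<noteq> 0" for b using nz[of b] by auto
      then have "Re (Ln (1 - of_real r * zeta37 ^ b)) = ln (norm (1 - of_real r * zeta37 ^ b))" for b by simp
      then have "Re (\<Sum>b<37. of_int (chi37 b) * (- Ln (1 - of_real r * zeta37 ^ b))) =
          - (\<Sum>b<37. of_int (chi37 b) * ln (norm (1 - of_real r * zeta37 ^ b)))"
        by (simp add: sum_negf)
      moreover have "Re (1 / of_real g * w) = 1 / g * Re w" for w
        by (simp add: Re_divide_of_real)
      ultimately show ?thesis by simp
    qed
    ultimately have "(\<lambda>n. of_int (chi37 n) * (r ^ n / real n)) sums
        (- (1 / g) * (\<Sum>b<37. of_int (chi37 b) * ln (norm (1 - of_real r * zeta37 ^ b))))" by simp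
    then have "(\<lambda>n. of_int (chi37 (Suc n)) * (r ^ Suc n / real (Suc n))) sums
        (- (1 / g) * (\<Sum>b<37. of_int (chi37 b) * ln (norm (1 - of_real r * zeta37 ^ b))))"
      using sums_Suc_iff[of "\<lambda>n. of_int (chi37 n) * (r ^ n / real n)"] by (simp del: power_Suc of_nat_Suc)
    then show ?thesis by (rule sums_unique[symmetric])
  qed
  have A: "((\<lambda>r :: real. \<Sum>k. of_int (chi37 (Suc k)) * (r ^ Suc k / real (Suc k))) \<longlongrightarrow> L37) (at_left 1)"
    unfolding L37_def
  proof (rule tendsto_sum_bounded_partials[OF chi37_Suc_partial_sums, where P = "{0<..<1}" and C = 1])
    fix p :: real and k assume "p \<in> {0<..<1}"
    then have p: "0 < p" "p < 1" by auto
    show "p ^ Suc (Suc k) / real (Suc (Suc k)) \<le> p ^ Suc k / real (Suc k)"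
      using p by (intro frac_le power_decreasing) auto
    show "0 \<le> p ^ Suc k / real (Suc k)" using p by simp
    show "p ^ Suc k / real (Suc k) \<le> 1 / real (Suc k)"
      using p by (intro divide_right_mono power_le_one) auto
  next
    show "\<forall>\<^sub>F p in at_left 1. (p :: real) \<in> {0<..<1}"
      using eventually_at_left_real[of 0 "1 :: real"] by simp
    show "((\<lambda>r :: real. r ^ Suc k / real (Suc k)) \<longlongrightarrow> 1 / real (Suc k)) (at_left 1)" for k
    proof -
      have "((\<lambda>r :: real. r ^ Suc k / real (Suc k)) \<longlongrightarrow> 1 ^ Suc k / real (Suc k)) (at_left 1)"
        by (intro tendsto_intros) simp
      then show ?thesis by simp
    qed
  qed simp
  have B: "((\<lambda>r :: real. - (1 / g) * (\<Sum>b\<in>{1..<37}. of_int (chi37 b) * ln (norm (1 - of_real r * zeta37 ^ b)))) \<longlongrightarrow>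
      - (1 / g) * (\<Sum>b\<in>{1..<37}. of_int (chi37 b) * ln (norm (1 - of_real 1 * zeta37 ^ b)))) (at_left 1)"
  proof (intro tendsto_mult tendsto_const tendsto_sum tendsto_ln tendsto_norm tendsto_diff tendsto_of_real tendsto_ident_at)
    fix b :: nat assume "b \<in> {1..<37}"
    then show "norm (1 - of_real 1 * zeta37 ^ b) \<noteq> 0" using zeta37_neq_1[of b] by auto
  qed
  have ev: "\<forall>\<^sub>F r in at_left 1. - (1 / g) * (\<Sum>b\<in>{1..<37}. of_int (chi37 b) * ln (norm (1 - of_real r * zeta37 ^ b))) =
      (\<Sum>k. of_int (chi37 (Suc k)) * (r ^ Suc k / real (Suc k)))"
  proof (rule eventually_mono[OF eventually_at_left_real[of 0 1]])
    fix r :: real assume "r \<in> {0<..<1}"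
    then have r: "0 < r" "r < 1" by auto
    have "{..<37::nat} = insert 0 {1..<37}" by auto
    then have "(\<Sum>b<37. of_int (chi37 b) * ln (norm (1 - of_real r * zeta37 ^ b))) =
        (\<Sum>b\<in>{1..<37}. of_int (chi37 b) * ln (norm (1 - of_real r * zeta37 ^ b)))"
      by (simp add: chi37_table[of 0] c37_def)
    then show "- (1 / g) * (\<Sum>b\<in>{1..<37}. of_int (chi37 b) * ln (norm (1 - of_real r * zeta37 ^ b))) =
      (\<Sum>k. of_int (chi37 (Suc k)) * (r ^ Suc k / real (Suc k)))" using eval[OF r] by simp
  qed simp
  have L: "L37 = - (1 / g) * (\<Sum>b\<in>{1..<37}. of_int (chi37 b) * ln (norm (1 - zeta37 ^ b)))"
    using tendsto_unique[OF _ A Lim_transform_eventually[OF B ev]] by simp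
  let ?l = "\<lambda>b. ln (norm (1 - zeta37 ^ b))"
  have sets: "set qr37 \<union> set nr37 = {1..<37}" "set qr37 \<inter> set nr37 = {}"
  proof -
    have "set qr37 \<union> set nr37 = set [1..<37]" "set qr37 \<inter> set nr37 = {}" by code_simp+
    then show "set qr37 \<union> set nr37 = {1..<37}" "set qr37 \<inter> set nr37 = {}" by auto
  qed
  have nz: "1 - zeta37 ^ a \<noteq> 0" if "a \<in> {1..<37}" for a
    using zeta37_neq_1[of a] that by auto
  have vals: "\<forall>b\<in>set qr37. c37 ! (b mod 37) = 1" "\<forall>b\<in>set nr37. c37 ! (b mod 37) = -1" by code_simp+
  have "(\<Sum>b\<in>{1..<37}. of_int (chi37 b) * ?l b) = (\<Sum>b\<in>set qr37. of_int (chi37 b) * ?l b) + (\<Sum>b\<in>set nr37. of_int (chi37 b) * ?l b)"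
    unfolding sets(1)[symmetric] by (intro sum.union_disjoint sets(2)) auto
  also have "(\<Sum>b\<in>set qr37. of_int (chi37 b) * ?l b) = (\<Sum>b\<in>set qr37. ?l b)"
    using vals by (intro sum.cong refl) (simp add: chi37_table)
  also have "(\<Sum>b\<in>set nr37. of_int (chi37 b) * ?l b) = - (\<Sum>b\<in>set nr37. ?l b)"
    unfolding sum_negf[symmetric] using vals by (intro sum.cong refl) (simp add: chi37_table)
  also have "(\<Sum>b\<in>set qr37. ?l b) = ln (norm (37 - 6 * ev37 c37))"
  proof -
    have "(\<Sum>b\<in>set qr37. ?l b) = ln (norm (\<Prod>a\<leftarrow>qr37. 1 - zeta37 ^ a)) \<and> (\<Prod>a\<leftarrow>qr37. 1 - zeta37 ^ a) \<noteq> 0"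
    proof (rule sum_ln_list)
      show "distinct qr37" by (simp add: qr37_def)
      fix a assume "a \<in> set qr37"
      then have "a \<in> {1..<37}" unfolding sets(1)[symmetric] by (rule UnI1)
      then show "1 - zeta37 ^ a \<noteq> 0" by (rule nz)
    qed
    then show ?thesis unfolding prod_qr37 by (rule conjunct1)
  qed
  also have "(\<Sum>b\<in>set nr37. ?l b) = ln (norm (37 + 6 * ev37 c37))"
  proof -
    have "(\<Sum>b\<in>set nr37. ?l b) = ln (norm (\<Prod>a\<leftarrow>nr37. 1 - zeta37 ^ a)) \<and> (\<Prod>a\<leftarrow>nr37. 1 - zeta37 ^ a) \<noteq> 0"
    proof (rule sum_ln_list)
      show "distinct nr37" by (simp add: nr37_def)
      fix a assume "a \<in> set nr37"
      then have "a \<in> {1..<37}" unfolding sets(1)[symmetric] by (rule UnI2)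
      then show "1 - zeta37 ^ a \<noteq> 0" by (rule nz)
    qed
    then show ?thesis unfolding prod_nr37 by (rule conjunct1)
  qed
  finally have fin: "(\<Sum>b\<in>{1..<37}. of_int (chi37 b) * ?l b) = ln (norm (37 - 6 * ev37 c37)) + - ln (norm (37 + 6 * ev37 c37))" .
  have S: "(\<Sum>b\<in>{1..<37}. of_int (chi37 b) * ?l b) = ln \<bar>37 - 6 * g\<bar> + - ln \<bar>37 + 6 * g\<bar>"
  proof -
    have "37 - 6 * ev37 c37 = of_real (37 - 6 * g)" "37 + 6 * ev37 c37 = of_real (37 + 6 * g)"
      unfolding G g_def[symmetric] by simp_all
    then have "norm (37 - 6 * ev37 c37) = \<bar>37 - 6 * g\<bar>" "norm (37 + 6 * ev37 c37) = \<bar>37 + 6 * g\<bar>"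
      by (simp_all only: norm_of_real)
    then show ?thesis using fin by simp
  qed
  have sq: "sqrt 37 * sqrt 37 = (37 :: real)" by simp
  have s6: "sqrt 37 > (6 :: real)" by (rule real_less_rsqrt) simp
  \<comment> \<open>The unit 6 + \<surd>37 has norm 36 - 37 = -1, and the quotient of the two
    products is its square.\<close>
  have inv: "sqrt 37 - 6 = 1 / (6 + sqrt 37)" using s6 by (simp add: field_simps)
  have e1: "37 - 6 * sqrt 37 = sqrt 37 * (1 / (6 + sqrt 37))" "37 + 6 * sqrt 37 = sqrt 37 * (6 + sqrt 37)"
    unfolding inv[symmetric] by (simp_all add: algebra_simps)
  have l1: "ln (37 - 6 * sqrt 37) = ln (sqrt 37) - ln (6 + sqrt 37)" "ln (37 + 6 * sqrt 37) = ln (sqrt 37) + ln (6 + sqrt 37)"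
    unfolding e1 using s6 by (simp_all add: ln_mult ln_div)
  have p: "37 - 6 * sqrt 37 > 0" "37 + 6 * sqrt 37 > 0" unfolding e1 using s6 by simp_all
  show ?thesis
  proof (cases "s = 1")
    case True
    then show ?thesis unfolding L S using l1 p by (simp add: g_def)
  next
    case False
    then have "s = -1" using s by simp
    then show ?thesis unfolding L S using l1 p by (simp add: g_def)
  qed
qed

section \<open>The characters modulo 4 and 148\<close>

lemma odd_character_chi4: "odd_character chi4 4 2"
proof
  fix j :: nat
  have i2: "exp (2 * of_real pi * \<i> * of_nat m * of_nat j / of_nat 4) = \<i> ^ (m * j)" for m
  proof -
    have "exp (\<i> * of_real (pi / 2)) = \<i>" by (simp only: cis_conv_exp[symmetric] cis_pi_half)
    then have "\<i> ^ (m * j) = exp (of_nat (m * j) * (\<i> * of_real (pi / 2)))" by (simp only: exp_of_nat_mult)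
    also have "of_nat (m * j) * (\<i> * of_real (pi / 2)) = 2 * of_real pi * \<i> * of_nat m * of_nat j / of_nat 4" by simp
    finally show ?thesis ..
  qed
  have "{..<4::nat} = {0, 1, 2, 3}" by auto
  then have "(\<Sum>m<4. of_int (chi4 m) * exp (2 * of_real pi * \<i> * of_nat m * of_nat j / of_nat 4)) = \<i> ^ j - \<i> ^ (3 * j)"
    unfolding i2 by (simp add: chi4_altdef)
  also have "\<i> ^ (3 * j) = (- \<i>) ^ j" by (simp add: power_mult power3_eq_cube)
  also have "\<i> ^ j - (- \<i>) ^ j = \<i> * complex_of_real 2 * of_int (chi4 j)"
  proof -
    obtain q r where j: "j = 4 * q + r" "r < 4" by (metis mod_less_divisor mult_div_mod_eq zero_less_numeral)
    have "r = 0 \<or> r = 1 \<or> r = 2 \<or> r = 3" using j(2) by linarith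
    moreover have "j mod 4 = r" using j by simp
    moreover have "\<i> ^ j = \<i> ^ r" "(- \<i>) ^ j = (- \<i>) ^ r" using j(1) by (simp_all add: power_add power_mult)
    ultimately show ?thesis by (auto simp: chi4_altdef power2_eq_square power3_eq_cube)
  qed
  finally show "(\<Sum>m<4. of_int (chi4 m) * exp (2 * of_real pi * \<i> * of_nat m * of_nat j / of_nat 4)) =
      \<i> * complex_of_real 2 * of_int (chi4 j)" .
  show "chi4 (4 - m) = - chi4 m" if "m \<le> 4" for m
  proof -
    have "m = 0 \<or> m = 1 \<or> m = 2 \<or> m = 3 \<or> m = 4" using that by linarith
    then show ?thesis by (elim disjE) (simp_all add: chi4_altdef)
  qed
qed (auto simp: chi4_altdef)

text \<open>Writing m = 37 a + 4 b splits the exponential into one of modulus 4 and one of modulus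
  37. Since 37 is 1 modulo 4 and 4 is a square, the character becomes
  \<open>chi4 a * chi37 b\<close>, so that the Gauss sums 2 i and \<open>g\<close> multiply.\<close>

lemma odd_character_chi148:
  assumes G: "ev37 c37 = of_real g"
  shows "odd_character chi148 148 (2 * g)"
proof
  fix j :: nat
  let ?e = "\<lambda>m. exp (2 * of_real pi * \<i> * of_nat m * of_nat j / of_nat 148) :: complex"
  have e_mod: "?e (m mod 148) = ?e m" for m
  proof -
    have one: "exp (2 * of_real pi * \<i>) ^ k = 1" for k by (simp only: exp_two_pi_i power_one)
    have "of_nat m = of_nat (148 * (m div 148) + m mod 148)" by simp
    also have "\<dots> = 148 * of_nat (m div 148) + (of_nat (m mod 148) :: complex)" by (simp only: of_nat_add of_nat_mult of_nat_numeral)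
    finally have m: "(of_nat m :: complex) = 148 * of_nat (m div 148) + of_nat (m mod 148)" .
    have "2 * of_real pi * \<i> * of_nat m * of_nat j / of_nat 148 =
        of_nat (m div 148 * j) * (2 * of_real pi * \<i>) + 2 * of_real pi * \<i> * of_nat (m mod 148) * of_nat j / of_nat 148"
      unfolding m by (simp add: field_simps)
    then show ?thesis by (simp only: exp_add exp_of_nat_mult one mult_1)
  qed
  have chi_mod: "chi148 (m mod 148) = chi148 m" for m
  proof -
    have "m mod 148 mod 4 = m mod 4" "m mod 148 mod 37 = m mod 37" by (simp_all add: mod_mod_cancel)
    then show ?thesis by (simp add: chi148_def chi4_altdef chi37_table)
  qed
  interpret c4: odd_character chi4 4 2 by (rule odd_character_chi4)
  have inj: "inj_on (\<lambda>(a, b). (37 * a + 4 * b) mod 148) ({..<4} \<times> {..<37 :: nat})"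
  proof (rule inj_onI, clarsimp)
    fix a b c d :: nat
    assume ab: "a < 4" "b < 37" "c < 4" "d < 37" "(37 * a + 4 * b) mod 148 = (37 * c + 4 * d) mod 148"
    have m4: "(37 * x + 4 * y) mod 148 mod 4 = x mod 4" for x y :: nat
    proof -
      have "(37 * x + 4 * y) mod 148 mod 4 = (x + 4 * (9 * x + y)) mod 4" by (simp add: mod_mod_cancel)
      then show ?thesis by (simp only: mod_mult_self2)
    qed
    have m37: "(37 * x + 4 * y) mod 148 mod 37 = (4 * y) mod 37" for x y :: nat
    proof -
      have "(37 * x + 4 * y) mod 148 mod 37 = (4 * y + 37 * x) mod 37" by (simp add: mod_mod_cancel add.commute)
      then show ?thesis by (simp only: mod_mult_self2)
    qed
    have "a mod 4 = c mod 4" using ab(5) m4 by metis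
    then have ac: "a = c" using ab by simp
    have "[4 * b = 4 * d] (mod 37)" unfolding cong_def using ab(5) m37 by metis
    moreover have "coprime 4 (37 :: nat)"
    proof -
      have "prime (37 :: nat)" by simp
      moreover have "\<not> 37 dvd (4 :: nat)" by (auto dest: dvd_imp_le)
      ultimately show ?thesis using prime_imp_coprime coprime_commute by blast
    qed
    ultimately have "[b = d] (mod 37)" using cong_mult_lcancel_nat by blast
    then show "a = c \<and> b = d" using ac ab by (simp add: cong_def)
  qed
  have im: "(\<lambda>(a, b). (37 * a + 4 * b) mod 148) ` ({..<4} \<times> {..<37 :: nat}) = {..<148}"
    by (rule card_subset_eq) (auto simp: card_image[OF inj])
  have val: "of_int (chi148 ((37 * a + 4 * b) mod 148)) * ?e ((37 * a + 4 * b) mod 148) =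
      (of_int (chi4 a) * exp (2 * of_real pi * \<i> * of_nat a * of_nat j / of_nat 4)) * (of_int (chi37 b) * zeta37 ^ (b * j))" for a b
  proof -
    have "37 * a + 4 * b = a + 4 * (9 * a + b)" by simp
    then have "(37 * a + 4 * b) mod 4 = a mod 4" by (simp only: mod_mult_self2)
    then have 4: "chi4 (37 * a + 4 * b) = chi4 a" by (simp only: chi4_altdef)
    have "37 * a + 4 * b = 4 * b + 37 * a" by simp
    then have "(37 * a + 4 * b) mod 37 = (4 * b) mod 37" by (simp only: mod_mult_self2)
    then have "chi37 (37 * a + 4 * b) = chi37 (4 * b)" by (simp only: chi37_table)
    also have "\<dots> = chi37 b" unfolding chi37_mult by (simp add: chi37_table[of 4] c37_def)
    finally have "chi148 (37 * a + 4 * b) = chi4 a * chi37 b" using 4 by (simp add: chi148_def)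
    moreover have "?e (37 * a + 4 * b) = exp (2 * of_real pi * \<i> * of_nat a * of_nat j / of_nat 4) * zeta37 ^ (b * j)"
    proof -
      have "2 * of_real pi * \<i> * of_nat (37 * a + 4 * b) * of_nat j / of_nat 148 =
          2 * of_real pi * \<i> * of_nat a * of_nat j / of_nat 4 + 2 * of_real pi * \<i> * of_nat (b * j) / 37"
        by (simp add: field_simps)
      then show ?thesis unfolding zeta37_pow by (simp only: exp_add)
    qed
    ultimately show ?thesis unfolding chi_mod e_mod by simp
  qed
  have "(\<Sum>m<148. of_int (chi148 m) * ?e m) =
      (\<Sum>(a, b)\<in>{..<4} \<times> {..<37}. of_int (chi148 ((37 * a + 4 * b) mod 148)) * ?e ((37 * a + 4 * b) mod 148))"
    unfolding im[symmetric] by (subst sum.reindex[OF inj]) (simp only: o_def case_prod_unfold)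
  also have "\<dots> = (\<Sum>a<4. \<Sum>b<37. (of_int (chi4 a) * exp (2 * of_real pi * \<i> * of_nat a * of_nat j / of_nat 4)) * (of_int (chi37 b) * zeta37 ^ (b * j)))"
    unfolding val by (simp only: sum.cartesian_product)
  also have "\<dots> = (\<Sum>a<4. of_int (chi4 a) * exp (2 * of_real pi * \<i> * of_nat a * of_nat j / of_nat 4)) *
      (\<Sum>b<37. of_int (chi37 b) * zeta37 ^ (b * j))"
    by (simp only: sum_product)
  also have "\<dots> = (\<i> * complex_of_real 2 * of_int (chi4 j)) * (of_int (chi37 j) * of_real g)"
    unfolding c4.gauss gauss37_twist G ..
  also have "\<dots> = \<i> * complex_of_real (2 * g) * of_int (chi148 j)" by (simp add: chi148_def)
  finally show "(\<Sum>m<148. of_int (chi148 m) * ?e m) = \<i> * complex_of_real (2 * g) * of_int (chi148 j)" .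
  show "chi148 (m + 148) = chi148 m" for m using chi_mod[of m] chi_mod[of "m + 148"] by simp
  show "\<bar>chi148 m\<bar> \<le> 1" for m
    using chi37_bounded[of m] by (simp add: chi148_def chi4_def abs_mult)
  show "chi148 (148 - m) = - chi148 m" if m: "m \<le> 148" for m
  proof -
    have add: "((148 - m) mod k + m mod k) mod k = 148 mod k" for k
      using m by (simp add: mod_add_eq)
    have "(148 - m) mod 4 = 0 \<or> (148 - m) mod 4 = 1 \<or> (148 - m) mod 4 = 2 \<or> (148 - m) mod 4 = 3"
      "m mod 4 = 0 \<or> m mod 4 = 1 \<or> m mod 4 = 2 \<or> m mod 4 = 3" by linarith+
    then have 4: "chi4 (148 - m) = - chi4 m"
      using add[of 4] unfolding chi4_altdef by (elim disjE) simp_all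
    define r t where "r = (148 - m) mod 37" and "t = m mod 37"
    have rt: "r < 37" "t < 37" "(r + t) mod 37 = 0" using add[of 37] by (simp_all add: r_def t_def)
    then obtain k where k: "r + t = 37 * k" by (auto simp: mod_eq_0_iff_dvd)
    then have "k = 0 \<or> k = 1" using rt by linarith
    then have "(r = 0 \<and> t = 0) \<or> r = 37 - t" using k by auto
    then have "r = (37 - t) mod 37" using rt(1) by (elim disjE) auto
    moreover have "\<forall>r\<in>set [0..<37]. c37 ! ((37 - r) mod 37) = c37 ! r" by code_simp
    then have "c37 ! ((37 - t) mod 37) = c37 ! t" using rt(2) by simp
    ultimately have "chi37 (148 - m) = chi37 m" by (simp add: chi37_table r_def t_def)
    then show ?thesis using 4 by (simp add: chi148_def)
  qed
qed simp

text \<open>By \<open>R_1\<close> the value -2 * 148 makes \<open>R 1\<close> equal to 2, the class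
  number of discriminant -148.\<close>

lemma sum_chi148: "(\<Sum>m<148. chi148 m * int m) = -296"
proof -
  have "chi148 m = (if m mod 4 = 1 then 1 else if m mod 4 = 3 then -1 else 0) * c37 ! (m mod 37)" for m
    by (simp add: chi148_def chi4_altdef chi37_table)
  then have "(\<Sum>m<148. chi148 m * int m) =
      sum_list (map (\<lambda>m. (if m mod 4 = 1 then 1 else if m mod 4 = 3 then -1 else 0) * c37 ! (m mod 37) * int m) [0..<148])"
    unfolding sum_set_upt_conv_sum_list_nat[symmetric] by (intro sum.cong) auto
  also have "\<dots> = -296" by code_simp
  finally show ?thesis .
qed

section \<open>Comparison of lattice sums and character sums\<close>

lemma has_sum_fibres:
  fixes q :: "'a \<Rightarrow> nat" and w :: "nat \<Rightarrow> real"
  assumes T: "((\<lambda>x. w (q x)) has_sum T) UNIV" and fin: "\<And>n. finite {x. q x = n}"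
  shows "((\<lambda>n. real (card {x. q x = n}) * w n) has_sum T) UNIV"
proof -
  have bij: "bij_betw (\<lambda>x. (q x, x)) UNIV (SIGMA n:UNIV. {x. q x = n})"
    by (auto simp: bij_betw_def inj_on_def)
  have "((\<lambda>p. w (fst p)) has_sum T) (SIGMA n:UNIV. {x. q x = n})"
    using T has_sum_reindex_bij_betw[OF bij, of "\<lambda>p. w (fst p)" T] by simp
  then show ?thesis
  proof (rule has_sum_SigmaD)
    show "((\<lambda>x. w (fst (n, x))) has_sum (real (card {x. q x = n}) * w n)) {x. q x = n}" for n
      using has_sum_finite[OF fin[of n], of "\<lambda>_. w n"] by simp
  qed
qed

lemma has_sum_divisors:
  fixes g :: "nat \<Rightarrow> nat \<Rightarrow> real"
  assumes S: "((\<lambda>(e, d). g d e * w (d * e)) has_sum S) ({0<..} \<times> {0<..})"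
  shows "((\<lambda>n. (\<Sum>d | d dvd n. g d (n div d)) * w n) has_sum S) {0<..}"
proof -
  have bij: "bij_betw (\<lambda>(e, d). (d * e, d)) ({0<..} \<times> {0<..}) (SIGMA n:{0<..}. {d :: nat. d dvd n})"
    by (rule bij_betwI[of _ _ _ "\<lambda>(n, d). (n div d, d)"]) (auto simp: dvd_div_eq_0_iff intro: Nat.gr0I)
  have "((\<lambda>(n, d). g d (n div d) * w n) has_sum S) (SIGMA n:{0<..}. {d. d dvd n})"
  proof (subst has_sum_reindex_bij_betw[OF bij, symmetric], rule has_sum_cong[THEN iffD1, OF _ S])
    fix p :: "nat \<times> nat" assume "p \<in> {0<..} \<times> {0<..}"
    then show "(case p of (e, d) \<Rightarrow> g d e * w (d * e)) =
        (case case p of (e, d) \<Rightarrow> (d * e, d) of (n, d) \<Rightarrow> g d (n div d) * w n)"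
      by (cases p) simp
  qed
  then show ?thesis
  proof (rule has_sum_SigmaD)
    fix n :: nat assume "n \<in> {0<..}"
    then have "finite {d. d dvd n}" by simp
    from has_sum_finite[OF this, of "\<lambda>d. g d (n div d) * w n"]
    show "((\<lambda>d. case (n, d) of (n, d) \<Rightarrow> g d (n div d) * w n) has_sum (\<Sum>d | d dvd n. g d (n div d)) * w n) {d. d dvd n}"
      by (simp add: sum_distrib_right)
  qed
qed

text \<open>Homogeneity of the weight: for a fixed cofactor \<open>e\<close>, the sum over
  \<open>d\<close> is a single character sum with the cut-off \<open>z / e\<close>.\<close>

lemma weight_scale: "e > 0 \<Longrightarrow> weight z (d * e) = weight (z / e) d / e"
proof -
  assume e: "e > 0"
  have "(d * e)\<^sup>2 + z\<^sup>2 = e\<^sup>2 * (d\<^sup>2 + (z / e)\<^sup>2)" using e by (simp add: power2_eq_square field_simps)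
  then have "2 * (d * e) / ((d * e)\<^sup>2 + z\<^sup>2) = 2 * d / (d\<^sup>2 + (z / e)\<^sup>2) / e"
    using e by (simp add: power2_eq_square)
  then show ?thesis using e by (simp add: weight_def diff_divide_distrib)
qed

lemma summable_double_weight:
  fixes g :: "nat \<Rightarrow> nat \<Rightarrow> real"
  assumes "\<And>d e. \<bar>g d e\<bar> \<le> 1"
  shows "(\<lambda>(e, d). g d e * weight z (real (d * e))) summable_on ({0<..} \<times> {0<..})"
proof (rule abs_summable_summable)
  define h where "h = (\<lambda>k :: nat. inverse (real k ^ 2))"
  have sh: "h summable_on {0<..}"
    unfolding h_def by (rule summable_on_subset[OF norm_summable_imp_summable_on[of "\<lambda>k. inverse (real k ^ 2)"]])
      (use inverse_power_summable[of 2, where ?'a = real] in simp_all)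
  have "(\<lambda>(e, d). 2 * z\<^sup>2 * (h e * h d)) summable_on ({0<..} \<times> {0<..})"
  proof (rule summable_on_SigmaI)
    show "((\<lambda>d. case (e, d) of (e, d) \<Rightarrow> 2 * z\<^sup>2 * (h e * h d)) has_sum (2 * z\<^sup>2 * (h e * infsum h {0<..}))) {0<..}" for e
      using sh by (auto intro!: has_sum_cmult_right)
    show "(\<lambda>e. 2 * z\<^sup>2 * (h e * infsum h {0<..})) summable_on {0<..}"
      by (intro summable_on_cmult_right summable_on_cmult_left sh)
  qed (auto simp: h_def)
  then show "(\<lambda>x. norm (case x of (e, d) \<Rightarrow> g d e * weight z (real (d * e)))) summable_on ({0<..} \<times> {0<..})"
  proof (rule summable_on_comparison_test)
    fix x :: "nat \<times> nat"
    obtain e d where x: "x = (e, d)" by (cases x)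
    have "\<bar>g d e\<bar> * weight z (real (d * e)) \<le> 1 * weight z (real (d * e))"
      by (intro mult_right_mono assms weight_nonneg) simp
    also have "\<dots> \<le> 2 * z\<^sup>2 * (h e * h d)"
      using weight_le_inverse_square[of z "d * e"] by (simp add: h_def power_mult_distrib mult_ac)
    finally show "norm (case x of (e, d) \<Rightarrow> g d e * weight z (real (d * e))) \<le> (case x of (e, d) \<Rightarrow> 2 * z\<^sup>2 * (h e * h d))"
      by (simp add: x abs_mult weight_nonneg)
  qed simp
qed

context odd_character
begin

text \<open>The sum over \<open>d\<close> is done in closed form by \<open>chi_weight_sums\<close>,
  which leaves a series over \<open>e\<close>. The coefficients \<open>b\<close> are 1 for the sum
  of the two forms and \<open>chi37\<close> for their difference.\<close>

lemma has_sum_chi_double: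
  fixes b :: "nat \<Rightarrow> int"
  assumes z: "z > 0" and b: "\<And>e. \<bar>b e\<bar> \<le> 1"
  shows "((\<lambda>(e, d). (of_int (b e) * of_int (chi d)) * weight z (real (d * e))) has_sum
     (2 * pi * Gs / real f * (\<Sum>k. of_int (b (Suc k)) * ((R 1 - R (exp (- (2 * pi * z / real f / real (Suc k))))) / real (Suc k)))))
     ({0<..} \<times> {0<..})"
proof -
  let ?t = "\<lambda>e. of_int (b e) * (2 * pi * Gs / real f * ((R 1 - R (exp (- (2 * pi * z / real f / real e)))) / real e))"
  have "(\<lambda>(e, d). (of_int (b e) * of_int (chi d)) * weight z (real (d * e))) summable_on ({0<..} \<times> {0<..})"
  proof (rule summable_double_weight)
    fix d e
    have "real_of_int \<bar>b e * chi d\<bar> \<le> 1" using b[of e] bounded[of d] by (simp add: abs_mult mult_le_one)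
    then show "\<bar>of_int (b e) * of_int (chi d)\<bar> \<le> (1 :: real)" by simp
  qed
  then obtain S where S: "((\<lambda>(e, d). (of_int (b e) * of_int (chi d)) * weight z (real (d * e))) has_sum S) ({0<..} \<times> {0<..})"
    by (auto simp: summable_on_def)
  have "(?t has_sum S) {0<..}"
  proof (rule has_sum_SigmaD[OF S])
    fix e :: nat assume "e \<in> {0<..}"
    then have e: "real e > 0" by simp
    have "((\<lambda>d. of_int (chi d) * weight (z / real e) (real d)) has_sum
        (2 * pi * Gs / real f * (R 1 - R (exp (- 2 * pi * (z / real e) / real f))))) UNIV"
      using z e by (intro norm_summable_imp_has_sum chi_weight_sums) (use summable_chi_weight in simp_all)
    from has_sum_cmult_right[OF this, of "of_int (b e) / real e"]
    have "((\<lambda>d. (of_int (b e) * of_int (chi d)) * weight z (real (d * e))) has_sum ?t e) UNIV"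
      using e by (simp add: weight_scale field_simps)
    moreover have "((\<lambda>d. (of_int (b e) * of_int (chi d)) * weight z (real (d * e))) has_sum ?t e) UNIV \<longleftrightarrow>
        ((\<lambda>d. (of_int (b e) * of_int (chi d)) * weight z (real (d * e))) has_sum ?t e) {0<..}"
      by (rule has_sum_cong_neutral) (auto simp: weight_def)
    ultimately show "((\<lambda>d. case (e, d) of (e, d) \<Rightarrow> (of_int (b e) * of_int (chi d)) * weight z (real (d * e))) has_sum ?t e) {0<..}"
      by simp
  qed
  moreover have "{0<..} = range Suc" by (auto simp: image_iff gr0_conv_Suc)
  ultimately have "((\<lambda>k. ?t (Suc k)) has_sum S) UNIV"
    by (simp add: has_sum_reindex o_def)
  then have "(\<lambda>k. ?t (Suc k)) sums S" by (rule has_sum_imp_sums)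
  then have t: "(\<lambda>k. 2 * pi * Gs / real f * (of_int (b (Suc k)) * ((R 1 - R (exp (- (2 * pi * z / real f / real (Suc k))))) / real (Suc k)))) sums S"
    by (simp only: mult.left_commute[of "of_int _"])
  obtain C where "exp_profile R R' C" by (rule exp_profile_R)
  then interpret pr: exp_profile R R' C .
  have "summable (\<lambda>k. of_int (b (Suc k)) * ((R 1 - R (exp (- (2 * pi * z / real f / real (Suc k))))) / real (Suc k)))"
  proof (rule summable_comparison_test[OF _ pr.summable_profile[of "2 * pi * z / real f"]])
    show "2 * pi * z / real f > 0" using z f_gt_1 by simp
    have "\<bar>real_of_int (b (Suc k)) * y\<bar> \<le> \<bar>y\<bar>" for k y
    proof -
      have "real_of_int \<bar>b (Suc k)\<bar> * \<bar>y\<bar> \<le> 1 * \<bar>y\<bar>" using b[of "Suc k"] by (intro mult_right_mono) (simp_all del: of_int_abs)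
      then show ?thesis by (simp add: abs_mult)
    qed
    then show "\<exists>N. \<forall>n\<ge>N. norm (of_int (b (Suc n)) * ((R 1 - R (exp (- (2 * pi * z / real f / real (Suc n))))) / real (Suc n)))
        \<le> \<bar>(R 1 - pr.F (2 * pi * z / real f / real (Suc n))) / real (Suc n)\<bar>"
      unfolding pr.F_def real_norm_def by blast
  qed
  from sums_unique2[OF t sums_mult[OF summable_sums[OF this], of "2 * pi * Gs / real f"]]
  show ?thesis using S by simp
qed

end

text \<open>The factors 1 and 0 keep the shape of \<open>lattice_sum\<close> at a = 1, h = 0. There
  the row index, which belongs to \<open>y\<close>, comes first, hence the swap.\<close>

lemma has_sum_rep:
  assumes T: "((\<lambda>(m :: int, n :: int). weight z (1 * ((of_int n + 0 * of_int m)\<^sup>2 + (sqrt 37 * of_int m)\<^sup>2))) has_sum T) (UNIV \<times> UNIV)"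
  shows "((\<lambda>n. real (rep n) * weight z (real n)) has_sum T) {0<..}"
proof -
  define q where "q = (\<lambda>(m :: int, n :: int). nat (n\<^sup>2 + 37 * m\<^sup>2))"
  have nn: "n\<^sup>2 + 37 * m\<^sup>2 \<ge> 0" for m n :: int by simp
  have val: "(case x of (m :: int, n :: int) \<Rightarrow> weight z (1 * ((of_int n + 0 * of_int m)\<^sup>2 + (sqrt 37 * of_int m)\<^sup>2))) = weight z (real (q x))" for x
    by (cases x) (simp add: q_def power_mult_distrib)
  have fib: "{x. q x = k} = prod.swap ` norm_set k" for k
  proof -
    have "(m, n) \<in> prod.swap ` norm_set k \<longleftrightarrow> q (m, n) = k" for m n
    proof -
      have "q (m, n) = k \<longleftrightarrow> n\<^sup>2 + 37 * m\<^sup>2 = int k" unfolding q_def prod.case using nn[of n m] by (metis int_nat_eq nat_int)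
      then show ?thesis by (auto simp: image_iff Bex_def norm_set_def)
    qed
    then show ?thesis by auto
  qed
  have card: "card {x. q x = k} = rep k" for k
    unfolding fib rep_def by (rule card_image) (metis inj_onI swap_swap)
  have "((\<lambda>x. weight z (real (q x))) has_sum T) UNIV" using T unfolding val by simp
  then have "((\<lambda>n. real (card {x. q x = n}) * weight z (real n)) has_sum T) UNIV"
    by (rule has_sum_fibres[where w = "\<lambda>n. weight z (real n)"]) (simp add: fib finite_norm_set)
  moreover have "((\<lambda>n. real (rep n) * weight z (real n)) has_sum T) UNIV \<longleftrightarrow> ((\<lambda>n. real (rep n) * weight z (real n)) has_sum T) {0<..}"
    by (rule has_sum_cong_neutral) (auto simp: weight_def)
  ultimately show ?thesis unfolding card by simp
qed

text \<open>At a = 2, h = 1/2 the form is 2 n^2 + 2 n m + 19 m^2. The substitution X = 2 n + m, Y =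
  m leads to representations of \<open>2 * k\<close>; it is invertible because X and Y have equal
  parity there.\<close>

lemma has_sum_rep_double:
  assumes T: "((\<lambda>(m :: int, n :: int). weight z (2 * ((of_int n + 1 / 2 * of_int m)\<^sup>2 + (sqrt 37 / 2 * of_int m)\<^sup>2))) has_sum T) (UNIV \<times> UNIV)"
  shows "((\<lambda>n. real (rep (2 * n)) * weight z (real n)) has_sum T) {0<..}"
proof -
  define q where "q = (\<lambda>(m :: int, n :: int). nat (2 * n\<^sup>2 + 2 * n * m + 19 * m\<^sup>2))"
  have id: "2 * (2 * n\<^sup>2 + 2 * n * m + 19 * m\<^sup>2) = (2 * n + m)\<^sup>2 + 37 * m\<^sup>2" for m n :: int
    by (simp add: power2_eq_square algebra_simps)
  have nn: "2 * n\<^sup>2 + 2 * n * m + 19 * m\<^sup>2 \<ge> 0" for m n :: int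
  proof -
    have "0 \<le> 2 * (2 * n\<^sup>2 + 2 * n * m + 19 * m\<^sup>2)" unfolding id by simp
    then show ?thesis by (simp only: zero_le_mult_iff) simp
  qed
  have val: "(case x of (m :: int, n :: int) \<Rightarrow> weight z (2 * ((of_int n + 1 / 2 * of_int m)\<^sup>2 + (sqrt 37 / 2 * of_int m)\<^sup>2))) = weight z (real (q x))" for x
  proof (cases x)
    case (Pair m n)
    have "real (nat (2 * n\<^sup>2 + 2 * n * m + 19 * m\<^sup>2)) = of_int (2 * n\<^sup>2 + 2 * n * m + 19 * m\<^sup>2)" using nn[of n m] by simp
    also have "\<dots> = 2 * ((of_int n + 1 / 2 * of_int m)\<^sup>2 + (sqrt 37 / 2 * of_int m)\<^sup>2)"
      by (simp add: power_mult_distrib power_divide power2_eq_square[of "of_int n + _"]) (simp add: power2_eq_square field_simps)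
    finally show ?thesis unfolding Pair q_def prod.case by simp
  qed
  have bij: "bij_betw (\<lambda>(m, n). (2 * n + m, m)) {x. q x = k} (norm_set (2 * k))" for k
  proof (rule bij_betwI[of _ _ _ "\<lambda>(X, Y). (Y, (X - Y) div 2)"])
    show "(\<lambda>(m, n). (2 * n + m, m)) \<in> {x. q x = k} \<rightarrow> norm_set (2 * k)"
    proof (intro funcsetI)
      fix x assume x: "x \<in> {x. q x = k}"
      obtain m n where mn: "x = (m, n)" by (cases x)
      have "2 * n\<^sup>2 + 2 * n * m + 19 * m\<^sup>2 = int k" using x nn[of n m] unfolding mn q_def by auto
      then show "(\<lambda>(m, n). (2 * n + m, m)) x \<in> norm_set (2 * k)" using id[of n m] by (simp add: mn)
    qed
    have par: "\<exists>n. X = 2 * n + Y" if "X\<^sup>2 + 37 * Y\<^sup>2 = int (2 * k)" for X Y :: int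
    proof -
      have "even (X\<^sup>2 + 37 * Y\<^sup>2)" unfolding that by simp
      then have "even (X - Y)" by simp
      then obtain n where "X - Y = 2 * n" by (rule evenE)
      then have "X = 2 * n + Y" by simp
      then show ?thesis ..
    qed
    show "(\<lambda>(X, Y). (Y, (X - Y) div 2)) \<in> norm_set (2 * k) \<rightarrow> {x. q x = k}"
    proof (intro funcsetI)
      fix x assume x: "x \<in> norm_set (2 * k)"
      obtain X Y where XY: "x = (X, Y)" by (cases x)
      have e: "X\<^sup>2 + 37 * Y\<^sup>2 = int (2 * k)" using x XY by simp
      obtain n where n: "X = 2 * n + Y" using par[OF e] by blast
      have "2 * n\<^sup>2 + 2 * n * Y + 19 * Y\<^sup>2 = int k" using id[of n Y] e unfolding n by simp
      then show "(\<lambda>(X, Y). (Y, (X - Y) div 2)) x \<in> {x. q x = k}" by (simp add: XY n q_def)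
    qed
    show "(\<lambda>(m, n). (2 * n + m, m)) ((\<lambda>(X, Y). (Y, (X - Y) div 2)) x) = x" if "x \<in> norm_set (2 * k)" for x
    proof -
      obtain X Y where XY: "x = (X, Y)" by (cases x)
      have e: "X\<^sup>2 + 37 * Y\<^sup>2 = int (2 * k)" using that XY by simp
      obtain n where n: "X = 2 * n + Y" using par[OF e] by blast
      show ?thesis by (simp add: XY n)
    qed
  qed auto
  have card: "card {x. q x = k} = rep (2 * k)" for k
    unfolding rep_def by (rule bij_betw_same_card[OF bij])
  have fin: "finite {x. q x = k}" for k
    using bij_betw_finite[OF bij[of k]] finite_norm_set by simp
  have "((\<lambda>x. weight z (real (q x))) has_sum T) UNIV" using T unfolding val by simp
  then have "((\<lambda>n. real (card {x. q x = n}) * weight z (real n)) has_sum T) UNIV"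
    by (rule has_sum_fibres[where w = "\<lambda>n. weight z (real n)"]) (rule fin)
  moreover have "((\<lambda>n. real (rep (2 * n)) * weight z (real n)) has_sum T) UNIV \<longleftrightarrow> ((\<lambda>n. real (rep (2 * n)) * weight z (real n)) has_sum T) {0<..}"
    by (rule has_sum_cong_neutral) (auto simp: weight_def)
  ultimately show ?thesis unfolding card by simp
qed

section \<open>The value of the theta function\<close>

theorem theorem1p3:
  shows "ramanujan_phi (exp (- pi * sqrt 37) :: real) =
           2 powr (-1/4) * 37 powr (-1/4) * pi powr (-1/4) * (6 + sqrt 37) powr (3/8) *
           (\<Prod>m = 1..148. Gamma (real m / 148) powi kronecker_symbol (-148) (int m)) powr (1/8)"
proof -
  let ?r = "sqrt 37 :: real" and ?\<gamma> = "euler_mascheroni :: real"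
  have rr: "?r * ?r = 37" "?r > 0" by simp_all
  define q where "q = exp (- pi * ?r)"
  have q: "0 < q" "q < 1" by (simp_all add: q_def)
  obtain T1 where T1: "\<And>z. z > 0 \<Longrightarrow> ((\<lambda>(m :: int, n :: int). weight z (1 * ((of_int n + 0 * of_int m)\<^sup>2 + (?r * of_int m)\<^sup>2)))
        has_sum T1 z) (UNIV \<times> UNIV)"
    and T1_lim: "((\<lambda>z. T1 z - 2 * pi / (1 * ?r) * ln z) \<longlongrightarrow>
        4 * pi / (1 * ?r) * (pi * ?r / 6 + 2 * log_euler ((if (0 :: real) = 0 then 1 else -1) * exp (- 2 * pi * ?r))
          + ?\<gamma> - ln 2 - ln (1 * ?r\<^sup>2) / 2)) at_top"
    by (rule lattice_sum[of 1 ?r 0]) (simp_all, blast)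
  obtain T2 where T2: "\<And>z. z > 0 \<Longrightarrow> ((\<lambda>(m :: int, n :: int). weight z (2 * ((of_int n + 1 / 2 * of_int m)\<^sup>2 + (?r / 2 * of_int m)\<^sup>2)))
        has_sum T2 z) (UNIV \<times> UNIV)"
    and T2_lim: "((\<lambda>z. T2 z - 2 * pi / (2 * (?r / 2)) * ln z) \<longlongrightarrow>
        4 * pi / (2 * (?r / 2)) * (pi * (?r / 2) / 6 + 2 * log_euler ((if (1 / 2 :: real) = 0 then 1 else -1) * exp (- 2 * pi * (?r / 2)))
          + ?\<gamma> - ln 2 - ln (2 * (?r / 2)\<^sup>2) / 2)) at_top"
    by (rule lattice_sum[of 2 "?r / 2" "1 / 2"]) (simp_all, blast)
  \<comment> \<open>Both lattices have \<open>a * Y = sqrt 37\<close>, hence the common factor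
    \<open>c\<close>, while \<open>a * Y\<^sup>2\<close> is 37 for the first and 37 / 2 for the
    second, hence the different logarithms.\<close>
  define X1 where "X1 = pi * ?r / 6 + 2 * log_euler (q\<^sup>2) + ?\<gamma> - ln 2 - ln 37 / 2"
  define X2 where "X2 = pi * ?r / 12 + 2 * log_euler (- q) + ?\<gamma> - ln 2 - (ln 37 - ln 2) / 2"
  define c where "c = 4 * pi / ?r"
  have c0: "c > 0" by (simp add: c_def)
  have q2: "exp (- 2 * pi * ?r) = q\<^sup>2" by (simp add: q_def power2_eq_square mult_exp_exp)
  have L1: "((\<lambda>z. T1 z - c / 2 * ln z) \<longlongrightarrow> c * X1) at_top"
    using T1_lim unfolding q2 by (simp add: c_def X1_def)
  have L2: "((\<lambda>z. T2 z - c / 2 * ln z) \<longlongrightarrow> c * X2) at_top"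
  proof -
    have "exp (- 2 * pi * (?r / 2)) = q" by (simp add: q_def)
    moreover have "ln (2 * (?r / 2)\<^sup>2) = ln 37 - ln 2" by (simp add: power_divide ln_div)
    ultimately show ?thesis using T2_lim by (simp add: c_def X2_def)
  qed
  obtain s :: real where s: "s = 1 \<or> s = -1" and G: "ev37 c37 = of_real (s * ?r)" by (rule gauss37)
  interpret c4: odd_character chi4 4 2 by (rule odd_character_chi4)
  interpret c148: odd_character chi148 148 "2 * (s * ?r)" by (rule odd_character_chi148[OF G])

  have sum_plus: "T1 z + T2 z = 2 * (2 * pi * (2 * (s * ?r)) / real 148 *
      (\<Sum>k. (c148.R 1 - c148.R (exp (- (2 * pi * z / real 148 / real (Suc k))))) / real (Suc k)))" if z: "z > 0" for z
  proof -
    let ?S = "2 * pi * (2 * (s * ?r)) / real 148 *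
      (\<Sum>k. of_int 1 * ((c148.R 1 - c148.R (exp (- (2 * pi * z / real 148 / real (Suc k))))) / real (Suc k)))"
    have "((\<lambda>(e, d). (of_int 1 * of_int (chi148 d)) * weight z (real (d * e))) has_sum ?S) ({0<..} \<times> {0<..})"
      by (rule c148.has_sum_chi_double[OF z, of "\<lambda>_. 1"]) simp
    then have "((\<lambda>n. (\<Sum>d | d dvd n. of_int 1 * of_int (chi148 d)) * weight z (real n)) has_sum ?S) {0<..}"
      by (rule has_sum_divisors[where g = "\<lambda>d e. of_int 1 * of_int (chi148 d)" and w = "\<lambda>n. weight z (real n)"])
    from has_sum_cmult_right[OF this, of 2]
    have "((\<lambda>n. 2 * ((\<Sum>d | d dvd n. of_int 1 * of_int (chi148 d)) * weight z (real n))) has_sum 2 * ?S) {0<..}" .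
    moreover have "2 * ((\<Sum>d | d dvd n. of_int 1 * of_int (chi148 d)) * weight z (real n)) =
        real (rep n) * weight z (real n) + real (rep (2 * n)) * weight z (real n)" if "n \<in> {0<..}" for n
    proof -
      have "real_of_int (int (rep n + rep (2 * n))) = of_int (2 * (\<Sum>d | d dvd n. chi148 d))"
        using rep_add[of n] that by (simp only: greaterThan_iff)
      then have "real (rep n) + real (rep (2 * n)) = 2 * (\<Sum>d | d dvd n. of_int 1 * of_int (chi148 d))" by simp
      then show ?thesis by (simp only: distrib_right[symmetric] mult.assoc[symmetric])
    qed
    ultimately have "((\<lambda>n. real (rep n) * weight z (real n) + real (rep (2 * n)) * weight z (real n)) has_sum 2 * ?S) {0<..}"
      using has_sum_cong by (metis (no_types, lifting))
    moreover have "((\<lambda>n. real (rep n) * weight z (real n) + real (rep (2 * n)) * weight z (real n)) has_sum (T1 z + T2 z)) {0<..}"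
      by (intro has_sum_add has_sum_rep[OF T1[OF z]] has_sum_rep_double[OF T2[OF z]])
    ultimately have "T1 z + T2 z = 2 * ?S" using has_sum_unique by blast
    then show ?thesis by simp
  qed

  \<comment> \<open>The odd character \<open>chi4\<close> is the one summed in closed form, and the
    even character \<open>chi37\<close> stays as a coefficient. For this \<open>d\<close> and
    \<open>n div d\<close> are exchanged in \<open>rep_diff\<close>.\<close>
  have sum_minus: "T1 z - T2 z = 2 * (2 * pi * 2 / real 4 *
      (\<Sum>k. of_int (chi37 (Suc k)) * ((c4.R 1 - c4.R (exp (- (2 * pi * z / real 4 / real (Suc k))))) / real (Suc k))))" if z: "z > 0" for z
  proof -
    let ?S = "2 * pi * 2 / real 4 *
      (\<Sum>k. of_int (chi37 (Suc k)) * ((c4.R 1 - c4.R (exp (- (2 * pi * z / real 4 / real (Suc k))))) / real (Suc k)))"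
    have "((\<lambda>(e, d). (of_int (chi37 e) * of_int (chi4 d)) * weight z (real (d * e))) has_sum ?S) ({0<..} \<times> {0<..})"
      by (rule c4.has_sum_chi_double[OF z, of chi37]) (rule chi37_bounded)
    then have "((\<lambda>n. (\<Sum>d | d dvd n. of_int (chi37 (n div d)) * of_int (chi4 d)) * weight z (real n)) has_sum ?S) {0<..}"
      by (rule has_sum_divisors[where g = "\<lambda>d e. of_int (chi37 e) * of_int (chi4 d)" and w = "\<lambda>n. weight z (real n)"])
    from has_sum_cmult_right[OF this, of 2]
    have "((\<lambda>n. 2 * ((\<Sum>d | d dvd n. of_int (chi37 (n div d)) * of_int (chi4 d)) * weight z (real n))) has_sum 2 * ?S) {0<..}" .
    moreover have "2 * ((\<Sum>d | d dvd n. of_int (chi37 (n div d)) * of_int (chi4 d)) * weight z (real n)) =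
        real (rep n) * weight z (real n) + - (real (rep (2 * n)) * weight z (real n))" if "n \<in> {0<..}" for n
    proof -
      have n0: "n > 0" using that by simp
      have "(\<Sum>d | d dvd n. chi37 (n div d) * chi4 d) = (\<Sum>d | d dvd n. chi37 d * chi4 (n div d))"
        by (rule sum.reindex_bij_witness[of _ "\<lambda>d. n div d" "\<lambda>d. n div d"])
          (use n0 in \<open>auto simp: div_div_eq_right elim!: dvdE\<close>)
      then have "real_of_int (int (rep n) - int (rep (2 * n))) = of_int (2 * (\<Sum>d | d dvd n. chi37 (n div d) * chi4 d))"
        using rep_diff[OF n0] by simp
      then have "real (rep n) - real (rep (2 * n)) = 2 * (\<Sum>d | d dvd n. of_int (chi37 (n div d)) * of_int (chi4 d))" by simp
      then have "(real (rep n) - real (rep (2 * n))) * weight z (real n) =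
          2 * (\<Sum>d | d dvd n. of_int (chi37 (n div d)) * of_int (chi4 d)) * weight z (real n)" by simp
      then show ?thesis by (simp only: left_diff_distrib mult.assoc add_uminus_conv_diff)
    qed
    ultimately have "((\<lambda>n. real (rep n) * weight z (real n) + - (real (rep (2 * n)) * weight z (real n))) has_sum 2 * ?S) {0<..}"
      using has_sum_cong by (metis (no_types, lifting))
    moreover have "((\<lambda>n. real (rep n) * weight z (real n) + - (real (rep (2 * n)) * weight z (real n))) has_sum (T1 z + - T2 z)) {0<..}"
      by (intro has_sum_add has_sum_uminusI has_sum_rep[OF T1[OF z]] has_sum_rep_double[OF T2[OF z]])
    ultimately have "T1 z + - T2 z = 2 * ?S" using has_sum_unique by blast
    then show ?thesis by simp
  qed

  have diff: "X1 - X2 = ln (6 + ?r) / 2"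
  proof -
    have R4: "c4.R x = x / (1 + x\<^sup>2)" if x: "x \<ge> 0" for x
    proof -
      have s4: "{..<4 :: nat} = {0, 1, 2, 3}" "{..0 :: nat} = {0}" "{..1 :: nat} = {0, 1}" "{..2 :: nat} = {0, 1, 2}" "{..3 :: nat} = {0, 1, 2, 3}"
        by auto
      have "c4.R x = (x + x\<^sup>2) / (1 + x + x\<^sup>2 + x ^ 3)"
        unfolding c4.R_def c4.P1_def c4.Dn_def c4.psum_def s4 by (simp add: s4 chi4_altdef)
      also have "\<dots> = (x * (1 + x)) / ((1 + x\<^sup>2) * (1 + x))"
        by (simp add: power2_eq_square power3_eq_cube algebra_simps)
      also have "\<dots> = x / (1 + x\<^sup>2)" using x by (intro mult_divide_mult_cancel_right) simp
      finally show ?thesis .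
    qed
    have mono: "x / (1 + x\<^sup>2) \<le> y / (1 + y\<^sup>2)" if xy: "0 \<le> x" "x \<le> y" "y \<le> 1" for x y :: real
    proof -
      have "x * y \<le> 1 * 1" using xy by (intro mult_mono) auto
      then have "0 \<le> (y - x) * (1 - x * y)" using xy by simp
      then have "x * (1 + y\<^sup>2) \<le> y * (1 + x\<^sup>2)" by (simp add: algebra_simps power2_eq_square)
      moreover have "1 + x\<^sup>2 > 0" "1 + y\<^sup>2 > 0" by (simp_all add: add_pos_nonneg)
      ultimately show ?thesis by (simp add: divide_le_eq le_divide_eq field_simps)
    qed
    define u where "u = (\<lambda>(k :: nat) (z :: real). exp (- (2 * pi * z / real 4 / real (Suc k))))"
    \<comment> \<open>Since \<open>c4.R x\<close> is \<open>x / (1 + x\<^sup>2)\<close> with value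
      1/2 at 1, \<open>v\<close> is twice the term of the series. It decreases in \<open>k\<close>,
      because that function increases on the unit interval, and tends to the term 1 / (k + 1) of
      L(1).\<close>
    define v where "v = (\<lambda>k z. (1 - 2 * (u k z / (1 + (u k z)\<^sup>2))) / real (Suc k))"
    have lim: "((\<lambda>z. \<Sum>k. of_int (chi37 (Suc k)) * v k z) \<longlongrightarrow> L37) at_top"
      unfolding L37_def
    proof (rule tendsto_sum_bounded_partials[OF chi37_Suc_partial_sums, where P = "{0<..}" and C = 1])
      fix z :: real and k assume "z \<in> {0<..}"
      then have z: "z > 0" by simp
      have u: "0 \<le> u k z" "u k z \<le> u (Suc k) z" "u (Suc k) z \<le> 1"
        using z by (auto simp: u_def intro!: frac_le)
      have b: "0 \<le> x / (1 + x\<^sup>2)" "2 * (x / (1 + x\<^sup>2)) \<le> 1" if "0 \<le> x" "x \<le> 1" for x :: real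
        using mono[OF that] that by (auto simp: add_nonneg_nonneg mult.commute)
      show "v (Suc k) z \<le> v k z"
        unfolding v_def using b[of "u k z"] b[of "u (Suc k) z"] mono[OF u] u by (intro frac_le) auto
      show "0 \<le> v k z" unfolding v_def using b[of "u k z"] u by (intro divide_nonneg_pos) auto
      show "v k z \<le> 1 / real (Suc k)" unfolding v_def using b[of "u k z"] u by (intro divide_right_mono) auto
    next
      show "\<forall>\<^sub>F z in at_top. (z :: real) \<in> {0<..}" using eventually_gt_at_top[of 0] by simp
      show "(v k \<longlongrightarrow> 1 / real (Suc k)) at_top" for k
      proof -
        have "(u k \<longlongrightarrow> 0) at_top" unfolding u_def by real_asymp
        then have "(v k \<longlongrightarrow> (1 - 2 * (0 / (1 + 0\<^sup>2))) / real (Suc k)) at_top"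
          unfolding v_def by (intro tendsto_intros) auto
        then show ?thesis by simp
      qed
    qed simp
    have "T1 z - T2 z = pi * (\<Sum>k. of_int (chi37 (Suc k)) * v k z)" if z: "z > 0" for z
    proof -
      have "2 * (of_int (chi37 (Suc k)) * ((c4.R 1 - c4.R (u k z)) / real (Suc k))) = of_int (chi37 (Suc k)) * v k z" for k
        using R4[of 1] R4[of "u k z"] by (simp add: v_def u_def field_simps)
      moreover have "2 * (\<Sum>k. of_int (chi37 (Suc k)) * ((c4.R 1 - c4.R (u k z)) / real (Suc k))) =
          (\<Sum>k. 2 * (of_int (chi37 (Suc k)) * ((c4.R 1 - c4.R (u k z)) / real (Suc k))))"
      proof (rule suminf_mult[symmetric])
        obtain C where "exp_profile c4.R c4.R' C" by (rule c4.exp_profile_R)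
        then interpret pr: exp_profile c4.R c4.R' C .
        show "summable (\<lambda>k. of_int (chi37 (Suc k)) * ((c4.R 1 - c4.R (u k z)) / real (Suc k)))"
        proof (rule summable_comparison_test[OF _ pr.summable_profile[of "2 * pi * z / real 4"]])
          have "\<bar>real_of_int (chi37 (Suc k)) * y\<bar> \<le> \<bar>y\<bar>" for k y
          proof -
            have "real_of_int \<bar>chi37 (Suc k)\<bar> * \<bar>y\<bar> \<le> 1 * \<bar>y\<bar>"
              using chi37_bounded[of "Suc k"] by (intro mult_right_mono) (simp_all del: of_int_abs)
            then show ?thesis by (simp add: abs_mult)
          qed
          then show "\<exists>N. \<forall>n\<ge>N. norm (of_int (chi37 (Suc n)) * ((c4.R 1 - c4.R (u n z)) / real (Suc n))) \<le>
              \<bar>(c4.R 1 - pr.F (2 * pi * z / real 4 / real (Suc n))) / real (Suc n)\<bar>"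
            unfolding pr.F_def real_norm_def u_def by blast
        qed (use z in simp)
      qed
      moreover have "T1 z - T2 z = pi * (2 * (\<Sum>k. of_int (chi37 (Suc k)) * ((c4.R 1 - c4.R (u k z)) / real (Suc k))))"
        unfolding sum_minus[OF z] u_def by simp
      ultimately show ?thesis by simp
    qed
    then have "((\<lambda>z. T1 z - T2 z) \<longlongrightarrow> pi * L37) at_top"
      by (intro Lim_transform_eventually[OF tendsto_mult[OF tendsto_const lim]] eventually_mono[OF eventually_gt_at_top[of 0]]) simp
    moreover have "((\<lambda>z. T1 z - T2 z) \<longlongrightarrow> c * X1 - c * X2) at_top"
      using tendsto_diff[OF L1 L2] by simp
    ultimately have "pi * L37 = c * X1 - c * X2" by (rule tendsto_unique[rotated]) simp
    then have "c * (X1 - X2) = pi * L37" by (simp only: right_diff_distrib)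
    also have "\<dots> = c * (ln (6 + ?r) / 2)" unfolding L37_eq by (simp add: c_def)
    finally have "c * (X1 - X2) = c * (ln (6 + ?r) / 2)" .
    then show ?thesis using c0 by simp
  qed

  define A where "A = (\<Sum>m\<in>{1..<148}. of_int (chi148 m) * ln (Gamma (real m / real 148)))"
  have plus: "X1 + X2 = 2 * ?\<gamma> - A / 2 + ln (2 * pi)"
  proof -
    obtain C where "exp_profile c148.R c148.R' C" by (rule c148.exp_profile_R)
    then interpret pr: exp_profile c148.R c148.R' C .
    obtain K K0 where K: "\<And>t. t > 0 \<Longrightarrow> (K has_real_derivative - (pr.F t / t)) (at t)"
      "(K \<longlongrightarrow> 0) at_top" "((\<lambda>t. K t + c148.R 1 * ln t) \<longlongrightarrow> K0) (at_right 0)"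
      using pr.F_antiderivative by blast
    have R1: "c148.R 1 = 2"
    proof -
      have "(\<Sum>m<148. real_of_int (chi148 m) * real m) = of_int (\<Sum>m<148. chi148 m * int m)" by simp
      then show ?thesis unfolding c148.R_1 sum_chi148 by simp
    qed
    have A: "A = K0 + 2 * (ln 148 + ?\<gamma>)"
      using c148.gamma_sum[OF K(1)[unfolded pr.F_def] K(2,3)] by (simp add: A_def R1)
    define S where "S = (\<lambda>a. \<Sum>k. (c148.R 1 - pr.F (a / real (Suc k))) / real (Suc k))"
    define a where "a = (\<lambda>z. 2 * pi * z / real 148)"
    have "((\<lambda>a. S a - 2 * ln a) \<longlongrightarrow> 2 * ?\<gamma> - K0) at_top"
      using pr.profile_sum_asymptotics[OF K] by (simp add: S_def R1)
    moreover have "filterlim a at_top at_top" unfolding a_def by real_asymp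
    ultimately have S: "((\<lambda>z. S (a z) - 2 * ln (a z)) \<longlongrightarrow> 2 * ?\<gamma> - K0) at_top"
      by (rule filterlim_compose)
    \<comment> \<open>The prefactor simplifies by 148 = 4 * 37. With \<open>c148.R 1 = 2\<close> the
      right-hand side grows like s c ln z, whereas the two lattice sums together grow like c ln
      z.\<close>
    have T: "T1 z + T2 z = s * (c / 2) * S (a z)" if z: "z > 0" for z
    proof -
      have "2 * (2 * pi * (2 * (s * ?r)) / real 148) = s * (c / 2)"
        using rr by (simp add: c_def field_simps)
      then show ?thesis unfolding sum_plus[OF z] S_def a_def pr.F_def by (simp only: mult.assoc[symmetric])
    qed
    have "((\<lambda>z. (T1 z - c / 2 * ln z) + (T2 z - c / 2 * ln z) - s * (c / 2) * (S (a z) - 2 * ln (a z)) - s * c * ln (2 * pi / 148))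
        \<longlongrightarrow> c * X1 + c * X2 - s * (c / 2) * (2 * ?\<gamma> - K0) - s * c * ln (2 * pi / 148)) at_top"
      by (intro tendsto_diff tendsto_add tendsto_mult tendsto_const L1 L2 S[unfolded tendsto_diff])
    then have lim: "((\<lambda>z. (s - 1) * c * ln z) \<longlongrightarrow> c * X1 + c * X2 - s * (c / 2) * (2 * ?\<gamma> - K0) - s * c * ln (2 * pi / 148)) at_top"
    proof (rule Lim_transform_eventually[OF _ eventually_mono[OF eventually_gt_at_top[of 0]]])
      fix z :: real assume z: "0 < z"
      have "a z = (2 * pi / 148) * z" by (simp add: a_def)
      moreover have "ln ((2 * pi / 148) * z) = ln (2 * pi / 148) + ln z"
        by (rule ln_mult_pos) (use z in simp_all)
      ultimately have la: "ln (a z) = ln (2 * pi / 148) + ln z" by (simp only:)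
      have "T1 z + T2 z = s * (c / 2) * S (a z)" by (rule T[OF z])
      then have "(T1 z - c / 2 * ln z) + (T2 z - c / 2 * ln z) = s * (c / 2) * S (a z) - c * ln z" by simp
      then show "(T1 z - c / 2 * ln z) + (T2 z - c / 2 * ln z) - s * (c / 2) * (S (a z) - 2 * ln (a z)) - s * c * ln (2 * pi / 148) =
          (s - 1) * c * ln z"
        unfolding la by (simp add: algebra_simps)
    qed
    txt \<open>The logarithmic growth of the two sides determines the sign of the Gauss sum.\<close>
    have s1: "s = 1"
    proof (rule ccontr)
      assume "s \<noteq> 1"
      define l where "l = c * X1 + c * X2 - s * (c / 2) * (2 * ?\<gamma> - K0) - s * c * ln (2 * pi / 148)"
      have "((\<lambda>z. (1 / ((s - 1) * c)) * ((s - 1) * c * ln z)) \<longlongrightarrow> (1 / ((s - 1) * c)) * l) at_top"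
        unfolding l_def by (rule tendsto_mult[OF tendsto_const lim])
      moreover have "(1 / ((s - 1) * c)) * ((s - 1) * c * x) = x" for x
        using c0 \<open>s \<noteq> 1\<close> by simp
      ultimately have "((\<lambda>z. ln z) \<longlongrightarrow> (1 / ((s - 1) * c)) * l) at_top" by (simp only:)
      moreover have "filterlim (ln :: real \<Rightarrow> real) at_infinity at_top"
        by (rule filterlim_at_top_imp_at_infinity[OF ln_at_top])
      ultimately show False by (rule not_tendsto_and_filterlim_at_infinity[OF trivial_limit_at_top_linorder])
    qed
    have "((\<lambda>z :: real. 0) \<longlongrightarrow> c * X1 + c * X2 - (c / 2) * (2 * ?\<gamma> - K0) - c * ln (2 * pi / 148)) at_top"
      using lim by (simp add: s1)
    then have "c * X1 + c * X2 - (c / 2) * (2 * ?\<gamma> - K0) - c * ln (2 * pi / 148) = 0"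
      by (rule tendsto_unique[OF _ _ tendsto_const, rotated]) simp
    moreover have "c * X1 + c * X2 - (c / 2) * u - c * v = c * (X1 + X2 - (u / 2 + v))" for u v :: real
      by (simp add: field_simps)
    ultimately have "c * (X1 + X2 - ((2 * ?\<gamma> - K0) / 2 + ln (2 * pi / 148))) = 0" by (simp only:)
    then have "X1 + X2 = (2 * ?\<gamma> - K0) / 2 + ln (2 * pi / 148)" using c0 by (simp only: mult_eq_0_iff) simp
    also have "ln (2 * pi / 148) = ln (2 * pi) - ln 148" by (subst ln_div) simp_all
    finally show ?thesis using A by (simp add: field_simps)
  qed

  have prod: "(\<Prod>m = 1..148. Gamma (real m / 148) powi kronecker_symbol (-148) (int m)) = exp A"
  proof -
    have "Gamma (real m / 148) powi kronecker_symbol (-148) (int m) = exp (of_int (chi148 m) * ln (Gamma (real m / real 148)))"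
      if m: "m \<in> {1..148}" for m
    proof -
      have "Gamma (real m / real 148) > 0" using m by (intro Gamma_real_pos) auto
      then have "exp (ln (Gamma (real m / real 148))) powi chi148 m = Gamma (real m / real 148) powi chi148 m" by simp
      then show ?thesis using kronecker_eq_chi148[of m] m by (simp add: exp_power_int)
    qed
    then have "(\<Prod>m = 1..148. Gamma (real m / 148) powi kronecker_symbol (-148) (int m)) =
        exp (\<Sum>m = 1..148. of_int (chi148 m) * ln (Gamma (real m / real 148)))"
      by (simp add: exp_sum)
    also have "(\<Sum>m = 1..148. of_int (chi148 m) * ln (Gamma (real m / real 148))) = A"
    proof -
      \<comment> \<open>The product includes m = 148, which \<open>gamma_sum\<close> leaves out; its
        exponent is zero.\<close>
      have "{1..148 :: nat} = insert 148 {1..<148}" by auto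
      moreover have "chi148 148 = 0" by (simp add: chi148_def chi4_def)
      ultimately show ?thesis by (simp add: A_def)
    qed
    finally show ?thesis .
  qed

  \<comment> \<open>In this combination the multiples of \<pi> \<surd>37 and of ln 2 cancel, and
    what remains is the exponent of \<open>theta_product\<close>. Euler's constant cancels
    afterwards against the one in \<open>plus\<close>.\<close>
  have "X1 / 2 - X2 = log_euler (q\<^sup>2) - 2 * log_euler (- q) - ?\<gamma> / 2 + ln 37 / 4"
    unfolding X1_def X2_def by (simp add: field_simps)
  moreover have "X1 / 2 - X2 = - (X1 + X2) / 4 + 3 / 4 * (X1 - X2)" by argo
  ultimately have "log_euler (q\<^sup>2) - 2 * log_euler (- q) = A / 8 - ln (2 * pi) / 4 - ln 37 / 4 + 3 / 8 * ln (6 + ?r)"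
    unfolding plus diff by (simp add: field_simps)
  also have "ln (2 * pi) = ln 2 + ln pi" by (rule ln_mult_pos) simp_all
  finally have "log_euler (q\<^sup>2) - 2 * log_euler (- q) =
      (-1/4) * ln 2 + (-1/4) * ln 37 + (-1/4) * ln pi + (3/8) * ln (6 + ?r) + (1/8) * A" by argo
  then have "ramanujan_phi q = exp ((-1/4) * ln 2 + (-1/4) * ln 37 + (-1/4) * ln pi + (3/8) * ln (6 + ?r) + (1/8) * A)"
    using theta_product[OF q] by simp
  also have "\<dots> = 2 powr (-1/4) * 37 powr (-1/4) * pi powr (-1/4) * (6 + ?r) powr (3/8) * exp A powr (1/8)"
  proof -
    have "6 + ?r > 0" using rr(2) by linarith
    then show ?thesis unfolding exp_add powr_def by simp
  qed
  finally show ?thesis unfolding prod q_def .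
qed

end
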